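(* For every $-1<b<0$, $$A(b)=\sup\{a\in(0,3+b):\Psi_b(a)\ge 0\}=\sup\left\{a\in(0,3+b):\inf_{t\ge 0}D_{a,-b}(t)\ge 0\right\}.$$ Moreover, $$\Psi_b(a)>0\quad(0<a<A(b)),\qquad \Psi_b(A(b))=0,$$ and, whenever $A(b)<a<3+b$, $$\Psi_b(a)<0 .$$ At $a=A(b)$ the infimum $\inf_{t\ge0}D_{A(b),-b}(t)$ is attained at at least one positive argument.
   Context: A function $g\in C^\infty(0,\infty)$ is completely monotone if $(-1)^n g^{(n)}\ge 0$ on $(0,\infty)$ for every integer $n\ge 0$. A nonnegative smooth function $f$ on $(0,\infty)$ is a Bernstein function if $f'$ is completely monotone. For $a>0$, $b\in\mathbb{R}$, $x>0$: $F_{a,b}(x)=\left(1+\frac{a}{x}\right)^{x+b}$. For $-1<b\le 0$, $A(b)=\sup\{a>0: F_{a,b}\text{ is a Bernstein function}\}$ (this set is nonempty and bounded above). For $a>0$, $0\le c<1$, $a+c<3$, put $$w_{a,c}(s)=\frac1\pi\left(\frac{s}{1-s}\right)^{as+c}\sin\bigl(\pi(as+c)\bigr)\quad(0<s<1),$$ $$q_1=\frac a2+c,\qquad q_2=\frac a3+\frac c2+\frac12\left(\frac a2+c\right)^2,$$ $$D_{a,c}(t)=q_1+(q_1-q_2)t+e^{-a}\int_0^1 w_{a,c}(s)\bigl[e^{(1-s)t}-1-(1-s)t\bigr]\,ds .$$ For fixed $-1<b<0$ and $0<a<3+b$, define $\Psi_b(a)=\inf_{t\ge 0}D_{a,-b}(t)$.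 *)

theory Defs
  imports "HOL-Analysis.Analysis"
begin

text \<open>
  Smoothness of \<open>g\<close> on the half-line is expressed as differentiability of all iterated
  derivatives at all positive points. The half-line is open, so \<open>(deriv ^^ n) g x\<close> for
  \<open>x > 0\<close> depends only on the values of \<open>g\<close> on the half-line.
\<close>

definition smooth_pos :: "(real \<Rightarrow> real) \<Rightarrow> bool" where
  "smooth_pos g \<longleftrightarrow> (\<forall>n. \<forall>x>0. (deriv ^^ n) g differentiable (at x))"

definition completely_monotone :: "(real \<Rightarrow> real) \<Rightarrow> bool" where
  "completely_monotone g \<longleftrightarrow>
     smooth_pos g \<and> (\<forall>n. \<forall>x>0. (-1) ^ n * (deriv ^^ n) g x \<ge> 0)"

definition bernstein_function :: "(real \<Rightarrow> real) \<Rightarrow> bool" where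
  "bernstein_function f \<longleftrightarrow>
     smooth_pos f \<and> (\<forall>x>0. f x \<ge> 0) \<and> completely_monotone (deriv f)"

definition F :: "real \<Rightarrow> real \<Rightarrow> real \<Rightarrow> real" where
  "F a b x = (1 + a / x) powr (x + b)"

definition A :: "real \<Rightarrow> real" where
  "A b = Sup {a. a > 0 \<and> bernstein_function (F a b)}"

definition w :: "real \<Rightarrow> real \<Rightarrow> real \<Rightarrow> real" where
  "w a c s = (1 / pi) * (s / (1 - s)) powr (a * s + c) * sin (pi * (a * s + c))"

definition q1 :: "real \<Rightarrow> real \<Rightarrow> real" where
  "q1 a c = a / 2 + c"

definition q2 :: "real \<Rightarrow> real \<Rightarrow> real" where
  "q2 a c = a / 3 + c / 2 + (1 / 2) * (a / 2 + c)\<^sup>2"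

text \<open>
  The integrand below is absolutely integrable for \<open>a > 0\<close>, \<open>0 \<le> c < 1\<close>, \<open>a + c < 3\<close>:
  near \<open>s = 1\<close> the bracket is of order \<open>(1 - s)\<^sup>2\<close>.
\<close>

definition D :: "real \<Rightarrow> real \<Rightarrow> real \<Rightarrow> real" where
  "D a c t = q1 a c + (q1 a c - q2 a c) * t
     + exp (- a) *
       (LINT s:{0<..<1}|lborel. w a c s * (exp ((1 - s) * t) - 1 - (1 - s) * t))"

text \<open>
  The infimum is taken in the extended reals, so that it has its usual meaning without a
  prior proof that \<open>D a (- b)\<close> is bounded below.
\<close>

definition Psi :: "real \<Rightarrow> real \<Rightarrow> ereal" where
  "Psi b a = (INF t\<in>{0..}. ereal (D a (- b) t))"

end

theory Submission
  imports Defs "HOL-Complex_Analysis.Complex_Analysis" "HOL-Real_Asymp.Real_Asymp"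
begin

text \<open>
  Put \<open>c = - b\<close> and \<open>E y = F a (- c) (a * y) = exp ((a * y - c) * ln (1 + 1 / y))\<close>. This function is
  analytic at infinity with value \<open>exp a\<close>. Hence there is an entire function \<open>\<phi> = E_density a c\<close> such
  that \<open>exp (- a) * E y\<close> is one minus the Laplace transform of \<open>\<phi>\<close> at all large \<open>y\<close>. The set of
  parameters that defines \<open>A b\<close>, the function \<open>D\<close> and the infimum \<open>Psi\<close> are all governed by the sign
  of \<open>\<phi>\<close>.

  First, \<open>F a (- c)\<close> is a Bernstein function if and only if \<open>\<phi>\<close> is nonnegative on the half-line
  (\<open>bernstein_F_iff\<close>). Laplace inversion recovers \<open>\<phi>\<close> from the derivatives of \<open>F\<close> at large
  arguments. Conversely, a nonnegative \<open>\<phi>\<close> gives these derivatives the right signs at large arguments,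
  and Taylor expansion to the left carries the signs to the whole half-line.

  Second, \<open>D a c t = exp t * \<phi> t\<close> for \<open>a + c < 3\<close> (\<open>D_eq_density\<close>). This is Cauchy's theorem for \<open>E\<close>
  times the bracket in \<open>D\<close> on a half disc: the boundary values on the cut \<open>{-1..0}\<close> of \<open>E\<close> produce the weight
  \<open>w\<close>, and the arc produces the Taylor coefficients at infinity, which are those of \<open>\<phi>\<close>.

  Third, the sign of \<open>\<phi>\<close> is monotone in \<open>a\<close>. Differentiating \<open>E\<close> in \<open>y\<close> and in \<open>a\<close> yields
  two convolution equations, \<open>t * \<phi> = \<nu> - \<nu> * \<phi>\<close> and \<open>d\<phi>/da = \<kappa> - \<kappa> * \<phi>\<close>, with explicit
  positive kernels. As \<open>\<kappa> / \<nu>\<close> decreases, they combine to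
  \<open>d\<phi>/da (t) = \<rho> * t * \<phi> t - (integral of \<phi> against a positive weight on {0..t})\<close> with
  \<open>\<rho> > 0\<close> (\<open>flow_identity\<close>). So nonnegativity for one \<open>a\<close> implies nonnegativity for all smaller
  \<open>a\<close> by a maximum principle (\<open>nonneg_propagates_down\<close>), and even strict positivity, since at
  a zero the derivative in \<open>a\<close> would be negative (\<open>E_density_pos_down\<close>).

  The admissible parameters thus form an interval \<open>{0<..A b}\<close>, closed at the right end by continuity.
  It contains \<open>1 - c\<close>, where \<open>w\<close> is nonnegative. It ends before \<open>3 - c\<close>: the maximum principle also
  works along the line \<open>a + c = 3\<close> for arguments up to 3, and at \<open>(a, c) = (3, 0)\<close> the density is negative
  at 3 (\<open>E_density_neg_on_diagonal\<close>). Finally, \<open>D a c t\<close> is at least 1 for large \<open>t\<close>,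
  uniformly for \<open>a\<close> away from \<open>3 - c\<close> (\<open>D_eventually_ge_1\<close>). Therefore \<open>Psi\<close> is
  positive below \<open>A b\<close>, and the arguments of negative values for \<open>a\<close> just above \<open>A b\<close> accumulate at a
  zero of \<open>D (A b) c\<close>. This zero is positive because \<open>D a c 0 = a / 2 + c\<close>.
\<close>

section \<open>Exponential generating functions and their convolution\<close>

definition egf :: "(nat \<Rightarrow> real) \<Rightarrow> real \<Rightarrow> real" where
  "egf x t = (\<Sum>n. x n * t ^ n / fact n)"

text \<open>
  Such sequences have an entire exponential generating function \<open>egf x\<close> of exponential type,
  whose Laplace transform is \<open>\<Sum>j. x j / y ^ (j + 1)\<close> for \<open>y > M\<close>.
\<close>

definition geo_bounded :: "real \<Rightarrow> real \<Rightarrow> (nat \<Rightarrow> real) \<Rightarrow> bool" where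
  "geo_bounded C M x \<longleftrightarrow> 0 < M \<and> (\<forall>n. \<bar>x n\<bar> \<le> C * M ^ n)"

lemma exp_series_summable: "summable (\<lambda>n. (t::real) ^ n / fact n)"
  using summable_exp[of t] by (simp add: field_simps)

lemma exp_series_sums: "(\<lambda>n. (t::real) ^ n / fact n) sums exp t"
  using exp_converges[of t] by (simp add: field_simps scaleR_conv_of_real)

lemma geo_bounded_term:
  assumes "geo_bounded C M x"
  shows "\<bar>x n * t ^ n / fact n\<bar> \<le> C * ((M * \<bar>t\<bar>) ^ n / fact n)"
proof -
  have "\<bar>x n * t ^ n / fact n\<bar> = \<bar>x n\<bar> * (\<bar>t\<bar> ^ n / fact n)"
    by (simp add: abs_mult power_abs)
  also have "\<dots> \<le> C * M ^ n * (\<bar>t\<bar> ^ n / fact n)"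
    using assms by (intro mult_right_mono) (auto simp: geo_bounded_def)
  finally show ?thesis by (simp add: power_mult_distrib)
qed

lemma egf_summable_norm:
  assumes "geo_bounded C M x"
  shows "summable (\<lambda>n. norm (x n * t ^ n / fact n))"
proof (rule summable_comparison_test')
  show "summable (\<lambda>n. C * ((M * \<bar>t\<bar>) ^ n / fact n))"
    by (intro summable_mult exp_series_summable)
  show "norm (norm (x n * t ^ n / fact n)) \<le> C * ((M * \<bar>t\<bar>) ^ n / fact n)" for n
    using geo_bounded_term[OF assms, of n t] by simp
qed

lemma egf_sums:
  assumes "geo_bounded C M x"
  shows "(\<lambda>n. x n * t ^ n / fact n) sums egf x t"
  using summable_norm_cancel[OF egf_summable_norm[OF assms, of t]]
  unfolding egf_def by (rule summable_sums)

lemma egf_0 [simp]: "egf x 0 = x 0"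
  unfolding egf_def using powser_zero[of "\<lambda>n. x n / fact n"] by simp

lemma egf_continuous_on:
  assumes "geo_bounded C M x"
  shows "continuous_on S (egf x)"
proof -
  have "isCont (egf x) t" for t
  proof -
    have "summable (\<lambda>n. (x n / fact n) * (\<bar>t\<bar> + 1) ^ n)"
      using summable_norm_cancel[OF egf_summable_norm[OF assms, of "\<bar>t\<bar> + 1"]] by simp
    from isCont_powser[OF this, of t] show ?thesis by (simp add: egf_def[abs_def])
  qed
  thus ?thesis by (intro continuous_at_imp_continuous_on) auto
qed

lemma geo_bounded_mono:
  assumes "geo_bounded C M x" "C \<le> C'" "M \<le> M'"
  shows "geo_bounded C' M' x"
proof -
  have M: "M > 0" and le: "\<bar>x n\<bar> \<le> C * M ^ n" for n
    using assms by (auto simp: geo_bounded_def)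
  have C: "C \<ge> 0" using le[of 0] abs_ge_zero[of "x 0"] by (simp del: abs_ge_zero)
  have "C * M ^ n \<le> C' * M' ^ n" for n
    using assms M C by (intro mult_mono power_mono) auto
  thus ?thesis using M assms(3) le unfolding geo_bounded_def
    by (auto intro: order_trans)
qed

text \<open>
  Divided powers are closed under convolution. Integration by parts moves one power from the
  right factor to the left one; at the end only \<open>t - s\<close> is left.
\<close>

lemma beta_integral_divided_powers:
  assumes "t \<ge> (0::real)"
  shows "((\<lambda>s. (t - s) ^ i / fact i * (s ^ j / fact j)) has_integral
           t ^ (i + j + 1) / fact (i + j + 1)) {0..t}"
proof (induction j arbitrary: i)
  case 0
  define G where "G = (\<lambda>s. - ((t - s) ^ Suc i / fact (Suc i)))"
  have "(G has_vector_derivative (t - s) ^ i / fact i) (at s within {0..t})" for s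
    unfolding G_def has_real_derivative_iff_has_vector_derivative [symmetric]
    by (rule derivative_eq_intros refl | simp add: divide_simps)+
  hence "((\<lambda>s. (t - s) ^ i / fact i) has_integral G t - G 0) {0..t}"
    using assms by (intro fundamental_theorem_of_calculus) auto
  thus ?case by (simp add: G_def)
next
  case (Suc j)
  define G where "G = (\<lambda>s. (t - s) ^ Suc i / fact (Suc i) * (s ^ Suc j / fact (Suc j)))"
  have D: "(G has_vector_derivative ((t - s) ^ Suc i / fact (Suc i) * (s ^ j / fact j)
           - (t - s) ^ i / fact i * (s ^ Suc j / fact (Suc j)))) (at s within {0..t})" for s
  proof -
    have 1: "((\<lambda>s. (t - s) ^ Suc i / fact (Suc i)) has_real_derivative - ((t - s) ^ i / fact i))
        (at s within {0..t})"
      by (rule derivative_eq_intros refl | simp add: divide_simps)+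
    have 2: "((\<lambda>s. s ^ Suc j / fact (Suc j)) has_real_derivative (s ^ j / fact j))
        (at s within {0..t})"
      by (rule derivative_eq_intros refl | simp add: divide_simps)+
    show ?thesis
      using DERIV_mult[OF 1 2] unfolding G_def has_real_derivative_iff_has_vector_derivative [symmetric]
      by (simp add: algebra_simps)
  qed
  have "((\<lambda>s. (t - s) ^ Suc i / fact (Suc i) * (s ^ j / fact j)
           - (t - s) ^ i / fact i * (s ^ Suc j / fact (Suc j))) has_integral G t - G 0) {0..t}"
    using assms D by (intro fundamental_theorem_of_calculus) auto
  moreover have "G t - G 0 = 0" by (simp add: G_def)
  ultimately have "((\<lambda>s. (t - s) ^ Suc i / fact (Suc i) * (s ^ j / fact j)
           - (t - s) ^ i / fact i * (s ^ Suc j / fact (Suc j))) has_integral 0) {0..t}"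
    by (simp only:)
  from has_integral_diff[OF Suc.IH[of "Suc i"] this] show ?case
    by (simp add: algebra_simps)
qed

text \<open>
  Convolution of exponential generating functions is the Cauchy product of the coefficients,
  shifted by one place. The binomial theorem bounds the \<open>n\<close>-th term of the Cauchy product of
  the two series uniformly by a multiple of \<open>(L * t) ^ n / fact n\<close>, so that it may be
  integrated term by term.
\<close>

lemma egf_convolution:
  assumes x: "geo_bounded C M x" and y: "geo_bounded C' M' y" and t: "t \<ge> 0"
  shows "((\<lambda>s. egf x (t - s) * egf y s) has_integral
           (\<Sum>n. (\<Sum>i\<le>n. x i * y (n - i)) * t ^ (n + 1) / fact (n + 1))) {0..t}"
proof -
  define B L where "B = max C C'" and "L = max M M'"
  have xB: "geo_bounded B L x" by (rule geo_bounded_mono[OF x]) (simp_all add: B_def L_def)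
  have yB: "geo_bounded B L y" by (rule geo_bounded_mono[OF y]) (simp_all add: B_def L_def)
  have "\<bar>x 0\<bar> \<le> B * L ^ 0" using xB unfolding geo_bounded_def by blast
  hence B0: "B \<ge> 0" by simp
  have L: "L > 0" using xB by (simp add: geo_bounded_def)
  define f where "f = (\<lambda>n s. \<Sum>i\<le>n. (x i * (t - s) ^ i / fact i) * (y (n - i) * s ^ (n - i) / fact (n - i)))"
  have sums: "(\<lambda>n. f n s) sums (egf x (t - s) * egf y s)" for s
    using Cauchy_product_sums[OF egf_summable_norm[OF x, of "t - s"] egf_summable_norm[OF y, of s]]
    by (simp add: f_def egf_def)
  have bound: "norm (f n s) \<le> B * B * ((L * t) ^ n / fact n)" if s: "s \<in> {0..t}" for n s
  proof -
    have "norm (f n s) \<le> (\<Sum>i\<le>n. (B * ((L * (t - s)) ^ i / fact i)) * (B * ((L * s) ^ (n - i) / fact (n - i))))"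
      unfolding f_def
    proof (intro sum_norm_le)
      fix i assume "i \<in> {..n}"
      have "norm (x i * (t - s) ^ i / fact i * (y (n - i) * s ^ (n - i) / fact (n - i)))
        = \<bar>x i * (t - s) ^ i / fact i\<bar> * \<bar>y (n - i) * s ^ (n - i) / fact (n - i)\<bar>"
        by (simp add: abs_mult)
      also have "\<dots> \<le> (B * ((L * \<bar>t - s\<bar>) ^ i / fact i)) * (B * ((L * \<bar>s\<bar>) ^ (n - i) / fact (n - i)))"
        using L B0 by (intro mult_mono geo_bounded_term xB yB) auto
      finally show "norm (x i * (t - s) ^ i / fact i * (y (n - i) * s ^ (n - i) / fact (n - i)))
        \<le> (B * ((L * (t - s)) ^ i / fact i)) * (B * ((L * s) ^ (n - i) / fact (n - i)))"
        using s by simp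
    qed
    also have "\<dots> = B * B * (\<Sum>i\<le>n. ((L * (t - s)) ^ i / fact i) * ((L * s) ^ (n - i) / fact (n - i)))"
      by (simp add: sum_distrib_left mult_ac)
    also have "(\<Sum>i\<le>n. ((L * (t - s)) ^ i / fact i) * ((L * s) ^ (n - i) / fact (n - i)))
       = (L * t) ^ n / fact n"
      using exp_series_add_commuting[of "L * (t - s)" "L * s" n]
      by (simp add: field_simps)
    finally show ?thesis .
  qed
  have ul: "uniform_limit {0..t} (\<lambda>N s. \<Sum>n<N. f n s) (\<lambda>s. \<Sum>n. f n s) sequentially"
    by (rule Weierstrass_m_test[OF bound], assumption, intro summable_mult exp_series_summable)
  obtain I J where I: "\<And>N. ((\<lambda>s. \<Sum>n<N. f n s) has_integral I N) {0..t}"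
    and J: "((\<lambda>s. \<Sum>n. f n s) has_integral J) {0..t}" and IJ: "I \<longlonglongrightarrow> J"
    by (rule uniform_limit_integral[OF ul]) (auto intro!: continuous_intros simp: f_def)
  have fint: "(f n has_integral (\<Sum>i\<le>n. x i * y (n - i)) * t ^ (n + 1) / fact (n + 1)) {0..t}" for n
  proof -
    have "((\<lambda>s. x i * y (n - i) * ((t - s) ^ i / fact i * (s ^ (n - i) / fact (n - i)))) has_integral
           x i * y (n - i) * (t ^ (n + 1) / fact (n + 1))) {0..t}" if "i \<le> n" for i
      using beta_integral_divided_powers[OF t, of i "n - i"] that
      by (intro has_integral_mult_right) simp
    hence "((\<lambda>s. \<Sum>i\<le>n. x i * y (n - i) * ((t - s) ^ i / fact i * (s ^ (n - i) / fact (n - i)))) has_integral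
           (\<Sum>i\<le>n. x i * y (n - i) * (t ^ (n + 1) / fact (n + 1)))) {0..t}"
      by (intro has_integral_sum) auto
    thus ?thesis
      by (simp add: f_def[abs_def] sum_distrib_left sum_distrib_right sum_divide_distrib mult_ac)
  qed
  have I_eq: "I = (\<lambda>N. \<Sum>n<N. (\<Sum>i\<le>n. x i * y (n - i)) * t ^ (n + 1) / fact (n + 1))"
    by (rule ext, rule has_integral_unique[OF I]) (intro has_integral_sum fint, auto)
  have "(\<lambda>n. (\<Sum>i\<le>n. x i * y (n - i)) * t ^ (n + 1) / fact (n + 1)) sums J"
    using IJ unfolding I_eq sums_def .
  hence "J = (\<Sum>n. (\<Sum>i\<le>n. x i * y (n - i)) * t ^ (n + 1) / fact (n + 1))"
    by (simp add: sums_iff)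
  moreover have "(\<lambda>s. \<Sum>n. f n s) = (\<lambda>s. egf x (t - s) * egf y s)"
    using sums by (auto simp: sums_iff)
  ultimately show ?thesis using J by simp
qed

section \<open>Laplace transforms at large arguments\<close>

text \<open>
  Up to the sign \<open>(-1) ^ n\<close>, the \<open>n\<close>-th derivative of the Laplace transform
  \<open>\<Sum>j. x j / y ^ (j + 1)\<close> of \<open>egf x\<close>. Written as a series it needs no decay of
  \<open>egf x\<close>, only \<open>y\<close> beyond the growth rate.
\<close>

definition laplace_deriv :: "(nat \<Rightarrow> real) \<Rightarrow> nat \<Rightarrow> real \<Rightarrow> real" where
  "laplace_deriv x n y = (\<Sum>j. x j * (fact (n + j) / fact j) / y ^ (n + j + 1))"

lemma laplace_coeff_summable:
  assumes "geo_bounded C M x" "\<bar>u\<bar> * M < 1"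
  shows "summable (\<lambda>j. norm (x j * (fact (n + j) / fact j) * u ^ j))"
proof -
  have M: "M > 0" using assms by (simp add: geo_bounded_def)
  have base: "summable (\<lambda>j. (\<bar>x j\<bar> * (fact (n + j) / fact j)) * v ^ j)" if "norm v < 1 / M" for v :: real
    using that
  proof (induction n arbitrary: v)
    case 0
    have v: "M * \<bar>v\<bar> < 1" using 0 M by (simp add: field_simps)
    show ?case
    proof (rule summable_comparison_test')
      show "summable (\<lambda>n. C * (M * \<bar>v\<bar>) ^ n)"
        using v M by (intro summable_mult summable_geometric) auto
      have "\<bar>x n\<bar> * \<bar>v\<bar> ^ n \<le> C * M ^ n * \<bar>v\<bar> ^ n" for n
        using assms by (intro mult_right_mono) (auto simp: geo_bounded_def)
      thus "norm (\<bar>x n\<bar> * (fact (0 + n) / fact n) * v ^ n) \<le> C * (M * \<bar>v\<bar>) ^ n" for n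
        by (simp add: abs_mult power_abs power_mult_distrib mult_ac)
    qed
  next
    case (Suc n)
    define c where "c = (\<lambda>j. \<bar>x j\<bar> * (fact (n + j) / fact j))"
    have c: "summable (\<lambda>j. c j * v ^ j)" if "norm v < 1 / M" for v
      using Suc.IH[OF that] by (simp add: c_def)
    have "summable (\<lambda>j. diffs c j * v ^ j)"
      using termdiff_converges[OF Suc.prems c] by simp
    hence "summable (\<lambda>j. (diffs c j * v ^ j) * v)" by (rule summable_mult2)
    hence "summable (\<lambda>j. of_nat (Suc j) * c (Suc j) * v ^ (Suc j))"
      by (simp add: diffs_def mult_ac)
    hence "summable (\<lambda>j. of_nat j * c j * v ^ j)"
      by (subst (asm) summable_Suc_iff[of "\<lambda>j. of_nat j * c j * v ^ j"])
    moreover have "summable (\<lambda>j. of_nat (Suc n) * (c j * v ^ j))"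
      by (intro summable_mult c Suc.prems)
    ultimately have "summable (\<lambda>j. of_nat j * c j * v ^ j + of_nat (Suc n) * (c j * v ^ j))"
      by (rule summable_add)
    thus ?case
      by (simp add: c_def algebra_simps add_divide_distrib)
  qed
  have "norm \<bar>u\<bar> < 1 / M" using assms(2) M by (simp add: field_simps)
  from base[OF this, of ] show ?thesis by (simp add: abs_mult power_abs)
qed

lemma laplace_deriv_conv_powser:
  assumes "geo_bounded C M x" "M < y"
  shows "laplace_deriv x n y = (1 / y) ^ (n + 1) * (\<Sum>j. x j * (fact (n + j) / fact j) * (1 / y) ^ j)"
    (is "_ = _ * suminf ?f")
proof -
  have M: "M > 0" using assms by (simp add: geo_bounded_def)
  have "summable (\<lambda>j. norm (?f j))"
    using M assms by (intro laplace_coeff_summable[OF assms(1)]) (simp add: field_simps)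
  hence "(\<lambda>j. (1 / y) ^ (n + 1) * ?f j) sums ((1 / y) ^ (n + 1) * suminf ?f)"
    by (intro sums_mult summable_sums) (rule summable_norm_cancel)
  moreover have "(1 / y) ^ (n + 1) * ?f j = x j * (fact (n + j) / fact j) / y ^ (n + j + 1)" for j
    by (simp add: power_add power_one_over divide_simps)
  ultimately show ?thesis unfolding laplace_deriv_def by (simp only: sums_iff)
qed

lemma has_real_derivative_laplace_deriv:
  assumes x: "geo_bounded C M x" and y: "M < y"
  shows "(laplace_deriv x n has_real_derivative - laplace_deriv x (Suc n) y) (at y)"
proof -
  have M: "M > 0" using x by (simp add: geo_bounded_def)
  define c where "c = (\<lambda>n j. x j * (fact (n + j) / fact j) :: real)"
  define P where "P = (\<lambda>n u. \<Sum>j. c n j * u ^ j)"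
  let ?S = "\<Sum>j. diffs (c n) j * (1 / y) ^ j"
  have sm: "summable (\<lambda>j. c n j * u ^ j)" if "norm u < 1 / M" for u n
  proof -
    have "\<bar>u\<bar> * M < 1" using that M by (simp add: field_simps)
    from summable_norm_cancel[OF laplace_coeff_summable[OF x this]]
    show ?thesis by (simp add: c_def)
  qed
  have u: "norm (1 / y) < 1 / M" using y M by (simp add: field_simps)
  have dP: "(P n has_real_derivative ?S) (at (1 / y))"
    unfolding P_def by (rule termdiffs_strong'[OF sm u])
  have PS: "P (Suc n) (1 / y) = real (n + 1) * P n (1 / y) + (1 / y) * ?S"
  proof -
    have "(\<lambda>j. diffs (c n) j * (1 / y) ^ j) sums ?S"
      by (rule summable_sums, rule termdiff_converges[OF u sm])
    from sums_mult[OF this, of "1 / y"]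
    have "(\<lambda>j. real (Suc j) * c n (Suc j) * (1 / y) ^ Suc j) sums
        ((1 / y) * ?S)"
      by (simp add: diffs_def mult_ac)
    hence "(\<lambda>j. real j * c n j * (1 / y) ^ j) sums ((1 / y) * ?S)"
      by (subst (asm) sums_Suc_iff) simp
    moreover have "(\<lambda>j. real (n + 1) * (c n j * (1 / y) ^ j)) sums (real (n + 1) * P n (1 / y))"
      unfolding P_def by (intro sums_mult summable_sums sm u)
    ultimately have "(\<lambda>j. real (n + 1) * (c n j * (1 / y) ^ j) + real j * c n j * (1 / y) ^ j) sums
       (real (n + 1) * P n (1 / y) + (1 / y) * ?S)"
      by (intro sums_add)
    moreover have "real (n + 1) * (c n j * (1 / y) ^ j) + real j * c n j * (1 / y) ^ j
        = c (Suc n) j * (1 / y) ^ j" for j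
    proof -
      have "c (Suc n) j = real (n + 1 + j) * c n j" by (simp add: c_def)
      thus ?thesis by (simp add: algebra_simps)
    qed
    ultimately show ?thesis unfolding P_def by (simp add: sums_iff)
  qed
  have eq: "laplace_deriv x n v = (1 / v) ^ (n + 1) * P n (1 / v)" if "M < v" for v n
    using laplace_deriv_conv_powser[OF x that] by (simp add: P_def c_def)
  have "((\<lambda>v. (1 / v) ^ (n + 1) * P n (1 / v)) has_real_derivative - laplace_deriv x (Suc n) y) (at y)"
  proof -
    have i: "((\<lambda>v. 1 / v) has_real_derivative - ((1 / y) ^ 2)) (at y)"
      using y M by (auto intro!: derivative_eq_intros simp: power2_eq_square)
    have "((\<lambda>v. P n (1 / v)) has_real_derivative ?S * (- ((1 / y) ^ 2))) (at y)"
      using DERIV_chain2[OF dP i] by simp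
    moreover have "((\<lambda>v. (1 / v) ^ (n + 1)) has_real_derivative (real (n + 1) * (1 / y) ^ n) * (- ((1 / y) ^ 2))) (at y)"
      using DERIV_power[OF i, of "n + 1"] by (simp add: mult_ac)
    ultimately have "((\<lambda>v. (1 / v) ^ (n + 1) * P n (1 / v)) has_real_derivative
        (real (n + 1) * (1 / y) ^ n) * (- ((1 / y) ^ 2)) * P n (1 / y) +
        ?S * (- ((1 / y) ^ 2)) * (1 / y) ^ (n + 1)) (at y)"
      by (rule DERIV_mult[rotated])
    moreover have "(real (n + 1) * (1 / y) ^ n) * (- ((1 / y) ^ 2)) * P n (1 / y) +
        ?S * (- ((1 / y) ^ 2)) * (1 / y) ^ (n + 1)
        = - ((1 / y) ^ (n + 2) * (real (n + 1) * P n (1 / y) + (1 / y) * ?S))"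
      by (simp add: power2_eq_square algebra_simps)
    moreover have "\<dots> = - laplace_deriv x (Suc n) y"
      using eq[OF y, of "Suc n"] PS by simp
    ultimately show ?thesis by simp
  qed
  moreover have "\<forall>\<^sub>F v in nhds y. laplace_deriv x n v = (1 / v) ^ (n + 1) * P n (1 / v)"
    using eventually_nhds_in_open[of "{M<..}" y] y by (auto elim!: eventually_mono simp: eq)
  ultimately show ?thesis by (simp add: DERIV_cong_ev)
qed

text \<open>
  The series is the integral of \<open>t ^ n * exp (- y * t) * egf x t\<close> over the half-line.
  Absorbing the powers of \<open>y\<close> into the coefficients reduces this to \<open>y = 1\<close>, where each
  term is a Gamma integral.
\<close>

lemma laplace_deriv_nonneg:
  assumes x: "geo_bounded C M x" and y: "M < y" and nonneg: "\<And>t. t \<ge> 0 \<Longrightarrow> egf x t \<ge> 0"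
  shows "laplace_deriv x n y \<ge> 0"
proof -
  have M: "M > 0" using x by (simp add: geo_bounded_def)
  \<comment> \<open>the substitution \<open>t / y\<close> for \<open>t\<close> on the level of coefficients\<close>
  define x' where "x' = (\<lambda>j. x j * (1 / y) ^ j)"
  let ?p = "\<lambda>N t. \<Sum>j<N. x' j / fact j * (t ^ (n + j) / exp t)"
  define L where "L = M / y"
  have L: "0 < L" "L < 1" using y M by (auto simp: L_def)
  have x': "geo_bounded C L x'"
    using x M y unfolding geo_bounded_def
    by (auto simp: x'_def L_def abs_mult power_abs power_divide divide_simps)
  have egf': "egf x' t = egf x (t / y)" for t
    by (simp add: egf_def x'_def power_divide mult_ac)
  have C0: "C \<ge> 0" using x unfolding geo_bounded_def
    by (metis abs_ge_zero mult.right_neutral order_trans power_0)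
  have gam: "((\<lambda>t::real. t ^ k / exp t) has_integral fact k) {0<..}" for k
  proof -
    have "((\<lambda>t::real. t powr (real (Suc k) - 1) / exp t) has_integral Gamma (real (Suc k))) {0..}"
      by (rule Gamma_integral_real) simp
    hence "((\<lambda>t::real. t powr (real k) / exp t) has_integral fact k) {0..}"
      using Gamma_fact[of k, where 'a = real] by (simp add: add.commute del: Gamma_fact)
    hence "((\<lambda>t::real. t powr (real k) / exp t) has_integral fact k) {0<..}"
    proof (rule iffD1[OF has_integral_spike_set_eq, rotated 2])
      show "negligible {x \<in> {0..} - {0<..}. x powr real k / exp x \<noteq> 0}"
        by (rule negligible_subset[of "{0}"]) auto
      show "negligible {x \<in> {0<..} - {0::real..}. x powr real k / exp x \<noteq> 0}"
        by (rule negligible_subset[of "{}"]) auto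
    qed
    thus ?thesis
      by (rule has_integral_eq[rotated]) (simp add: powr_realpow)
  qed
  define s where "s = (\<lambda>N. \<Sum>j<N. x' j * (fact (n + j) / fact j))"
  have lim: "s \<longlonglongrightarrow> (\<Sum>j. x j * (fact (n + j) / fact j) * (1 / y) ^ j)"
  proof -
    have "\<bar>1 / y\<bar> * M < 1" using y M by (simp add: field_simps)
    from summable_LIMSEQ[OF summable_norm_cancel[OF laplace_coeff_summable[OF x this, of n]]]
    show ?thesis by (simp add: s_def x'_def mult_ac)
  qed
  have "((\<lambda>t. t ^ n / exp t * egf x' t) has_integral
      (\<Sum>j. x j * (fact (n + j) / fact j) * (1 / y) ^ j)) {0<..}"
  proof (rule has_integral_dominated_convergence[where f = "?p"
        and y = s and h = "\<lambda>t. C * (t ^ n / exp ((1 - L) * t))"])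
    show "(?p N has_integral s N) {0<..}" for N
    proof -
      have "((\<lambda>t. x' j / fact j * (t ^ (n + j) / exp t)) has_integral x' j / fact j * fact (n + j)) {0<..}" for j
        by (rule has_integral_mult_right[OF gam])
      hence "(?p N has_integral
              (\<Sum>j<N. x' j / fact j * fact (n + j))) {0<..}"
        by (intro has_integral_sum) auto
      thus ?thesis by (simp add: s_def mult_ac)
    qed
    have "(\<lambda>t. complex_of_real t powr (of_nat (Suc n) - 1) / of_real (exp ((1 - L) * t))) absolutely_integrable_on {0<..}"
      using L by (intro absolutely_integrable_Gamma_integral) auto
    hence "(\<lambda>t. complex_of_real t powr (of_nat n) / of_real (exp ((1 - L) * t))) integrable_on {0<..}"
      by (simp add: absolutely_integrable_on_def)
    hence "(\<lambda>t. Re (complex_of_real t powr (of_nat n) / of_real (exp ((1 - L) * t)))) integrable_on {0<..}"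
      by (rule integrable_linear[OF _ bounded_linear_Re, unfolded o_def])
    hence "(\<lambda>t. t ^ n / exp ((1 - L) * t)) integrable_on {0<..}"
      by (rule integrable_eq)
        (simp only: greaterThan_iff powr_nat' of_real_power [symmetric] of_real_divide [symmetric] Re_complex_of_real, simp add: powr_nat' flip: of_real_power of_real_divide)
    thus "(\<lambda>t. C * (t ^ n / exp ((1 - L) * t))) integrable_on {0<..}"
      by (rule integrable_on_mult_right)
    show "\<forall>t\<in>{0<..}. norm (?p N t) \<le> C * (t ^ n / exp ((1 - L) * t))" for N
    proof
      fix t :: real assume t: "t \<in> {0<..}"
      have "norm (?p N t) = t ^ n / exp t * \<bar>\<Sum>j<N. x' j * t ^ j / fact j\<bar>"
      proof -
        have "(?p N t) = t ^ n / exp t * (\<Sum>j<N. x' j * t ^ j / fact j)"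
          by (simp add: sum_distrib_left power_add mult_ac)
        thus ?thesis using t by (simp add: abs_mult)
      qed
      also have "\<bar>\<Sum>j<N. x' j * t ^ j / fact j\<bar> \<le> (\<Sum>j<N. C * ((L * \<bar>t\<bar>) ^ j / fact j))"
        by (rule order_trans[OF sum_abs]) (intro sum_mono geo_bounded_term x')
      also have "\<dots> = C * (\<Sum>j<N. (L * t) ^ j / fact j)" using t by (simp add: sum_distrib_left)
      also have "(\<Sum>j<N. (L * t) ^ j / fact j) \<le> exp (L * t)"
        using sum_le_suminf[OF exp_series_summable[of "L * t"], of "{..<N}"] exp_series_sums[of "L * t"] L t
        by (simp add: sums_iff)
      finally have "norm (?p N t) \<le> t ^ n / exp t * (C * exp (L * t))"
        using t C0 by (simp add: mult_left_mono divide_right_mono)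
      also have "\<dots> = C * (t ^ n / exp ((1 - L) * t))"
        by (simp add: algebra_simps exp_diff)
      finally show "norm (?p N t) \<le> C * (t ^ n / exp ((1 - L) * t))" .
    qed
    show "\<forall>t\<in>{0<..}. (\<lambda>N. ?p N t) \<longlonglongrightarrow> t ^ n / exp t * egf x' t"
    proof
      fix t :: real
      have "(\<lambda>N. t ^ n / exp t * (\<Sum>j<N. x' j * t ^ j / fact j)) \<longlonglongrightarrow> t ^ n / exp t * egf x' t"
        using egf_sums[OF x', of t] unfolding sums_def by (intro tendsto_mult_left)
      thus "(\<lambda>N. ?p N t) \<longlonglongrightarrow> t ^ n / exp t * egf x' t"
        by (simp add: sum_distrib_left power_add mult_ac)
    qed
  qed (rule lim)
  hence "(\<Sum>j. x j * (fact (n + j) / fact j) * (1 / y) ^ j) \<ge> 0"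
    by (rule has_integral_nonneg) (use nonneg y M in \<open>auto simp: egf'\<close>)
  thus ?thesis using laplace_deriv_conv_powser[OF x y, of n] y M by simp
qed

lemma zero_le_mult_iff_pos: "0 \<le> a * b \<longleftrightarrow> 0 \<le> b" if "0 < a" for a b :: real
  using that by (simp add: zero_le_mult_iff)

text \<open>
  Inversion formula of Post and Widder: with \<open>y = N / t\<close> and after multiplication by
  \<open>y ^ (N + 1) / fact N\<close>, the \<open>N\<close>-th derivative is the series of \<open>egf x t\<close> with the
  \<open>j\<close>-th term multiplied by \<open>\<Prod>i=1..j. 1 + i / N\<close>. These factors decrease to 1 in
  \<open>N\<close>, so Tannery's theorem gives the limit \<open>egf x t\<close>.
\<close>

lemma post_widder_nonneg:
  assumes x: "geo_bounded C M x" and nonneg: "\<And>n y. n \<ge> 1 \<Longrightarrow> M < y \<Longrightarrow> laplace_deriv x n y \<ge> 0"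
    and t: "t > 0"
  shows "egf x t \<ge> 0"
proof -
  have M: "M > 0" using x by (simp add: geo_bounded_def)
  define a where "a = (\<lambda>j N. x j * t ^ j / fact j * (\<Prod>i=1..j. 1 + real i / real N))"
  have a_eq: "a j N = x j * (fact (N + j) / fact j) * (t / real N) ^ j / fact N" if "N > 0" for j N
  proof -
    have "(\<Prod>i=1..j. 1 + real i / real N) = fact (N + j) / (fact N * real N ^ j)"
    proof (induction j)
      case (Suc j)
      thus ?case using that by (subst prod.nat_ivl_Suc', simp, subst Suc.IH) (simp add: field_simps)
    qed simp
    thus ?thesis by (simp add: a_def power_divide mult_ac)
  qed
  \<comment> \<open>from \<open>n0\<close> on the argument \<open>N / t\<close> lies in the domain of the transform; the terms for \<open>n0\<close> dominate\<close>
  obtain n0 where n0: "M * t < real n0" using reals_Archimedean2 by blast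
  hence n0': "real n0 > 0" using M t by (smt (verit) mult_pos_pos)
  have "(\<lambda>N. \<Sum>j. a j N) \<longlonglongrightarrow> (\<Sum>j. x j * t ^ j / fact j)"
  proof (rule conjunct2[OF conjunct2[OF tannerys_theorem]])
    show "(a j \<longlongrightarrow> x j * t ^ j / fact j) sequentially" for j
    proof -
      have "(\<lambda>N. \<Prod>i=1..j. 1 + real i / real N) \<longlonglongrightarrow> (\<Prod>i=1..j. 1 + 0)"
        by (intro tendsto_prod tendsto_add tendsto_const lim_const_over_n)
      from tendsto_mult_left[OF this, of "x j * t ^ j / fact j"] show ?thesis by (simp add: a_def)
    qed
    show "summable (\<lambda>j. norm (a j n0))"
    proof -
      have "\<bar>t / real n0\<bar> * M < 1" using n0 n0' t by (simp add: field_simps)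
      from laplace_coeff_summable[OF x this, of n0]
      have "summable (\<lambda>j. norm (x j * (fact (n0 + j) / fact j) * (t / real n0) ^ j) / fact n0)"
        by (rule summable_divide)
      thus ?thesis using n0' by (simp add: a_eq)
    qed
    have mono: "norm (a j N) \<le> norm (a j n0)" if "N \<ge> n0" for j N
    proof -
      have "(\<Prod>i=1..j. 1 + real i / real N) \<le> (\<Prod>i=1..j. 1 + real i / real n0)"
        using that n0' by (intro prod_mono) (auto intro!: divide_left_mono add_nonneg_nonneg)
      moreover have "(\<Prod>i=1..j. 1 + real i / real N) \<ge> 0"
        by (intro prod_nonneg) (auto intro!: add_nonneg_nonneg)
      ultimately have "\<bar>\<Prod>i=1..j. 1 + real i / real N\<bar> \<le> \<bar>\<Prod>i=1..j. 1 + real i / real n0\<bar>" by linarith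
      thus ?thesis by (auto simp: a_def abs_mult intro!: mult_left_mono divide_right_mono)
    qed
    show "\<forall>\<^sub>F (j, N) in at_top \<times>\<^sub>F sequentially. norm (a j N) \<le> norm (a j n0)"
      using eventually_prodI[OF eventually_True eventually_ge_at_top[of n0]]
      by (rule eventually_mono) (use mono in auto)
  qed auto
  moreover have "\<forall>\<^sub>F N in sequentially. (\<Sum>j. a j N) \<ge> 0"
    using eventually_ge_at_top[of "max n0 1"]
  proof eventually_elim
    case (elim N)
    have N: "M * t < real N" "N > 0" using elim n0 by auto
    hence y: "M < real N / t" using t by (simp add: field_simps)
    have sm: "summable (\<lambda>j. x j * (fact (N + j) / fact j) * (1 / (real N / t)) ^ j)"
      using y M t N by (intro summable_norm_cancel[OF laplace_coeff_summable[OF x]]) (simp add: field_simps)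
    have "0 \<le> (1 / (real N / t)) ^ (N + 1) * (\<Sum>j. x j * (fact (N + j) / fact j) * (1 / (real N / t)) ^ j)"
      using nonneg[of N, OF _ y] elim laplace_deriv_conv_powser[OF x y, of N] by simp
    hence "0 \<le> (\<Sum>j. x j * (fact (N + j) / fact j) * (1 / (real N / t)) ^ j)"
      using N t by (subst (asm) zero_le_mult_iff_pos) (auto intro!: divide_pos_pos zero_less_power)
    hence "0 \<le> (\<Sum>j. x j * (fact (N + j) / fact j) * (1 / (real N / t)) ^ j) / fact N" by simp
    also have "\<dots> = (\<Sum>j. a j N)"
      using N by (subst suminf_divide[OF sm, symmetric]) (simp add: a_eq)
    finally show ?case .
  qed
  ultimately have "0 \<le> (\<Sum>j. x j * t ^ j / fact j)"
    by (rule tendsto_lowerbound) simp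
  thus ?thesis by (simp add: egf_def)
qed

section \<open>The density and its dependence on the parameters\<close>

text \<open>
  The coefficients of \<open>(a / u - c) * ln (1 + u) - a\<close> as a power series in \<open>u\<close>. With
  \<open>u = 1 / y\<close> this is the logarithm of \<open>F a (- c) (a * y)\<close> normalised to vanish at
  infinity.
\<close>

definition log_coeff :: "real \<Rightarrow> real \<Rightarrow> nat \<Rightarrow> real" where
  "log_coeff a c n = (if n = 0 then 0 else (-1) ^ n * (a / (real n + 1) + c / real n))"

definition log_fps :: "real \<Rightarrow> real \<Rightarrow> real fps" where
  "log_fps a c = Abs_fps (log_coeff a c)"

definition E_fps :: "real \<Rightarrow> real \<Rightarrow> real fps" where
  "E_fps a c = fps_exp 1 oo log_fps a c"

definition E_density_coeff :: "real \<Rightarrow> real \<Rightarrow> nat \<Rightarrow> real" where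
  "E_density_coeff a c n = - fps_nth (E_fps a c) (Suc n)"

text \<open>
  If \<open>E y = F a (- c) (a * y)\<close>, then \<open>exp (- a) * E y\<close> is one minus the Laplace transform
  of this entire function.
\<close>

definition E_density :: "real \<Rightarrow> real \<Rightarrow> real \<Rightarrow> real" where
  "E_density a c = egf (E_density_coeff a c)"

lemma log_fps_nth [simp]: "fps_nth (log_fps a c) n = log_coeff a c n"
  by (simp add: log_fps_def)

lemma log_coeff_0 [simp]: "log_coeff a c 0 = 0"
  by (simp add: log_coeff_def)

lemma fps_exp_compose_deriv:
  fixes l :: "'a::field_char_0 fps"
  assumes "fps_nth l 0 = 0"
  shows "fps_deriv (fps_exp 1 oo l) = fps_deriv l * (fps_exp 1 oo l)"
  using fps_compose_deriv[OF assms, of "fps_exp 1"] by (simp add: mult.commute)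

text \<open>
  Comparing coefficients in \<open>G' = l' * G\<close> for \<open>G = exp l\<close>.
\<close>

lemma fps_exp_compose_rec:
  fixes l :: "'a::field_char_0 fps"
  assumes "fps_nth l 0 = 0"
  shows "of_nat (Suc n) * fps_nth (fps_exp 1 oo l) (Suc n) =
    (\<Sum>i\<le>n. of_nat (Suc i) * fps_nth l (Suc i) * fps_nth (fps_exp 1 oo l) (n - i))"
proof -
  have "fps_nth (fps_deriv (fps_exp 1 oo l)) n = fps_nth (fps_deriv l * (fps_exp 1 oo l)) n"
    by (simp only: fps_exp_compose_deriv[OF assms])
  thus ?thesis by (simp add: fps_mult_nth atMost_atLeast0)
qed

lemma fps_exp_compose_bound:
  fixes l :: "'a::{field_char_0,real_normed_field} fps"
  assumes l0: "fps_nth l 0 = 0" and B: "\<And>n. norm (of_nat n * fps_nth l n) \<le> B"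
  shows "norm (fps_nth (fps_exp 1 oo l) n) \<le> (1 + B) ^ n"
proof (induction n rule: less_induct)
  let ?e = "fps_nth (fps_exp 1 oo l)"
  case (less n)
  have B0: "B \<ge> 0" using B[of 0] by simp
  show ?case
  proof (cases n)
    case (Suc m)
    have "real (Suc m) * norm (?e (Suc m)) =
       norm (of_nat (Suc m) * ?e (Suc m))"
      by (simp only: norm_mult norm_of_nat)
    also have "\<dots> \<le> (\<Sum>i\<le>m. norm (of_nat (Suc i) * fps_nth l (Suc i) * ?e (m - i)))"
      unfolding fps_exp_compose_rec[OF l0] by (rule norm_sum)
    also have "\<dots> \<le> (\<Sum>i\<le>m. B * (1 + B) ^ m)"
    proof (intro sum_mono)
      fix i assume i: "i \<in> {..m}"
      have "norm (of_nat (Suc i) * fps_nth l (Suc i) * ?e (m - i))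
         \<le> B * (1 + B) ^ (m - i)"
        unfolding norm_mult[of "of_nat (Suc i) * fps_nth l (Suc i)"]
        using less.IH[of "m - i"] Suc B0 by (intro mult_mono B) auto
      also have "\<dots> \<le> B * (1 + B) ^ m"
        using B0 by (intro mult_left_mono power_increasing) auto
      finally show "norm (of_nat (Suc i) * fps_nth l (Suc i) * ?e (m - i)) \<le> B * (1 + B) ^ m" .
    qed
    also have "\<dots> \<le> real (Suc m) * (1 + B) ^ Suc m"
      using B0 by (simp add: mult_left_mono mult_right_mono distrib_left)
    finally show ?thesis using Suc by (simp del: of_nat_Suc power_Suc)
  qed simp
qed

lemma log_coeff_bound: "\<bar>real n * log_coeff a c n\<bar> \<le> \<bar>a\<bar> + \<bar>c\<bar>"
proof (cases "n = 0")
  case False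
  have "\<bar>real n * log_coeff a c n\<bar> = \<bar>a * (real n / (real n + 1)) + c\<bar>"
  proof -
    have "real n * log_coeff a c n = (-1) ^ n * (a * (real n / (real n + 1)) + c)"
      using False by (simp add: log_coeff_def distrib_left)
    thus ?thesis by (simp only: abs_mult power_abs abs_minus abs_one power_one mult_1_left)
  qed
  also have "\<dots> \<le> \<bar>a\<bar> * \<bar>real n / (real n + 1)\<bar> + \<bar>c\<bar>"
    by (metis abs_mult abs_triangle_ineq)
  also have "\<bar>a\<bar> * \<bar>real n / (real n + 1)\<bar> \<le> \<bar>a\<bar> * 1"
    by (intro mult_left_mono) auto
  finally show ?thesis by simp
qed simp

lemma E_fps_bound: "\<bar>fps_nth (E_fps a c) n\<bar> \<le> (1 + (\<bar>a\<bar> + \<bar>c\<bar>)) ^ n"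
  using fps_exp_compose_bound[of "log_fps a c" "\<bar>a\<bar> + \<bar>c\<bar>" n] log_coeff_bound
  by (simp add: E_fps_def)

lemma E_fps_bound':
  assumes "\<bar>a\<bar> + \<bar>c\<bar> \<le> B"
  shows "\<bar>fps_nth (E_fps a c) n\<bar> \<le> (1 + B) ^ n"
  using E_fps_bound[of a c n] power_mono[of "1 + (\<bar>a\<bar> + \<bar>c\<bar>)" "1 + B" n] assms by linarith

lemma E_fps_0 [simp]: "fps_nth (E_fps a c) 0 = 1"
  by (simp add: E_fps_def)

lemma E_density_geo_bounded':
  assumes "\<bar>a\<bar> + \<bar>c\<bar> \<le> B"
  shows "geo_bounded (1 + B) (1 + B) (E_density_coeff a c)"
  using E_fps_bound'[OF assms, of "Suc n" for n] assms
  by (auto simp: geo_bounded_def E_density_coeff_def)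

lemmas E_density_geo_bounded = E_density_geo_bounded'[OF order_refl]

lemma E_density_continuous_on: "continuous_on S (E_density a c)"
  unfolding E_density_def by (rule egf_continuous_on[OF E_density_geo_bounded])

lemma E_fps_rec: "real (Suc n) * fps_nth (E_fps a c) (Suc n) =
    (\<Sum>i\<le>n. real (Suc i) * log_coeff a c (Suc i) * fps_nth (E_fps a c) (n - i))"
  using fps_exp_compose_rec[of "log_fps a c" n] by (simp add: E_fps_def)

lemma E_density_0: "E_density a c 0 = a / 2 + c"
  using E_fps_rec[of 0 a c] by (simp add: E_density_def E_density_coeff_def log_coeff_def)

text \<open>
  The Laplace transform of \<open>egf (scale_coeff a c)\<close> is the derivative of \<open>ln E\<close> in its
  argument. That of \<open>egf (flow_coeff p q)\<close> is minus the derivative of \<open>ln (exp (- a) * E)\<close>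
  when the parameters \<open>(a, c)\<close> move in the direction \<open>(p, q)\<close>.
\<close>

definition scale_coeff :: "real \<Rightarrow> real \<Rightarrow> nat \<Rightarrow> real" where
  "scale_coeff a c n = - (real n * log_coeff a c n)"

definition flow_coeff :: "real \<Rightarrow> real \<Rightarrow> nat \<Rightarrow> real" where
  "flow_coeff p q n = - log_coeff p q (Suc n)"

lemma scale_geo_bounded: "geo_bounded (\<bar>a\<bar> + \<bar>c\<bar>) 1 (scale_coeff a c)"
  using log_coeff_bound by (simp add: geo_bounded_def scale_coeff_def)

lemma log_coeff_bound1: "\<bar>log_coeff p q n\<bar> \<le> \<bar>p\<bar> + \<bar>q\<bar>"
proof (cases "n = 0")
  case False
  have "1 * \<bar>log_coeff p q n\<bar> \<le> real n * \<bar>log_coeff p q n\<bar>"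
    using False by (intro mult_right_mono) auto
  also have "\<dots> \<le> \<bar>p\<bar> + \<bar>q\<bar>" using log_coeff_bound[of n p q] by (simp add: abs_mult)
  finally show ?thesis by simp
qed simp

lemma flow_geo_bounded: "geo_bounded (\<bar>p\<bar> + \<bar>q\<bar>) 1 (flow_coeff p q)"
  using log_coeff_bound1 by (simp add: geo_bounded_def flow_coeff_def)

lemma egf_sums_Suc:
  assumes "geo_bounded C M x"
  shows "(\<lambda>n. x (Suc n) * t ^ Suc n / fact (Suc n)) sums (egf x t - x 0)"
  using egf_sums[OF assms, of t] by (subst sums_Suc_iff) simp

text \<open>
  Differentiation of the transform \<open>1 - exp (- a) * E\<close> in its argument corresponds to
  multiplication of the density by \<open>t\<close>, and \<open>E' = E * (ln E)'\<close> turns into a convolution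
  equation: \<open>t * \<phi> = \<nu> - \<nu> * \<phi>\<close> with the last product a convolution.
\<close>

lemma E_density_scale_equation:
  assumes t: "t \<ge> 0"
  shows "((\<lambda>s. egf (scale_coeff a c) (t - s) * E_density a c s) has_integral
           (egf (scale_coeff a c) t - t * E_density a c t)) {0..t}"
proof -
  define x where "x = E_density_coeff a c"
  define y where "y = scale_coeff a c"
  define g where "g = fps_nth (E_fps a c)"
  have *: "(\<Sum>i\<le>n. y i * x (n - i)) = y (Suc n) - real (Suc n) * x n" for n
  proof -
    have "real (Suc n) * x n = - (\<Sum>i\<le>n. real (Suc i) * log_coeff a c (Suc i) * g (n - i))"
      using E_fps_rec[of n a c] by (simp add: x_def E_density_coeff_def g_def)
    also have "\<dots> = (\<Sum>i\<le>n. y (Suc i) * g (Suc n - Suc i))"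
      by (simp add: y_def scale_coeff_def sum_negf)
    also have "\<dots> = (\<Sum>i\<le>Suc n. y i * g (Suc n - i))"
      by (subst sum.atMost_Suc_shift) (simp add: y_def scale_coeff_def)
    also have "\<dots> = y (Suc n) + (\<Sum>i\<le>n. y i * g (Suc n - i))"
      by (simp add: g_def)
    also have "(\<Sum>i\<le>n. y i * g (Suc n - i)) = - (\<Sum>i\<le>n. y i * x (n - i))"
      by (simp add: x_def E_density_coeff_def g_def sum_negf Suc_diff_le)
    finally show ?thesis by simp
  qed
  have y: "geo_bounded (\<bar>a\<bar> + \<bar>c\<bar>) 1 y" unfolding y_def by (rule scale_geo_bounded)
  note x = E_density_geo_bounded[of a c, folded x_def]
  have "(\<lambda>n. y (Suc n) * t ^ Suc n / fact (Suc n) - t * (x n * t ^ n / fact n)) sums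
     ((egf y t - y 0) - t * egf x t)"
    by (intro sums_diff egf_sums_Suc[OF y] sums_mult egf_sums[OF x])
  moreover have "y (Suc n) * t ^ Suc n / fact (Suc n) - t * (x n * t ^ n / fact n) =
      (\<Sum>i\<le>n. y i * x (n - i)) * t ^ (n + 1) / fact (n + 1)" for n
    unfolding * by (simp add: divide_simps) (simp add: algebra_simps)
  moreover have "y 0 = 0" by (simp add: y_def scale_coeff_def)
  ultimately have "(\<Sum>n. (\<Sum>i\<le>n. y i * x (n - i)) * t ^ (n + 1) / fact (n + 1)) = egf y t - t * egf x t"
    by (simp only: sums_iff diff_zero)
  thus ?thesis
    using egf_convolution[OF y x t] unfolding E_density_def x_def[symmetric] y_def[symmetric] by simp
qed

lemma log_fps_line: "log_fps (a + u * p) (c + u * q) = log_fps a c + fps_const u * log_fps p q"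
  by (rule fps_ext) (simp add: log_coeff_def algebra_simps add_divide_distrib)

lemma E_fps_line_deriv:
  "((\<lambda>u. fps_nth (E_fps (a + u * p) (c + u * q)) n) has_real_derivative
     fps_nth (log_fps p q * E_fps (a + u * p) (c + u * q)) n) (at u)"
proof (induction n rule: less_induct)
  case (less n)
  define g where "g = (\<lambda>u. E_fps (a + u * p) (c + u * q))"
  define l where "l = (\<lambda>u. log_fps (a + u * p) (c + u * q))"
  define l1 where "l1 = log_fps p q"
  show ?case
  proof (cases n)
    case 0
    thus ?thesis by simp
  next
    case (Suc m)
    let ?S = "(\<Sum>i=0..m. fps_nth (fps_deriv l1) i * fps_nth (g u) (m - i) + fps_nth (l1 * g u) (m - i) * fps_nth (fps_deriv (l u)) i)"
    have rec: "fps_nth (g v) (Suc m) = fps_nth (fps_deriv (l v) * g v) m / real (Suc m)" for v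
    proof -
      have "fps_deriv (g v) = fps_deriv (l v) * g v"
        unfolding g_def l_def E_fps_def by (rule fps_exp_compose_deriv) simp
      hence "fps_nth (fps_deriv (g v)) m = fps_nth (fps_deriv (l v) * g v) m" by simp
      thus ?thesis by (simp add: field_simps)
    qed
    have l: "((\<lambda>v. fps_nth (fps_deriv (l v)) i) has_real_derivative fps_nth (fps_deriv l1) i) (at u)" for i
      unfolding l_def l1_def log_fps_line by (auto intro!: derivative_eq_intros)
    have "((\<lambda>v. (\<Sum>i=0..m. fps_nth (fps_deriv (l v)) i * fps_nth (g v) (m - i)) / real (Suc m))
      has_real_derivative ?S / real (Suc m)) (at u)"
      using less.IH Suc unfolding g_def l1_def
      by (intro DERIV_cdivide DERIV_sum DERIV_mult l[unfolded l1_def]) auto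
    moreover have "?S / real (Suc m) = fps_nth (l1 * g u) (Suc m)"
    proof -
      have "fps_deriv (g u) = fps_deriv (l u) * g u"
        unfolding g_def l_def E_fps_def by (rule fps_exp_compose_deriv) simp
      hence "fps_deriv (l1 * g u) = fps_deriv l1 * g u + fps_deriv (l u) * (l1 * g u)"
        by (simp only: fps_deriv_mult mult_ac add_ac)
      hence "fps_nth (fps_deriv (l1 * g u)) m = fps_nth (fps_deriv l1 * g u) m + fps_nth (fps_deriv (l u) * (l1 * g u)) m"
        by (simp only: fps_add_nth)
      also have "\<dots> = ?S"
        unfolding fps_mult_nth[of "fps_deriv l1"] fps_mult_nth[of "fps_deriv (l u)"]
        by (simp add: sum.distrib mult.commute)
      finally have "fps_nth (fps_deriv (l1 * g u)) m = ?S" .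
      hence *: "?S = real (Suc m) * fps_nth (l1 * g u) (Suc m)"
        unfolding fps_deriv_nth[of "l1 * g u"] by (simp only: Suc_eq_plus1)
      show ?thesis unfolding * by (rule nonzero_mult_div_cancel_left) simp
    qed
    moreover have "(\<lambda>v. (\<Sum>i=0..m. fps_nth (fps_deriv (l v)) i * fps_nth (g v) (m - i)) / real (Suc m)) =
        (\<lambda>v. fps_nth (g v) (Suc m))"
      unfolding rec fps_mult_nth ..
    ultimately show ?thesis
      unfolding Suc g_def l1_def by (simp only:)
  qed
qed

lemma line_bound:
  assumes "\<bar>u\<bar> \<le> (R::real)"
  shows "\<bar>a + u * p\<bar> + \<bar>c + u * q\<bar> \<le> \<bar>a\<bar> + \<bar>c\<bar> + R * (\<bar>p\<bar> + \<bar>q\<bar>)"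
proof -
  have "\<bar>u * p\<bar> \<le> R * \<bar>p\<bar>" "\<bar>u * q\<bar> \<le> R * \<bar>q\<bar>"
    using assms by (auto simp: abs_mult intro!: mult_right_mono)
  thus ?thesis by (simp add: distrib_left) (smt (verit))
qed

text \<open>
  The derivative of the density when the parameters \<open>(a, c)\<close> move with velocity \<open>(p, q)\<close>:
  the derivative of \<open>exp l\<close> is \<open>exp l\<close> times that of \<open>l\<close>.
\<close>

definition E_density_flow :: "real \<Rightarrow> real \<Rightarrow> real \<Rightarrow> real \<Rightarrow> real \<Rightarrow> real" where
  "E_density_flow p q a c = egf (\<lambda>n. - fps_nth (log_fps p q * E_fps a c) (Suc n))"

lemma flow_bound:
  assumes "\<bar>a\<bar> + \<bar>c\<bar> \<le> B"
  shows "\<bar>fps_nth (log_fps p q * E_fps a c) (Suc n)\<bar> \<le> ((\<bar>p\<bar> + \<bar>q\<bar>) * (2 * (1 + B))) * (2 * (1 + B)) ^ n"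
proof -
  let ?b = "\<bar>p\<bar> + \<bar>q\<bar>"
  have B0: "B \<ge> 0" using assms by linarith
  have "\<bar>fps_nth (log_fps p q * E_fps a c) (Suc n)\<bar> \<le>
      (\<Sum>i=0..Suc n. \<bar>log_coeff p q i * fps_nth (E_fps a c) (Suc n - i)\<bar>)"
    unfolding fps_mult_nth log_fps_nth by (rule sum_abs)
  also have "\<dots> \<le> (\<Sum>i=0..Suc n. (?b) * (1 + B) ^ Suc n)"
  proof (intro sum_mono)
    fix i assume "i \<in> {0..Suc n}"
    have "\<bar>log_coeff p q i * fps_nth (E_fps a c) (Suc n - i)\<bar> \<le> (?b) * (1 + B) ^ (Suc n - i)"
      unfolding abs_mult by (intro mult_mono log_coeff_bound1 E_fps_bound' assms) auto
    also have "\<dots> \<le> (?b) * (1 + B) ^ Suc n"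
      using B0 by (intro mult_left_mono power_increasing) auto
    finally show "\<bar>log_coeff p q i * fps_nth (E_fps a c) (Suc n - i)\<bar> \<le> (?b) * (1 + B) ^ Suc n" .
  qed
  also have "\<dots> = real (n + 2) * ((?b) * (1 + B) ^ Suc n)" by simp
  also have "\<dots> \<le> 2 ^ Suc n * ((?b) * (1 + B) ^ Suc n)"
  proof (intro mult_right_mono)
    have "n + 2 \<le> 2 ^ Suc n" by (induction n) auto
    hence "real (n + 2) \<le> real (2 ^ Suc n)" by (rule of_nat_mono)
    thus "real (n + 2) \<le> 2 ^ Suc n" by simp
  qed (use B0 in auto)
  also have "\<dots> = ((?b) * (2 * (1 + B))) * (2 * (1 + B)) ^ n"
    by (simp only: power_Suc power_mult_distrib mult_ac)
  finally show ?thesis .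
qed

lemma flow_coeffs_geo_bounded:
  assumes "\<bar>a\<bar> + \<bar>c\<bar> \<le> B"
  shows "geo_bounded ((\<bar>p\<bar> + \<bar>q\<bar>) * (2 * (1 + B))) (2 * (1 + B)) (\<lambda>n. - fps_nth (log_fps p q * E_fps a c) (Suc n))"
proof -
  have "B \<ge> 0" using assms by linarith
  thus ?thesis unfolding geo_bounded_def using flow_bound[OF assms, of p q] by auto
qed

text \<open>
  All parameters near \<open>u\<close> share one geometric bound on the coefficients, so the series may
  be differentiated term by term.
\<close>

lemma E_density_line_deriv:
  "((\<lambda>u. E_density (a + u * p) (c + u * q) t) has_real_derivative
     E_density_flow p q (a + u * p) (c + u * q) t) (at u)"
proof -
  define B where "B = \<bar>a\<bar> + \<bar>c\<bar> + (\<bar>u\<bar> + 1) * (\<bar>p\<bar> + \<bar>q\<bar>)"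
  let ?K = "(\<bar>p\<bar> + \<bar>q\<bar>) * (2 * (1 + B))"
  define f where "f = (\<lambda>n v. E_density_coeff (a + v * p) (c + v * q) n * t ^ n / fact n)"
  define f' where "f' = (\<lambda>n v. - fps_nth (log_fps p q * E_fps (a + v * p) (c + v * q)) (Suc n) * t ^ n / fact n)"
  have B: "\<bar>a + v * p\<bar> + \<bar>c + v * q\<bar> \<le> B" if "v \<in> ball u 1" for v
    using that unfolding B_def by (intro line_bound) (auto simp: dist_real_def)
  have d: "(f n has_field_derivative f' n v) (at v within ball u 1)" for n v
    unfolding f_def f'_def E_density_coeff_def
    by (intro DERIV_cdivide DERIV_cmult_right DERIV_minus has_field_derivative_at_within[OF E_fps_line_deriv])
  have "uniform_limit (ball u 1) (\<lambda>n x. \<Sum>i<n. f' i x) (\<lambda>x. \<Sum>i. f' i x) sequentially"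
  proof (rule Weierstrass_m_test)
    fix n v assume "v \<in> ball u 1"
    from geo_bounded_term[OF flow_coeffs_geo_bounded[OF B[OF this]]]
    show "norm (f' n v) \<le> (?K) * ((2 * (1 + B) * \<bar>t\<bar>) ^ n / fact n)"
      unfolding f'_def by simp
  qed (intro summable_mult exp_series_summable)
  hence ul: "uniformly_convergent_on (ball u 1) (\<lambda>n x. \<Sum>i<n. f' i x)"
    by (auto simp: uniformly_convergent_on_def)
  have "summable (\<lambda>n. f n u)"
    unfolding f_def using sums_summable[OF egf_sums[OF E_density_geo_bounded]] .
  from has_field_derivative_series'(2)[OF convex_ball d ul _ this, of u]
  have "((\<lambda>v. \<Sum>n. f n v) has_field_derivative (\<Sum>n. f' n u)) (at u)" by simp
  thus ?thesis by (simp add: f_def f'_def E_density_def E_density_flow_def egf_def[abs_def])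
qed

text \<open>
  The counterpart of the scale equation for the parameters: the derivative of the density is
  \<open>\<kappa> - \<kappa> * \<phi>\<close> with a convolution, where \<open>\<kappa>\<close> is the kernel of
  \<open>flow_coeff p q\<close>.
\<close>

lemma E_density_flow_equation:
  assumes t: "t \<ge> 0"
  shows "((\<lambda>s. egf (flow_coeff p q) (t - s) * E_density a c s) has_integral
           (egf (flow_coeff p q) t - E_density_flow p q a c t)) {0..t}"
proof -
  define x where "x = E_density_coeff a c"
  define y where "y = flow_coeff p q"
  define z where "z = (\<lambda>n. - fps_nth (log_fps p q * E_fps a c) (Suc n))"
  define g where "g = fps_nth (E_fps a c)"
  have z: "z n = y n - (\<Sum>i<n. y i * x (n - Suc i))" for n
  proof -
    have "- z n = (\<Sum>i\<le>Suc n. log_coeff p q i * g (Suc n - i))"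
      by (simp add: z_def fps_mult_nth g_def atMost_atLeast0)
    also have "\<dots> = (\<Sum>i\<le>n. log_coeff p q (Suc i) * g (n - i))"
      by (subst sum.atMost_Suc_shift) simp
    also have "\<dots> = - (\<Sum>i\<le>n. y i * g (n - i))"
      by (simp add: y_def flow_coeff_def sum_negf)
    also have "(\<Sum>i\<le>n. y i * g (n - i)) = y n + (\<Sum>i<n. y i * g (n - i))"
      by (simp add: g_def lessThan_Suc_atMost[symmetric])
    also have "(\<Sum>i<n. y i * g (n - i)) = - (\<Sum>i<n. y i * x (n - Suc i))"
      unfolding sum_negf[symmetric]
      by (intro sum.cong) (auto simp: x_def E_density_coeff_def g_def Suc_diff_Suc)
    finally show ?thesis by simp
  qed
  have y: "geo_bounded (\<bar>p\<bar> + \<bar>q\<bar>) 1 y" unfolding y_def by (rule flow_geo_bounded)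
  note x = E_density_geo_bounded[of a c, folded x_def]
  note zb = flow_coeffs_geo_bounded[OF order_refl, where a = a and c = c and p = p and q = q, folded z_def]
  have "(\<lambda>n. y (Suc n) * t ^ Suc n / fact (Suc n) - z (Suc n) * t ^ Suc n / fact (Suc n)) sums
     ((egf y t - y 0) - (egf z t - z 0))"
    by (intro sums_diff egf_sums_Suc[OF y] egf_sums_Suc[OF zb])
  moreover have "y (Suc n) * t ^ Suc n / fact (Suc n) - z (Suc n) * t ^ Suc n / fact (Suc n) =
      (\<Sum>i\<le>n. y i * x (n - i)) * t ^ (n + 1) / fact (n + 1)" for n
  proof -
    have "y (Suc n) - z (Suc n) = (\<Sum>i\<le>n. y i * x (n - i))"
      unfolding z[of "Suc n"] by (simp add: lessThan_Suc_atMost)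
    thus ?thesis by (metis Suc_eq_plus1 diff_divide_distrib left_diff_distrib)
  qed
  moreover have "y 0 = z 0" by (simp add: z)
  ultimately have "(\<Sum>n. (\<Sum>i\<le>n. y i * x (n - i)) * t ^ (n + 1) / fact (n + 1)) = egf y t - egf z t"
    by (simp add: sums_iff)
  thus ?thesis
    using egf_convolution[OF y x t]
    unfolding E_density_def E_density_flow_def x_def[symmetric] y_def[symmetric] z_def[symmetric] by simp
qed

lemma E_density_line_continuous_on:
  "continuous_on ({0..\<beta>} \<times> {0..T}) (\<lambda>(u, t). E_density (a + u * p) (c + u * q) t)"
proof -
  define B where "B = \<bar>a\<bar> + \<bar>c\<bar> + \<beta> * (\<bar>p\<bar> + \<bar>q\<bar>)"
  define f where "f = (\<lambda>n (u, t). E_density_coeff (a + u * p) (c + u * q) n * t ^ n / fact n)"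
  have B: "\<bar>a + v * p\<bar> + \<bar>c + v * q\<bar> \<le> B" if "v \<in> {0..\<beta>}" for v
    using that unfolding B_def by (intro line_bound) auto
  have cf: "continuous_on S (f n)" for S n
  proof -
    have "isCont (\<lambda>u. fps_nth (E_fps (a + u * p) (c + u * q)) (Suc n)) v" for v
      by (rule DERIV_isCont[OF E_fps_line_deriv])
    hence "continuous_on UNIV (\<lambda>u. fps_nth (E_fps (a + u * p) (c + u * q)) (Suc n))"
      by (intro continuous_at_imp_continuous_on) auto
    from continuous_on_compose2[OF this continuous_on_fst[OF continuous_on_id]]
    have "continuous_on S (\<lambda>x. fps_nth (E_fps (a + fst x * p) (c + fst x * q)) (Suc n))" by simp
    thus ?thesis unfolding f_def case_prod_beta E_density_coeff_def by (intro continuous_intros) auto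
  qed
  have "uniform_limit ({0..\<beta>} \<times> {0..T}) (\<lambda>N x. \<Sum>n<N. f n x) (\<lambda>x. \<Sum>n. f n x) sequentially"
  proof (rule Weierstrass_m_test)
    fix n x assume x: "x \<in> {0..\<beta>} \<times> {0..T}"
    obtain u t where ut: "x = (u, t)" by (cases x)
    have B0: "B \<ge> 0" using B[of u] x ut by auto
    have "norm (f n x) \<le> (1 + B) * (((1 + B) * \<bar>t\<bar>) ^ n / fact n)"
      using geo_bounded_term[OF E_density_geo_bounded'[OF B[of u]], of n t] x ut by (simp add: f_def)
    also have "\<dots> \<le> (1 + B) * (((1 + B) * \<bar>T\<bar>) ^ n / fact n)"
      using B0 x ut by (intro mult_left_mono divide_right_mono power_mono) auto
    finally show "norm (f n x) \<le> (1 + B) * (((1 + B) * \<bar>T\<bar>) ^ n / fact n)" .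
  qed (intro summable_mult exp_series_summable)
  hence "continuous_on ({0..\<beta>} \<times> {0..T}) (\<lambda>x. \<Sum>n. f n x)"
    by (rule uniform_limit_theorem[rotated]) (auto intro!: always_eventually continuous_intros cf)
  thus ?thesis by (simp add: f_def E_density_def egf_def case_prod_beta)
qed

section \<open>The kernels in closed form\<close>

lemma geo_bounded_alt: "(\<And>n. \<bar>f n\<bar> \<le> 1) \<Longrightarrow> geo_bounded 1 1 f"
  by (simp add: geo_bounded_def)

lemma egf_add:
  assumes "geo_bounded C M x" "geo_bounded C' M' y"
  shows "egf (\<lambda>n. u * x n + v * y n) t = u * egf x t + v * egf y t"
proof -
  have "(\<lambda>n. u * (x n * t ^ n / fact n) + v * (y n * t ^ n / fact n)) sums (u * egf x t + v * egf y t)"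
    by (intro sums_add sums_mult egf_sums[OF assms(1)] egf_sums[OF assms(2)])
  thus ?thesis by (simp add: egf_def sums_iff field_simps)
qed

lemma egf_exp: "egf (\<lambda>n. (-1) ^ n) t = exp (- t)"
  using exp_series_sums[of "- t"] by (simp add: egf_def sums_iff power_minus')

lemma egf_exp1: "t \<noteq> 0 \<Longrightarrow> egf (\<lambda>n. (-1) ^ n / (real n + 1)) t = (1 - exp (- t)) / t"
proof -
  assume t: "t \<noteq> 0"
  have "(\<lambda>n. (- t) ^ Suc n / fact (Suc n)) sums (exp (- t) - 1)"
    using exp_series_sums[of "- t"] by (subst sums_Suc_iff) simp
  hence *: "(\<lambda>n. - ((- t) ^ Suc n / fact (Suc n)) / t) sums (- (exp (- t) - 1) / t)"
    by (intro sums_divide sums_minus)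
  have "- ((- t) ^ Suc n / fact (Suc n)) / t = (-1) ^ n / (real n + 1) * t ^ n / fact n" for n
    using t by (simp add: power_minus' divide_simps)
  with * show ?thesis unfolding egf_def by (simp only: sums_iff minus_diff_eq)
qed

lemma egf_exp2: "t \<noteq> 0 \<Longrightarrow> egf (\<lambda>n. (-1) ^ n / ((real n + 1) * (real n + 2))) t = (exp (- t) - 1 + t) / t ^ 2"
proof -
  assume t: "t \<noteq> 0"
  have "(\<lambda>n. (- t) ^ Suc n / fact (Suc n)) sums (exp (- t) - 1)"
    using exp_series_sums[of "- t"] by (subst sums_Suc_iff) simp
  hence "(\<lambda>n. (- t) ^ Suc (Suc n) / fact (Suc (Suc n))) sums (exp (- t) - 1 + t)"
    by (subst sums_Suc_iff) simp
  from sums_divide[OF this, of "t ^ 2"]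
  have "(\<lambda>n. (-1) ^ n / ((real n + 1) * (real n + 2)) * t ^ n / fact n) sums ((exp (- t) - 1 + t) / t ^ 2)"
    using t by (simp add: power_minus' power2_eq_square divide_simps) (simp add: algebra_simps)
  thus ?thesis by (simp add: egf_def sums_iff)
qed

text \<open>
  The flow kernel for increasing \<open>a\<close>.
\<close>

definition up_kernel :: "real \<Rightarrow> real" where "up_kernel = egf (flow_coeff 1 0)"
text \<open>
  The flow kernel for moving along the lines \<open>a + c\<close> constant, towards larger \<open>c\<close>.
\<close>

definition diag_kernel :: "real \<Rightarrow> real" where "diag_kernel = egf (flow_coeff (-1) 1)"
definition scale_kernel :: "real \<Rightarrow> real \<Rightarrow> real \<Rightarrow> real" where
  "scale_kernel a c = egf (scale_coeff a c)"

lemma flow_coeff_up: "flow_coeff 1 0 = (\<lambda>n. (-1) ^ n / (real n + 2))"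
  by (rule ext) (simp add: flow_coeff_def log_coeff_def add_ac)

lemma flow_coeff_diag: "flow_coeff (-1) 1 = (\<lambda>n. (-1) ^ n / ((real n + 1) * (real n + 2)))"
  by (rule ext) (simp add: flow_coeff_def log_coeff_def divide_simps, simp add: algebra_simps)

lemma diag_kernel_eq: "t > 0 \<Longrightarrow> diag_kernel t = (exp (- t) - 1 + t) / t ^ 2"
  unfolding diag_kernel_def flow_coeff_diag by (rule egf_exp2) simp

lemma up_kernel_eq:
  assumes "t > 0"
  shows "up_kernel t = (1 - exp (- t) * (1 + t)) / t ^ 2"
proof -
  have "flow_coeff 1 0 = (\<lambda>n. 1 * ((-1) ^ n / (real n + 1)) + (-1) * ((-1) ^ n / ((real n + 1) * (real n + 2))))"
    unfolding flow_coeff_up by (rule ext) (simp add: divide_simps, simp add: algebra_simps)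
  hence "up_kernel t = 1 * ((1 - exp (- t)) / t) + (-1) * ((exp (- t) - 1 + t) / t ^ 2)"
    unfolding up_kernel_def using assms
    by (simp only:, subst egf_add[OF geo_bounded_alt geo_bounded_alt])
       (simp_all add: egf_exp1 egf_exp2 abs_mult power_abs divide_simps mult_ge1_I)
  also have "\<dots> = (1 - exp (- t) * (1 + t)) / t ^ 2"
    using assms by (simp add: divide_simps power2_eq_square) (simp add: algebra_simps)
  finally show ?thesis .
qed

lemma scale_kernel_0 [simp]: "scale_kernel a c 0 = 0"
  by (simp add: scale_kernel_def scale_coeff_def)

lemma scale_kernel_eq:
  assumes "t > 0"
  shows "scale_kernel a c t = a * (t * up_kernel t) + c * (1 - exp (- t))"
proof -
  define z where "z = (\<lambda>n::nat. if n = 0 then 1 else 0 :: real)"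
  have ez: "egf z t = 1"
  proof -
    have "(\<lambda>n. z n * t ^ n / fact n) sums (\<Sum>n\<in>{0}. z n * t ^ n / fact n)"
      by (rule sums_finite) (auto simp: z_def)
    thus ?thesis by (simp add: egf_def sums_iff z_def)
  qed
  have b1: "geo_bounded 1 1 (\<lambda>n. (-1) ^ n / (real n + 1))"
    by (rule geo_bounded_alt) (simp add: power_abs divide_simps)
  have b2: "geo_bounded 1 1 (\<lambda>n. (-1) ^ n)" by (rule geo_bounded_alt) simp
  have b3: "geo_bounded 1 1 z" by (rule geo_bounded_alt) (simp add: z_def)
  have b4: "geo_bounded (1 + \<bar>a\<bar> + \<bar>c\<bar>) 1 (\<lambda>n. - (a + c) * (-1) ^ n + c * z n)"
    unfolding geo_bounded_def
  proof (intro conjI allI)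
    fix n
    have "\<bar>- (a + c) * (-1) ^ n + c * z n\<bar> \<le> (1 + \<bar>a\<bar> + \<bar>c\<bar>)"
      by (cases "even n"; cases "n = 0") (auto simp: z_def)
    thus "\<bar>- (a + c) * (-1) ^ n + c * z n\<bar> \<le> (1 + \<bar>a\<bar> + \<bar>c\<bar>) * 1 ^ n" by simp
  qed simp
  have "scale_coeff a c = (\<lambda>n. a * ((-1) ^ n / (real n + 1)) + 1 * (- (a + c) * (-1) ^ n + c * z n))"
    by (rule ext) (simp add: scale_coeff_def log_coeff_def z_def divide_simps, simp add: algebra_simps)
  hence "scale_kernel a c t = a * ((1 - exp (- t)) / t) + 1 * (- (a + c) * exp (- t) + c * 1)"
    unfolding scale_kernel_def using assms
    by (simp only: egf_add[OF b1 b4] egf_add[OF b2 b3] ez egf_exp egf_exp1)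
  also have "\<dots> = a * (t * up_kernel t) + c * (1 - exp (- t))"
    using assms unfolding up_kernel_eq[OF assms]
    by (simp add: divide_simps power2_eq_square) (simp add: algebra_simps)
  finally show ?thesis .
qed

lemma up_kernel_pos: "t > 0 \<Longrightarrow> up_kernel t > 0"
proof -
  assume t: "t > 0"
  have "1 + t < exp t" using t exp_minus_greater[of "-t"] by simp
  hence "exp (- t) * (1 + t) < exp (- t) * exp t" by (intro mult_strict_left_mono) auto
  also have "\<dots> = 1" by (simp flip: exp_add)
  finally show ?thesis using t by (simp add: up_kernel_eq)
qed

lemma up_kernel_0: "up_kernel 0 = 1 / 2"
  unfolding up_kernel_def flow_coeff_up by simp

lemma diag_kernel_pos: "t > 0 \<Longrightarrow> diag_kernel t > 0"
  using exp_minus_greater[of t] by (simp add: diag_kernel_eq)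

lemma diag_kernel_0: "diag_kernel 0 = 1 / 2"
  unfolding diag_kernel_def flow_coeff_diag by simp

lemma up_kernel_antimono:
  assumes "0 < u" "u \<le> t"
  shows "up_kernel t \<le> up_kernel u"
proof -
  have "(1 - exp (- t) * (1 + t)) / t ^ 2 \<le> (1 - exp (- u) * (1 + u)) / u ^ 2"
  proof (rule DERIV_nonpos_imp_nonincreasing[OF assms(2)])
    fix x assume x: "u \<le> x" "x \<le> t"
    hence x0: "x > 0" using assms by simp
    have "((\<lambda>x. (1 - exp (- x) * (1 + x)) / x ^ 2) has_real_derivative
       - ((2 - exp (- x) * (2 + 2 * x + x ^ 2)) / x ^ 3)) (at x)"
      using x0 by (auto intro!: derivative_eq_intros simp: divide_simps power2_eq_square power3_eq_cube)
        (simp add: algebra_simps)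
    moreover have "(2 - exp (- x) * (2 + 2 * x + x ^ 2)) / x ^ 3 \<ge> 0"
    proof -
      have "1 + x + x ^ 2 / 2 \<le> exp x" using x0 by (intro exp_lower_Taylor_quadratic) simp
      hence "exp (- x) * (1 + x + x ^ 2 / 2) \<le> exp (- x) * exp x" by (intro mult_left_mono) auto
      also have "\<dots> = 1" by (simp flip: exp_add)
      finally show ?thesis using x0 by (simp add: algebra_simps)
    qed
    ultimately show "\<exists>y. ((\<lambda>x. (1 - exp (- x) * (1 + x)) / x ^ 2) has_real_derivative y) (at x) \<and> y \<le> 0"
      by (intro exI[of _ "- ((2 - exp (- x) * (2 + 2 * x + x ^ 2)) / x ^ 3)"]) auto
  qed
  thus ?thesis using assms by (simp add: up_kernel_eq)
qed

lemma two_minus_times_exp_le: "0 \<le> t \<Longrightarrow> (2 - t) * exp t \<le> t + (2::real)"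
proof -
  assume t: "0 \<le> t"
  have "(\<lambda>t. t + 2 - (2 - t) * exp t) 0 \<le> (\<lambda>t. t + 2 - (2 - t) * exp t) t"
  proof (rule DERIV_nonneg_imp_nondecreasing[OF t])
    fix x :: real assume x: "0 \<le> x"
    have "((\<lambda>t. t + 2 - (2 - t) * exp t) has_real_derivative 1 - (1 - x) * exp x) (at x)"
      by (auto intro!: derivative_eq_intros simp: algebra_simps)
    moreover have "(1 - x) * exp x \<le> exp (- x) * exp x"
      using exp_ge_add_one_self[of "- x"] by (intro mult_right_mono) auto
    ultimately show "\<exists>y. ((\<lambda>t. t + 2 - (2 - t) * exp t) has_real_derivative y) (at x) \<and> 0 \<le> y"
      by (intro exI[of _ "1 - (1 - x) * exp x"]) (simp flip: exp_add)
  qed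
  thus ?thesis by simp
qed

lemma diag_kernel_antimono:
  assumes "0 < u" "u \<le> t"
  shows "diag_kernel t \<le> diag_kernel u"
proof -
  have "(exp (- t) - 1 + t) / t ^ 2 \<le> (exp (- u) - 1 + u) / u ^ 2"
  proof (rule DERIV_nonpos_imp_nonincreasing[OF assms(2)])
    fix x assume x: "u \<le> x" "x \<le> t"
    hence x0: "x > 0" using assms by simp
    have "((\<lambda>x. (exp (- x) - 1 + x) / x ^ 2) has_real_derivative
       - ((x + 2 - (2 - x) * exp x) * exp (- x) / x ^ 3 )) (at x)"
      using x0 by (auto intro!: derivative_eq_intros simp: divide_simps power2_eq_square power3_eq_cube exp_minus)
        (simp add: algebra_simps)
    moreover have "(x + 2 - (2 - x) * exp x) * exp (- x) / x ^ 3 \<ge> 0"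
      using two_minus_times_exp_le[of x] x0 by simp
    ultimately show "\<exists>y. ((\<lambda>x. (exp (- x) - 1 + x) / x ^ 2) has_real_derivative y) (at x) \<and> y \<le> 0"
      by (intro exI[of _ "- ((x + 2 - (2 - x) * exp x) * exp (- x) / x ^ 3)"]) auto
  qed
  thus ?thesis using assms by (simp add: diag_kernel_eq)
qed

text \<open>
  The derivative of the cubic times \<open>exp (- t)\<close> is
  \<open>(t - 1) * (3 * t - t^2 - 1) * exp (- t)\<close>, which changes sign once on the interval. Hence
  the product is at least its smaller endpoint value, and both endpoint values are at least 1.
\<close>

lemma exp_le_cubic:
  fixes t :: real
  assumes "1 \<le> t" "t \<le> 3"
  shows "exp t \<le> 1 + 2 * t - t ^ 2 + t ^ 3"
proof -
  define g where "g = (\<lambda>t::real. (1 + 2 * t - t ^ 2 + t ^ 3) * exp (- t))"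
  have d: "(g has_real_derivative (x - 1) * (3 * x - x ^ 2 - 1) * exp (- x)) (at x)" for x
    unfolding g_def
    by (auto intro!: derivative_eq_intros simp: algebra_simps power2_eq_square power3_eq_cube)
  have "g t \<ge> 1"
  proof (cases "t ^ 2 \<le> 3 * t - 1")
    case True
    have "g 1 \<le> g t"
    proof (rule DERIV_nonneg_imp_nondecreasing[OF assms(1)])
      fix x assume x: "1 \<le> x" "x \<le> t"
      have "(t - x) * (t + x - 3) \<ge> 0 \<or> x \<le> 2"
        using x by (cases "x \<le> 2") auto
      hence "x ^ 2 + 1 \<le> 3 * x"
      proof
        assume "(t - x) * (t + x - 3) \<ge> 0"
        thus ?thesis using True by (simp add: algebra_simps power2_eq_square)
      next
        assume "x \<le> 2"
        hence "(x - 1) * (2 - x) \<ge> 0" using x by simp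
        thus ?thesis using x by (simp add: algebra_simps power2_eq_square)
      qed
      thus "\<exists>y. (g has_real_derivative y) (at x) \<and> 0 \<le> y"
        using d[of x] x by (intro exI[of _ "(x - 1) * (3 * x - x ^ 2 - 1) * exp (- x)"]) auto
    qed
    moreover have "exp 1 \<le> (3 :: real)" using exp_le .
    hence "g 1 \<ge> 1" by (simp add: g_def exp_minus divide_simps)
    ultimately show ?thesis by simp
  next
    case False
    have t2: "t \<ge> 2"
    proof (rule ccontr)
      assume "\<not> t \<ge> 2"
      hence "(t - 1) * (2 - t) \<ge> 0" using assms by simp
      thus False using False assms by (simp add: algebra_simps power2_eq_square)
    qed
    have "g 3 \<le> g t"
    proof (rule DERIV_nonpos_imp_nonincreasing[OF assms(2)])
      fix x assume x: "t \<le> x" "x \<le> 3"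
      have "(x - t) * (t + x - 3) \<ge> 0" using x t2 by simp
      hence "3 * x - x ^ 2 - 1 \<le> 0" using False by (simp add: algebra_simps power2_eq_square)
      hence "(x - 1) * (3 * x - x ^ 2 - 1) * exp (- x) \<le> 0"
        using x assms by (intro mult_nonpos_nonneg mult_nonneg_nonpos) auto
      thus "\<exists>y. (g has_real_derivative y) (at x) \<and> y \<le> 0"
        using d[of x] by blast
    qed
    moreover have "exp 3 \<le> (25 :: real)"
    proof -
      have "exp (3::real) = exp 1 ^ 3" by (simp flip: exp_of_nat_mult)
      also have "\<dots> \<le> (2.75 :: real) ^ 3" using e_less_272 by (intro power_mono) auto
      also have "\<dots> \<le> 25" by (simp add: power3_eq_cube)
      finally show ?thesis .
    qed
    hence "g 3 \<ge> 1" by (simp add: g_def exp_minus divide_simps)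
    ultimately show ?thesis by simp
  qed
  hence "exp t * 1 \<le> exp t * g t" by (intro mult_left_mono) auto
  also have "exp t * g t = (1 + 2 * t - t ^ 2 + t ^ 3) * (exp t * exp (- t))"
    unfolding g_def by (simp only: mult_ac)
  also have "exp t * exp (- t) = 1" by (simp flip: exp_add)
  finally show ?thesis by simp
qed

text \<open>
  The difference of the two sides is, up to a positive factor, the numerator of the derivative
  of \<open>t * up_kernel t / diag_kernel t\<close>. For large \<open>t\<close> the left side grows like
  \<open>exp (2 * t)\<close> and wins, which limits all statements about the diagonal direction to a
  bounded interval.
\<close>

lemma kernel_quotient_ineq:
  fixes t :: real
  assumes "0 \<le> t" "t \<le> 3"
  shows "(exp t - 1 - t) ^ 2 \<le> t ^ 2 * (t * exp t - exp t + 1)"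
proof (cases "exp t \<le> 1 + t + t ^ 2")
  case True
  have "(exp t - 1 - t) * (exp t - 1 - t) \<le> t ^ 2 * (exp t - 1 - t)"
    using True exp_ge_add_one_self[of t] by (intro mult_right_mono) linarith+
  also have "\<dots> \<le> t ^ 2 * (t * exp t - exp t + 1)"
    using two_minus_times_exp_le[OF assms(1)] by (intro mult_left_mono) (auto simp: algebra_simps)
  finally show ?thesis by (simp add: power2_eq_square)
next
  case False
  have t: "t \<ge> 1" using exp_bound[of t] False assms by fastforce
  have "1 + 2 * t \<le> exp t * 1"
  proof -
    have "t * 1 \<le> t * t" using t by (intro mult_left_mono) auto
    thus ?thesis using False by (simp add: power2_eq_square)
  qed
  moreover have "exp t * (exp t + 1) \<le> exp t * (2 + 2 * t - t ^ 2 + t ^ 3)"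
    using exp_le_cubic[OF t assms(2)] by (intro mult_left_mono) auto
  ultimately have "exp t * exp t + (1 + 2 * t) \<le> exp t * (2 + 2 * t - t ^ 2 + t ^ 3)"
    by (simp add: algebra_simps)
  thus ?thesis by (simp add: power2_eq_square power3_eq_cube algebra_simps)
qed

lemma kernel_quotient_mono:
  assumes "0 < u" "u \<le> t" "t \<le> 3"
  shows "u * up_kernel u * diag_kernel t \<le> t * up_kernel t * diag_kernel u"
proof -
  define N where "N = (\<lambda>x::real. x - exp (- x) * (x + x ^ 2))"
  define E where "E = (\<lambda>x::real. exp (- x) - 1 + x)"
  have E: "E x > 0" if "x > 0" for x using exp_minus_greater[of x] that by (simp add: E_def)
  have "N u / E u \<le> N t / E t"
  proof (rule DERIV_nonneg_imp_nondecreasing[OF assms(2)])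
    fix x assume "u \<le> x" "x \<le> t"
    hence x: "0 < x" "x \<le> 3" using assms by auto
    let ?m = "exp (- x)"
    have dN: "(N has_real_derivative 1 - ?m * (1 + x - x ^ 2)) (at x)"
      unfolding N_def by (auto intro!: derivative_eq_intros simp: algebra_simps)
    have dE: "(E has_real_derivative 1 - ?m) (at x)"
      unfolding E_def by (auto intro!: derivative_eq_intros)
    have "?m * ?m * (exp x - 1 - x) ^ 2 \<le>
       ?m * ?m * (x ^ 2 * (x * exp x - exp x + 1))"
      using kernel_quotient_ineq[of x] x by (intro mult_left_mono) auto
    also have "?m * ?m * (exp x - 1 - x) ^ 2 = (?m * exp x - ?m - ?m * x) ^ 2"
      by (simp add: algebra_simps power2_eq_square)
    also have "\<dots> = (1 - ?m - ?m * x) ^ 2" by (simp flip: exp_add)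
    also have "?m * ?m * (x ^ 2 * (x * exp x - exp x + 1)) =
       x ^ 2 * ((?m * exp x) * (x * ?m - ?m) + ?m * ?m)"
      by (simp add: algebra_simps)
    also have "\<dots> = x ^ 2 * (x * ?m - ?m + ?m * ?m)" by (simp flip: exp_add)
    finally have *: "(1 - ?m - ?m * x) ^ 2 \<le> x ^ 2 * (x * ?m - ?m + ?m * ?m)" .
    have "0 \<le> (1 - ?m * (1 + x - x ^ 2)) * E x - N x * (1 - ?m)"
      using * unfolding N_def E_def by (simp add: algebra_simps power2_eq_square)
    thus "\<exists>y. ((\<lambda>x. N x / E x) has_real_derivative y) (at x) \<and> 0 \<le> y"
      using DERIV_divide[OF dN dE] E[of x] x
      by (intro exI[of _ "((1 - ?m * (1 + x - x ^ 2)) * E x - N x * (1 - ?m)) / (E x * E x)"]) auto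
  qed
  hence "N u * E t \<le> N t * E u"
    using E[of u] E[of t] assms by (simp add: field_simps)
  hence "N u * E t / (u ^ 2 * t ^ 2) \<le> N t * E u / (u ^ 2 * t ^ 2)"
    by (intro divide_right_mono) auto
  moreover have "x * up_kernel x = N x / x ^ 2" if "x > 0" for x
    using that by (simp add: up_kernel_eq N_def field_simps power2_eq_square)
  ultimately show ?thesis using assms
    by (simp add: diag_kernel_eq E_def mult_ac)
qed

section \<open>A maximum principle in the parameters\<close>

text \<open>
  Eliminating the inhomogeneous terms from the scale equation and the flow equation: with
  \<open>\<rho> = \<kappa> t / \<nu> t\<close>, the derivative of the density in the direction \<open>(p, q)\<close>
  is \<open>\<rho> * t * \<phi> t\<close> minus the integral of \<open>\<phi>\<close> against the weight
  \<open>\<kappa> (t - s) - \<rho> * \<nu> (t - s)\<close>. The weight is nonnegative if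
  \<open>\<kappa> / \<nu>\<close> decreases.
\<close>

lemma flow_identity:
  fixes a c p q t :: real
  defines "\<kappa> \<equiv> egf (flow_coeff p q)" and "\<nu> \<equiv> scale_kernel a c"
  assumes t: "t \<ge> 0"
  shows "((\<lambda>s. (\<kappa> (t - s) - \<kappa> t / \<nu> t * \<nu> (t - s)) * E_density a c s) has_integral
           (\<kappa> t / \<nu> t * (t * E_density a c t) - E_density_flow p q a c t + (\<kappa> t - \<kappa> t / \<nu> t * \<nu> t))) {0..t}"
proof -
  have "((\<lambda>s. \<kappa> (t - s) * E_density a c s - \<kappa> t / \<nu> t * (\<nu> (t - s) * E_density a c s)) has_integral
      ((\<kappa> t - E_density_flow p q a c t) - \<kappa> t / \<nu> t * (\<nu> t - t * E_density a c t))) {0..t}"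
    unfolding \<kappa>_def \<nu>_def scale_kernel_def
    by (intro has_integral_diff has_integral_mult_right E_density_flow_equation E_density_scale_equation t)
  thus ?thesis by (simp add: algebra_simps)
qed

lemma kernel_continuous_on [continuous_intros]:
  "continuous_on S (egf (flow_coeff p q))" "continuous_on S (scale_kernel a c)"
  unfolding scale_kernel_def
  by (rule egf_continuous_on[OF flow_geo_bounded] egf_continuous_on[OF scale_geo_bounded])+

text \<open>
  A maximum principle. Suppose the density is nonnegative at the end \<open>\<beta>\<close> of a
  parameter line, but negative somewhere before. Multiply it by \<open>exp (lam * u)\<close> and take the
  minimum of the product over the compact rectangle of all \<open>(u, t)\<close>. At this negative
  minimum the identity above bounds the derivative of the density in \<open>u\<close> by \<open>K * T\<close> times
  the depth of the minimum, so for \<open>lam > K * T\<close> the product still decreases in \<open>u\<close>. The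
  minimum is not at \<open>u = \<beta>\<close>, a contradiction.
\<close>

lemma nonneg_propagates_down:
  fixes a c p q \<beta> T :: real
  defines "\<phi> \<equiv> \<lambda>u. E_density (a + u * p) (c + u * q)"
  defines "\<kappa> \<equiv> egf (flow_coeff p q)" and "\<nu> \<equiv> \<lambda>u. scale_kernel (a + u * p) (c + u * q)"
  assumes \<kappa>_nonneg: "\<And>t. 0 \<le> t \<Longrightarrow> t \<le> T \<Longrightarrow> \<kappa> t \<ge> 0"
    and \<nu>_pos: "\<And>u t. 0 \<le> u \<Longrightarrow> u \<le> \<beta> \<Longrightarrow> 0 < t \<Longrightarrow> t \<le> T \<Longrightarrow> \<nu> u t > 0"
    and \<nu>_nonneg: "\<And>u. 0 \<le> u \<Longrightarrow> u \<le> \<beta> \<Longrightarrow> \<nu> u 0 = 0"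
    and ratio: "\<And>u s t. 0 \<le> u \<Longrightarrow> u \<le> \<beta> \<Longrightarrow> 0 \<le> s \<Longrightarrow> s \<le> t \<Longrightarrow> t \<le> T \<Longrightarrow> \<kappa> t * \<nu> u s \<le> \<kappa> s * \<nu> u t"
    and init: "\<And>u. 0 \<le> u \<Longrightarrow> u \<le> \<beta> \<Longrightarrow> (a + u * p) / 2 + (c + u * q) \<ge> 0"
    and final: "\<And>t. 0 \<le> t \<Longrightarrow> t \<le> T \<Longrightarrow> \<phi> \<beta> t \<ge> 0"
    and u: "0 \<le> u" "u \<le> \<beta>" and t: "0 \<le> t" "t \<le> T"
  shows "\<phi> u t \<ge> 0"
proof (rule ccontr)
  assume neg: "\<not> \<phi> u t \<ge> 0"
  obtain K where K: "\<And>s. 0 \<le> s \<Longrightarrow> s \<le> T \<Longrightarrow> \<kappa> s \<le> K"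
  proof -
    have "compact (\<kappa> ` {0..T})"
      unfolding \<kappa>_def by (intro compact_continuous_image continuous_intros) auto
    hence "bounded (\<kappa> ` {0..T})" by (rule compact_imp_bounded)
    then obtain B where B: "\<forall>y\<in>\<kappa> ` {0..T}. norm y \<le> B" unfolding bounded_iff by blast
    show ?thesis
    proof (rule that)
      fix s assume "0 \<le> s" "s \<le> T"
      hence "norm (\<kappa> s) \<le> B" using B by auto
      thus "\<kappa> s \<le> B" by simp
    qed
  qed
  have K0: "K \<ge> 0" using K[of 0] \<kappa>_nonneg[of 0] t by linarith
  \<comment> \<open>any value above \<open>K * T\<close> makes the product strictly decreasing at the minimum\<close>
  define lam where "lam = K * T + 1"
  define U where "U = (\<lambda>(u, t). exp (lam * u) * \<phi> u t)"
  have "continuous_on ({0..\<beta>} \<times> {0..T}) U"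
  proof -
    have "continuous_on ({0..\<beta>} \<times> {0..T})
        (\<lambda>x. exp (lam * fst x) * (\<lambda>(u, t). E_density (a + u * p) (c + u * q) t) x)"
      by (intro continuous_on_mult E_density_line_continuous_on continuous_intros)
    thus ?thesis by (simp add: U_def \<phi>_def case_prod_beta)
  qed
  then obtain x0 where x0: "x0 \<in> {0..\<beta>} \<times> {0..T}" and min: "\<And>x. x \<in> {0..\<beta>} \<times> {0..T} \<Longrightarrow> U x0 \<le> U x"
    using continuous_attains_inf[of "{0..\<beta>} \<times> {0..T}" U] u t
    by (metis atLeastAtMost_iff compact_Icc compact_Times empty_iff mem_Sigma_iff)
  obtain u0 t0 where x0_eq: "x0 = (u0, t0)" by (cases x0)
  have u0: "0 \<le> u0" "u0 \<le> \<beta>" and t0: "0 \<le> t0" "t0 \<le> T" using x0 x0_eq by auto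
  have "U (u0, t0) \<le> U (u, t)" using min[of "(u, t)"] u t x0_eq by simp
  also have "U (u, t) < 0" using neg by (simp add: U_def mult_pos_neg)
  finally have U0: "U (u0, t0) < 0" .
  hence \<phi>0: "\<phi> u0 t0 < 0" by (simp add: U_def mult_less_0_iff)
  have "t0 \<noteq> 0" using \<phi>0 init[OF u0] by (auto simp: \<phi>_def E_density_0)
  hence t0': "t0 > 0" using t0 by simp
  have "u0 \<noteq> \<beta>" using \<phi>0 final[OF t0] by auto
  hence u0': "u0 < \<beta>" using u0 by simp
  have lower: "\<phi> u0 t0 \<le> \<phi> u0 s" if "0 \<le> s" "s \<le> T" for s
    using min[of "(u0, s)"] that u0 x0_eq by (simp add: U_def)
  define F where "F = E_density_flow p q (a + u0 * p) (c + u0 * q) t0"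
  define \<rho> where "\<rho> = \<kappa> t0 / \<nu> u0 t0"
  have \<nu>0: "\<nu> u0 t0 > 0" using \<nu>_pos u0 t0 t0' by simp
  have \<rho>0: "\<rho> \<ge> 0" unfolding \<rho>_def using \<nu>0 \<kappa>_nonneg[OF t0] by simp
  have I1: "((\<lambda>s. (\<kappa> (t0 - s) - \<rho> * \<nu> u0 (t0 - s)) * \<phi> u0 s) has_integral
           (\<rho> * (t0 * \<phi> u0 t0) - F)) {0..t0}"
    using flow_identity[OF t0(1), of p q "a + u0 * p" "c + u0 * q"] \<nu>0
    by (simp add: \<kappa>_def \<nu>_def \<phi>_def F_def \<rho>_def)
  have I2: "((\<lambda>s. K * \<phi> u0 t0) has_integral (t0 - 0) *\<^sub>R (K * \<phi> u0 t0)) {0..t0}"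
    using has_integral_const_real[of "K * \<phi> u0 t0" 0 t0] t0 by simp
  have le: "K * \<phi> u0 t0 \<le> (\<kappa> (t0 - s) - \<rho> * \<nu> u0 (t0 - s)) * \<phi> u0 s" if s: "s \<in> {0..t0}" for s
  proof -
    define w where "w = \<kappa> (t0 - s) - \<rho> * \<nu> u0 (t0 - s)"
    have "\<kappa> t0 * \<nu> u0 (t0 - s) \<le> \<kappa> (t0 - s) * \<nu> u0 t0"
      using s t0 u0 by (intro ratio) auto
    hence w0: "w \<ge> 0" using \<nu>0 by (simp add: w_def \<rho>_def field_simps)
    have "\<nu> u0 (t0 - s) \<ge> 0"
      using \<nu>_pos[OF u0, of "t0 - s"] \<nu>_nonneg[OF u0] s t0 by (cases "s = t0") auto
    hence "w \<le> K" using K[of "t0 - s"] s t0 \<rho>0 unfolding w_def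
      by (smt (verit) atLeastAtMost_iff mult_nonneg_nonneg)
    hence "K * \<phi> u0 t0 \<le> w * \<phi> u0 t0" using \<phi>0 by (intro mult_right_mono_neg) auto
    also have "\<dots> \<le> w * \<phi> u0 s" using lower[of s] s t0 w0 by (intro mult_left_mono) auto
    finally show ?thesis by (simp add: w_def)
  qed
  have "(t0 - 0) *\<^sub>R (K * \<phi> u0 t0) \<le> \<rho> * (t0 * \<phi> u0 t0) - F"
    by (rule has_integral_le[OF I2 I1 le])
  moreover have "\<rho> * (t0 * \<phi> u0 t0) \<le> 0"
    using \<rho>0 t0 \<phi>0 by (intro mult_nonneg_nonpos) auto
  moreover have "T * (K * \<phi> u0 t0) \<le> t0 * (K * \<phi> u0 t0)"
    using t0 K0 \<phi>0 by (intro mult_right_mono_neg mult_nonneg_nonpos) auto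
  ultimately have "F \<le> - (T * (K * \<phi> u0 t0))" by simp
  hence Fneg: "lam * \<phi> u0 t0 + F < 0" using \<phi>0 unfolding lam_def by (simp add: algebra_simps)
  have "((\<lambda>v. exp (lam * v) * \<phi> v t0) has_real_derivative exp (lam * u0) * (lam * \<phi> u0 t0 + F)) (at u0)"
  proof -
    have 1: "((\<lambda>v. exp (lam * v)) has_real_derivative exp (lam * u0) * lam) (at u0)"
      by (auto intro!: derivative_eq_intros)
    have 2: "((\<lambda>v. \<phi> v t0) has_real_derivative F) (at u0)"
      unfolding \<phi>_def F_def by (rule E_density_line_deriv)
    show ?thesis using DERIV_mult[OF 1 2] by (simp add: algebra_simps)
  qed
  from DERIV_neg_dec_right[OF this] Fneg obtain d where d: "d > 0"
    and dec: "\<And>h. 0 < h \<Longrightarrow> h < d \<Longrightarrow> exp (lam * (u0 + h)) * \<phi> (u0 + h) t0 < exp (lam * u0) * \<phi> u0 t0"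
    by (auto simp: mult_pos_neg)
  define h where "h = min (d / 2) (\<beta> - u0)"
  have "0 < h" "h < d" "u0 + h \<le> \<beta>" using d u0' by (auto simp: h_def)
  from dec[OF this(1,2)] min[of "(u0 + h, t0)"] show False
    using u0 t0 \<open>0 < h\<close> \<open>u0 + h \<le> \<beta>\<close> x0_eq by (simp add: U_def)
qed

text \<open>
  Here \<open>scale_kernel / up_kernel\<close> is \<open>a * t + c * (1 - exp (- t)) / up_kernel t\<close>, a sum of
  increasing functions.
\<close>

lemma up_ratio:
  assumes a: "a \<ge> 0" and c: "c > 0" and s: "0 \<le> s" "s < t"
  shows "up_kernel t * scale_kernel a c s < up_kernel s * scale_kernel a c t"
proof (cases "s = 0")
  case True
  have "scale_kernel a c t > 0"
    using a c s up_kernel_pos[of t] True unfolding scale_kernel_eq[OF s(2)[unfolded True]]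
    by (intro add_nonneg_pos) auto
  thus ?thesis using True by (simp add: up_kernel_0)
next
  case False
  hence s0: "s > 0" "t > 0" using s by auto
  have "a * (up_kernel s * up_kernel t * (t - s)) \<ge> 0"
    using a s s0 up_kernel_pos[of s] up_kernel_pos[of t] by (intro mult_nonneg_nonneg) auto
  moreover have "up_kernel t * (1 - exp (- s)) < up_kernel s * (1 - exp (- t))"
    using up_kernel_antimono[of s t] up_kernel_pos[of s] up_kernel_pos[of t] s s0
    by (intro mult_le_less_imp_less) auto
  hence "c * (up_kernel t * (1 - exp (- s))) < c * (up_kernel s * (1 - exp (- t)))"
    using c by (intro mult_strict_left_mono)
  ultimately show ?thesis using s0 by (simp add: scale_kernel_eq algebra_simps)
qed

text \<open>
  Dividing \<open>scale_kernel\<close> by \<open>diag_kernel\<close> gives a combination of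
  \<open>t * up_kernel t / diag_kernel t\<close> and \<open>(1 - exp (- t)) / diag_kernel t\<close>, which both
  increase on \<open>{0<..3}\<close>.
\<close>

lemma diag_ratio:
  assumes a: "a \<ge> 0" and c: "c \<ge> 0" and s: "0 \<le> s" "s \<le> t" "t \<le> 3"
  shows "diag_kernel t * scale_kernel a c s \<le> diag_kernel s * scale_kernel a c t"
proof (cases "s = 0")
  case True
  have "scale_kernel a c t \<ge> 0"
  proof (cases "t = 0")
    case False
    thus ?thesis using a c s up_kernel_pos[of t] True
      by (subst scale_kernel_eq) (auto intro!: add_nonneg_nonneg mult_nonneg_nonneg)
  qed simp
  thus ?thesis using True by (simp add: diag_kernel_0)
next
  case False
  hence s0: "s > 0" "t > 0" using s by auto
  have "a * (s * up_kernel s * diag_kernel t) \<le> a * (t * up_kernel t * diag_kernel s)"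
    using a s s0 by (intro mult_left_mono kernel_quotient_mono) auto
  moreover have "diag_kernel t * (1 - exp (- s)) \<le> diag_kernel s * (1 - exp (- t))"
    using diag_kernel_antimono[of s t] diag_kernel_pos[of s] s s0
    by (intro mult_mono) auto
  hence "c * (diag_kernel t * (1 - exp (- s))) \<le> c * (diag_kernel s * (1 - exp (- t)))"
    using c by (intro mult_left_mono)
  ultimately show ?thesis using s0 by (simp add: scale_kernel_eq algebra_simps)
qed

lemma scale_kernel_pos:
  assumes "a \<ge> 0" "c \<ge> 0" "a + c > 0" "t > 0"
  shows "scale_kernel a c t > 0"
proof -
  have "t * up_kernel t > 0" "1 - exp (- t) > 0" using assms up_kernel_pos by auto
  hence "a * (t * up_kernel t) \<ge> 0" "c * (1 - exp (- t)) \<ge> 0"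
    "a * (t * up_kernel t) > 0 \<or> c * (1 - exp (- t)) > 0"
    using assms by (auto simp: zero_less_mult_iff)
  thus ?thesis unfolding scale_kernel_eq[OF assms(4)] by linarith
qed

lemma E_density_nonneg_down:
  assumes c: "c > 0" and \<alpha>: "0 \<le> \<alpha>" "\<alpha> \<le> \<beta>" and nonneg: "\<And>t. 0 \<le> t \<Longrightarrow> t \<le> T \<Longrightarrow> E_density \<beta> c t \<ge> 0"
    and t: "0 \<le> t" "t \<le> T"
  shows "E_density \<alpha> c t \<ge> 0"
proof -
  have "E_density (0 + \<alpha> * 1) (c + \<alpha> * 0) t \<ge> 0"
  proof (rule nonneg_propagates_down[where \<beta> = \<beta> and T = T])
    fix u s t :: real assume "0 \<le> u" "0 \<le> s" "s \<le> t"
    thus "egf (flow_coeff 1 0) t * scale_kernel (0 + u * 1) (c + u * 0) s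
       \<le> egf (flow_coeff 1 0) s * scale_kernel (0 + u * 1) (c + u * 0) t"
      using up_ratio[of u c s t] c by (cases "s = t") (auto simp: up_kernel_def)
  next
    fix t :: real assume "0 \<le> t"
    thus "egf (flow_coeff 1 0) t \<ge> 0"
      using up_kernel_pos[of t] up_kernel_0 by (cases "t = 0") (auto simp: up_kernel_def)
  qed (use assms in \<open>auto intro!: scale_kernel_pos\<close>)
  thus ?thesis by simp
qed

text \<open>
  At a zero of a nonnegative density only the weighted integral remains in the flow identity,
  and the weight is positive. Increasing \<open>a\<close> pushes the density below zero there.
\<close>

lemma E_density_flow_neg_at_zero:
  assumes a: "a \<ge> 0" and c: "c > 0" and t: "t > 0" and nonneg: "\<And>s. 0 \<le> s \<Longrightarrow> s \<le> t \<Longrightarrow> E_density a c s \<ge> 0"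
    and zero: "E_density a c t = 0"
  shows "E_density_flow 1 0 a c t < 0"
proof -
  define \<rho> where "\<rho> = up_kernel t / scale_kernel a c t"
  define f where "f = (\<lambda>s. (up_kernel (t - s) - \<rho> * scale_kernel a c (t - s)) * E_density a c s)"
  have \<nu>: "scale_kernel a c t > 0" using scale_kernel_pos[of a c t] a c t by simp
  have int: "(f has_integral (- E_density_flow 1 0 a c t)) {0..t}"
    using flow_identity[of t 1 0 a c] t \<nu> zero by (simp add: f_def \<rho>_def up_kernel_def)
  have w: "up_kernel (t - s) - \<rho> * scale_kernel a c (t - s) > 0" if "0 < s" "s \<le> t" for s
    using up_ratio[OF a c, of "t - s" t] that \<nu> by (simp add: \<rho>_def field_simps)
  have w': "up_kernel (t - s) - \<rho> * scale_kernel a c (t - s) \<ge> 0" if "0 \<le> s" "s \<le> t" for s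
    using w[of s] that \<nu> by (cases "s = 0") (auto simp: \<rho>_def)
  have f0: "f s \<ge> 0" if "s \<in> {0..t}" for s
    unfolding f_def using that by (intro mult_nonneg_nonneg w' nonneg) auto
  have "continuous_on {0..t} f"
    unfolding f_def up_kernel_def
    by (intro continuous_intros continuous_on_compose2[OF kernel_continuous_on(1)[of UNIV]]
        continuous_on_compose2[OF kernel_continuous_on(2)[of UNIV]] E_density_continuous_on) auto
  have "- E_density_flow 1 0 a c t \<ge> 0" using has_integral_nonneg[OF int f0] .
  moreover have "- E_density_flow 1 0 a c t \<noteq> 0"
  proof
    assume "- E_density_flow 1 0 a c t = 0"
    hence int0: "(f has_integral 0) (cbox 0 t)" using int by simp
    have f_zero: "f s = 0" if "s \<in> {0..t}" for s
      using has_integral_0_cbox_imp_0[OF _ _ int0] \<open>continuous_on {0..t} f\<close> f0 that t by auto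
    have "continuous_on UNIV (E_density a c)" by (rule E_density_continuous_on)
    hence "isCont (E_density a c) 0" by (simp add: continuous_on_eq_continuous_at)
    moreover have "E_density a c 0 > 0" using a c by (simp add: E_density_0)
    ultimately have "\<forall>\<^sub>F s in at 0. E_density a c s > 0"
      by (simp add: isCont_def order_tendstoD)
    hence "\<forall>\<^sub>F s in at_right 0. E_density a c s > 0"
      by (rule filter_leD[rotated]) (simp add: at_le)
    moreover have "\<forall>\<^sub>F s in at_right 0. s \<in> {0<..<t}" using eventually_at_right_real[OF t] .
    ultimately have "\<forall>\<^sub>F s in at_right 0. E_density a c s > 0 \<and> s \<in> {0<..<t}" by (rule eventually_conj)
    then obtain s where s: "E_density a c s > 0" "s \<in> {0<..<t}"
      using eventually_happens[of _ "at_right (0::real)"] by auto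
    have "f s > 0" unfolding f_def using s w[of s] by (intro mult_pos_pos) auto
    thus False using f_zero[of s] s by simp
  qed
  ultimately show ?thesis by simp
qed

text \<open>
  Nonnegativity persists for smaller \<open>a\<close>, and a zero at \<open>\<alpha>\<close> would turn into a
  negative value just above \<open>\<alpha>\<close>.
\<close>

lemma E_density_pos_down:
  assumes c: "c > 0" and \<alpha>: "0 \<le> \<alpha>" "\<alpha> < \<beta>" and nonneg: "\<And>t. 0 \<le> t \<Longrightarrow> E_density \<beta> c t \<ge> 0"
    and t: "0 \<le> t"
  shows "E_density \<alpha> c t > 0"
proof (rule ccontr)
  have *: "E_density u c s \<ge> 0" if "0 \<le> u" "u \<le> \<beta>" "0 \<le> s" for u s
    using E_density_nonneg_down[OF c, of u \<beta> s s] that nonneg by simp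
  assume "\<not> E_density \<alpha> c t > 0"
  hence zero: "E_density \<alpha> c t = 0" using *[of \<alpha> t] \<alpha> t by simp
  have "t \<noteq> 0" using zero \<alpha> c by (auto simp: E_density_0)
  hence t0: "t > 0" using t by simp
  have neg: "E_density_flow 1 0 \<alpha> c t < 0"
    using \<alpha> c t0 zero * by (intro E_density_flow_neg_at_zero) auto
  have "((\<lambda>u. E_density u c t) has_real_derivative E_density_flow 1 0 \<alpha> c t) (at \<alpha>)"
    using E_density_line_deriv[of 0 1 c 0 t \<alpha>] by simp
  from DERIV_neg_dec_right[OF this neg] obtain d where d: "d > 0"
    and dec: "\<And>h. 0 < h \<Longrightarrow> h < d \<Longrightarrow> E_density (\<alpha> + h) c t < E_density \<alpha> c t" by auto
  define h where "h = min (d / 2) (\<beta> - \<alpha>)"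
  have h: "0 < h" "h < d" "\<alpha> + h \<le> \<beta>" using d \<alpha> by (auto simp: h_def)
  show False using dec[OF h(1,2)] *[of "\<alpha> + h" t] \<alpha> h t zero by simp
qed

section \<open>A negative value on the line a + c = 3\<close>

text \<open>
  The value is about \<open>-0.0041\<close>. With alternating signs removed, the coefficients \<open>g n\<close> are
  rational and at most \<open>(n + 1) * (n + 2) / 2\<close>, the coefficients of \<open>(1 - u) ^ (-3)\<close>.
  Fifteen terms of the series are evaluated exactly, and the rest is dominated by a geometric
  series.
\<close>

lemma E_density_3_0_neg: "E_density 3 0 3 < 0"
proof -
  define g where "g = (\<lambda>n. (-1) ^ n * fps_nth (E_fps 3 0) n)"
  have g_0: "g 0 = 1" by (simp add: g_def)
  have g_rec: "real (Suc n) * g (Suc n) = (\<Sum>i\<le>n. 3 * (real i + 1) / (real i + 2) * g (n - i))" for n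
  proof -
    have "real (Suc n) * g (Suc n) = (-1) ^ Suc n * (\<Sum>i\<le>n. real (Suc i) * log_coeff 3 0 (Suc i) * fps_nth (E_fps 3 0) (n - i))"
      using E_fps_rec[of n 3 0] by (simp add: g_def del: of_nat_Suc)
    also have "\<dots> = (\<Sum>i\<le>n. 3 * (real i + 1) / (real i + 2) * g (n - i))"
      unfolding sum_distrib_left
    proof (intro sum.cong refl)
      fix i assume "i \<in> {..n}"
      then obtain k where k: "n = i + k" using le_iff_add by auto
      show "(-1) ^ Suc n * (real (Suc i) * log_coeff 3 0 (Suc i) * fps_nth (E_fps 3 0) (n - i)) =
        3 * (real i + 1) / (real i + 2) * g (n - i)"
        unfolding k by (cases "even i"; cases "even k") (simp_all add: log_coeff_def g_def minus_one_power_iff add_ac)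
    qed
    finally show ?thesis .
  qed
  have g_bound: "0 \<le> g n \<and> g n \<le> (real n + 1) * (real n + 2) / 2" for n
  proof (induction n rule: less_induct)
    case (less n)
    show ?case
    proof (cases n)
      case (Suc m)
      have "real (Suc m) * g (Suc m) \<ge> 0"
        unfolding g_rec using less.IH Suc by (intro sum_nonneg mult_nonneg_nonneg) auto
      hence 1: "g (Suc m) \<ge> 0" by (simp add: zero_le_mult_iff del: of_nat_Suc)
      have "real (Suc m) * g (Suc m) \<le> (\<Sum>i\<le>m. 3 * ((real (m - i) + 1) * (real (m - i) + 2) / 2))"
        unfolding g_rec
      proof (intro sum_mono mult_mono)
        fix i
        show "3 * (real i + 1) / (real i + 2) \<le> 3" by (simp add: divide_simps)
        show "g (m - i) \<le> (real (m - i) + 1) * (real (m - i) + 2) / 2"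
          by (intro conjunct2[OF less.IH]) (use Suc in auto)
      qed (use less.IH Suc in auto)
      also have "\<dots> = (\<Sum>i\<le>m. 3 * ((real i + 1) * (real i + 2) / 2))"
        by (rule sum.reindex_bij_witness[of _ "\<lambda>i. m - i" "\<lambda>i. m - i"]) auto
      also have "\<dots> = (real m + 1) * (real m + 2) * (real m + 3) / 2"
        by (induction m) (auto simp: field_simps)
      also have "\<dots> = real (Suc m) * ((real (Suc m) + 1) * (real (Suc m) + 2) / 2)"
        by (simp add: add_ac mult_ac)
      finally have "g (Suc m) \<le> (real (Suc m) + 1) * (real (Suc m) + 2) / 2"
        by (rule mult_left_le_imp_le) simp
      with 1 Suc show ?thesis by simp
    qed (simp add: g_0)
  qed
  have g_rec': "real n * g n = (\<Sum>i<n. 3 * (real i + 1) / (real i + 2) * g (n - 1 - i))" if "n > 0" for n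
    using g_rec[of "n - 1"] that by (cases n) (simp_all add: lessThan_Suc_atMost)
  have v1: "g (Suc 0) = 3 / 2"
    using g_rec[of 0] by (simp add: g_0)
  have v2: "g 2 = 17 / 8"
    using g_rec'[of 2] by (simp add: lessThan_nat_numeral g_0 v1)
  have v3: "g 3 = 45 / 16"
    using g_rec'[of 3] by (simp add: lessThan_nat_numeral g_0 v1 v2)
  have v4: "g 4 = 2279 / 640"
    using g_rec'[of 4] by (simp add: lessThan_nat_numeral g_0 v1 v2 v3)
  have v5: "g 5 = 5593 / 1280"
    using g_rec'[of 5] by (simp add: lessThan_nat_numeral g_0 v1 v2 v3 v4)
  have v6: "g 6 = 563149 / 107520"
    using g_rec'[of 6] by (simp add: lessThan_nat_numeral g_0 v1 v2 v3 v4 v5)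
  have v7: "g 7 = 441879 / 71680"
    using g_rec'[of 7] by (simp add: lessThan_nat_numeral g_0 v1 v2 v3 v4 v5 v6)
  have v8: "g 8 = 41000637 / 5734400"
    using g_rec'[of 8] by (simp add: lessThan_nat_numeral g_0 v1 v2 v3 v4 v5 v6 v7)
  have v9: "g 9 = 13423641 / 1638400"
    using g_rec'[of 9] by (simp add: lessThan_nat_numeral g_0 v1 v2 v3 v4 v5 v6 v7 v8)
  have v10: "g 10 = 2009948791 / 216268800"
    using g_rec'[of 10] by (simp add: lessThan_nat_numeral g_0 v1 v2 v3 v4 v5 v6 v7 v8 v9)
  have v11: "g 11 = 31644308917 / 3027763200"
    using g_rec'[of 11] by (simp add: lessThan_nat_numeral g_0 v1 v2 v3 v4 v5 v6 v7 v8 v9 v10)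
  have v12: "g 12 = 35063992498399 / 3005743104000"
    using g_rec'[of 12] by (simp add: lessThan_nat_numeral g_0 v1 v2 v3 v4 v5 v6 v7 v8 v9 v10 v11)
  have v13: "g 13 = 57028577087533 / 4408423219200"
    using g_rec'[of 13] by (simp add: lessThan_nat_numeral g_0 v1 v2 v3 v4 v5 v6 v7 v8 v9 v10 v11 v12)
  have v14: "g 14 = 107789081099797 / 7557296947200"
    using g_rec'[of 14] by (simp add: lessThan_nat_numeral g_0 v1 v2 v3 v4 v5 v6 v7 v8 v9 v10 v11 v12 v13)
  have v15: "g 15 = 183923067365067 / 11755795251200"
    using g_rec'[of 15] by (simp add: lessThan_nat_numeral g_0 v1 v2 v3 v4 v5 v6 v7 v8 v9 v10 v11 v12 v13 v14)
  define a where "a = (\<lambda>n. (-1) ^ n * g (Suc n) * 3 ^ n / fact n)"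
  have a_sums: "a sums E_density 3 0 3"
    using egf_sums[OF E_density_geo_bounded, of 3 0 3]
    by (simp add: a_def E_density_def E_density_coeff_def g_def mult.assoc flip: power_mult_distrib)
  define K :: real where "K = 153 * 3 ^ 15 / fact 15"
  have tail: "\<bar>a (m + 15)\<bar> \<le> K * (1 / 4) ^ m" for m
  proof -
    have "\<bar>a (m + 15)\<bar> = g (m + 16) * (3 ^ (m + 15) / fact (m + 15))"
      using g_bound[of "m + 16"] by (simp add: a_def abs_mult add_ac)
    also have "\<dots> \<le> ((real m + 17) * (real m + 18) / 2) * (3 ^ (m + 15) / fact (m + 15))"
      using g_bound[of "m + 16"] by (intro mult_right_mono) (auto simp: add_ac)
    also have "\<dots> \<le> K * (1 / 4) ^ m"
    proof (induction m)
      case (Suc m)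
      have "((real (Suc m) + 17) * (real (Suc m) + 18) / 2) * (3 ^ (Suc m + 15) / fact (Suc m + 15))
        = ((real m + 17) * (real m + 18) / 2 * (3 ^ (m + 15) / fact (m + 15))) * ((real m + 19) / (real m + 17) * (3 / (real m + 16)))"
      proof -
        define P Q :: real where "P = 3 ^ (m + 15)" and "Q = fact (m + 15)"
        have "Q > 0" by (simp add: Q_def)
        thus ?thesis
          unfolding add_Suc power_Suc fact_Suc P_def[symmetric] Q_def[symmetric]
          by (simp add: divide_simps) (simp add: algebra_simps)
      qed
      also have "\<dots> \<le> (K * (1 / 4) ^ m) * (1 / 4)"
      proof (rule mult_mono[OF Suc])
        have "(real m + 19) / (real m + 17) * (3 / (real m + 16)) \<le> (19 / 17) * (3 / 16)"
          by (intro mult_mono) (auto simp: divide_simps)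
        also have "(19 / 17) * (3 / 16) \<le> (1 / 4 :: real)" by simp
        finally show "(real m + 19) / (real m + 17) * (3 / (real m + 16)) \<le> 1 / 4" .
      qed (auto simp: K_def)
      finally show ?case by simp
    qed (simp add: K_def)
    finally show ?thesis .
  qed
  have "(\<lambda>m. a (m + 15)) sums (E_density 3 0 3 - (\<Sum>n<15. a n))"
    using a_sums by (rule sums_split_initial_segment)
  moreover have "(\<lambda>m. K * (1 / 4) ^ m) sums (K * (1 / (1 - 1 / 4)))"
    by (intro sums_mult geometric_sums) simp
  ultimately have "E_density 3 0 3 - (\<Sum>n<15. a n) \<le> K * (1 / (1 - 1 / 4))"
    by (rule sums_le[rotated]) (use tail abs_le_D1 in blast)
  moreover have "(\<Sum>n<15. a n) + K * (1 / (1 - 1 / 4)) < 0"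
    by (simp add: lessThan_nat_numeral a_def K_def fact_numeral v1 v2 v2[unfolded numeral_2_eq_2] v3 v4 v5 v6 v7 v8 v9 v10 v11 v12 v13 v14 v15)
  ultimately show ?thesis by linarith
qed

text \<open>
  If the density were nonnegative on \<open>{0..3}\<close> for the parameters \<open>(3 - c, c)\<close>, it would be
  so for \<open>(3, 0)\<close> by the maximum principle along the line \<open>a + c = 3\<close>.
\<close>

lemma E_density_neg_on_diagonal:
  assumes c: "0 \<le> c" "c \<le> 3"
  shows "\<exists>t\<in>{0..3}. E_density (3 - c) c t < 0"
proof (rule ccontr)
  assume "\<not> ?thesis"
  hence nonneg: "E_density (3 - c) c t \<ge> 0" if "0 \<le> t" "t \<le> 3" for t
    using that by (meson atLeastAtMost_iff not_less)
  have "E_density (3 + 0 * (-1)) (0 + 0 * 1) 3 \<ge> 0"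
  proof (rule nonneg_propagates_down[where \<beta> = c and T = 3])
    fix u s t :: real assume "0 \<le> u" "u \<le> c" "0 \<le> s" "s \<le> t" "t \<le> 3"
    thus "egf (flow_coeff (-1) 1) t * scale_kernel (3 + u * (-1)) (0 + u * 1) s
       \<le> egf (flow_coeff (-1) 1) s * scale_kernel (3 + u * (-1)) (0 + u * 1) t"
      using diag_ratio[of "3 - u" u s t] c by (auto simp: diag_kernel_def)
  next
    fix t :: real assume "0 \<le> t"
    thus "egf (flow_coeff (-1) 1) t \<ge> 0"
      using diag_kernel_pos[of t] diag_kernel_0 by (cases "t = 0") (auto simp: diag_kernel_def)
  next
    fix u t :: real assume "0 \<le> u" "u \<le> c" "0 < t"
    thus "scale_kernel (3 + u * (-1)) (0 + u * 1) t > 0"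
      using c by (intro scale_kernel_pos) auto
  qed (use c nonneg in auto)
  thus False using E_density_3_0_neg by simp
qed

section \<open>The expansion at infinity and the residue there\<close>

text \<open>
  The analytic continuation of \<open>\<lambda>y. F a (- c) (a * y)\<close>. It is holomorphic off the
  segment \<open>cut\<close>.
\<close>

definition E_complex :: "real \<Rightarrow> real \<Rightarrow> complex \<Rightarrow> complex" where
  "E_complex a c z = exp ((of_real a * z - of_real c) * Ln (1 + 1 / z))"

definition cut :: "complex set" where
  "cut = of_real ` {-1..0}"

lemma cut_closed: "closed cut"
  unfolding cut_def by (intro compact_imp_closed compact_continuous_image continuous_intros) auto

lemma one_plus_inverse_nonpos_Reals_iff:
  assumes "z \<notin> cut"
  shows "1 + 1 / z \<notin> \<real>\<^sub>\<le>\<^sub>0"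
proof
  assume "1 + 1 / z \<in> \<real>\<^sub>\<le>\<^sub>0"
  then obtain r where r: "1 + 1 / z = of_real r" "r \<le> 0" by (auto elim!: nonpos_Reals_cases)
  hence eq: "1 / z = of_real (r - 1)" by (simp add: algebra_simps)
  have "z = 1 / (1 / z)" by simp
  also have "\<dots> = of_real (1 / (r - 1))" unfolding eq by simp
  finally have "z = of_real (1 / (r - 1))" .
  moreover have "1 / (r - 1) \<in> {-1..0}" using r by (auto simp: divide_simps)
  ultimately show False using assms unfolding cut_def by (metis imageI)
qed

lemma E_complex_holomorphic: "E_complex a c holomorphic_on (- cut)"
  unfolding E_complex_def
  by (intro holomorphic_intros) (use one_plus_inverse_nonpos_Reals_iff in \<open>auto simp: cut_def\<close>)

lemma E_complex_cnj:
  assumes "z \<notin> cut"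
  shows "E_complex a c (cnj z) = cnj (E_complex a c z)"
  using cnj_Ln[OF one_plus_inverse_nonpos_Reals_iff[OF assms]]
  by (simp add: E_complex_def exp_cnj)

lemma not_in_cutI: "norm z > 1 \<Longrightarrow> z \<notin> cut"
  by (auto simp: cut_def)

lemma not_in_cut_Im: "Im z \<noteq> 0 \<Longrightarrow> z \<notin> cut"
  by (auto simp: cut_def)

lemma geometric_bound_conv_radius:
  fixes f :: "complex fps"
  assumes "M > 0" and "\<And>n. norm (fps_nth f n) \<le> C * M ^ n"
  shows "fps_conv_radius f \<ge> ereal (1 / M)"
  unfolding fps_conv_radius_def
proof (rule conv_radius_geI_ex)
  fix r :: real assume r: "0 < r" "ereal r < ereal (1 / M)"
  show "\<exists>z. norm z = r \<and> summable (\<lambda>n. fps_nth f n * z ^ n)"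
  proof (intro exI conjI)
    show "norm (of_real r :: complex) = r" using r by simp
    show "summable (\<lambda>n. fps_nth f n * of_real r ^ n)"
    proof (rule summable_comparison_test')
      show "summable (\<lambda>n. C * (M * r) ^ n)"
        using r assms by (intro summable_mult summable_geometric) (auto simp: field_simps)
      fix n show "norm (fps_nth f n * of_real r ^ n) \<le> C * (M * r) ^ n"
        using assms(2)[of n] r by (simp add: norm_mult norm_power power_mult_distrib mult_right_mono flip: mult.assoc)
    qed
  qed
qed

lemma fps_exp_compose_of_real:
  "fps_nth (fps_exp 1 oo Abs_fps (\<lambda>n. complex_of_real (log_coeff a c n))) n = of_real (fps_nth (E_fps a c) n)"
proof (induction n rule: less_induct)
  case (less n)
  define l where "l = Abs_fps (\<lambda>n. complex_of_real (log_coeff a c n))"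
  show ?case
  proof (cases n)
    case (Suc m)
    have "of_nat (Suc m) * fps_nth (fps_exp 1 oo l) (Suc m) =
      (\<Sum>i\<le>m. of_nat (Suc i) * fps_nth l (Suc i) * fps_nth (fps_exp 1 oo l) (m - i))"
      by (rule fps_exp_compose_rec) (simp add: l_def)
    also have "\<dots> = (\<Sum>i\<le>m. of_real (real (Suc i) * log_coeff a c (Suc i) * fps_nth (E_fps a c) (m - i)))"
      using less.IH Suc unfolding l_def by (intro sum.cong refl) simp
    also have "\<dots> = of_real (real (Suc m) * fps_nth (E_fps a c) (Suc m))"
      by (simp only: E_fps_rec of_real_sum)
    also have "\<dots> = of_nat (Suc m) * of_real (fps_nth (E_fps a c) (Suc m))"
      by (simp only: of_real_mult of_real_of_nat_eq)
    finally show ?thesis unfolding Suc l_def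
      using of_nat_neq_0 mult_left_cancel by blast
  qed simp
qed

lemma log_series:
  assumes "norm u < 1" "u \<noteq> 0"
  shows "(\<lambda>n. of_real (log_coeff a c n) * u ^ n) sums
           ((of_real a * (1 / u) - of_real c) * Ln (1 + u) - of_real a)"
proof -
  have L: "(\<lambda>n. - ((- u) ^ n) / of_nat n) sums Ln (1 + u)"
    using Ln_series'[OF assms(1)] .
  have "(\<lambda>n. - ((- u) ^ Suc n) / of_nat (Suc n)) sums Ln (1 + u)"
    using L by (subst sums_Suc_iff) simp
  hence "(\<lambda>n. - ((- u) ^ Suc n) / of_nat (Suc n) / u) sums (Ln (1 + u) / u)"
    by (rule sums_divide)
  moreover have "- ((- u) ^ Suc n) / of_nat (Suc n) / u = (- u) ^ n / of_nat (Suc n)" for n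
    using assms by (simp del: of_nat_Suc)
  ultimately have L1: "(\<lambda>n. (- u) ^ n / of_nat (Suc n)) sums (Ln (1 + u) / u)" by simp
  have "(\<lambda>n. of_real a * ((- u) ^ n / of_nat (Suc n) - (if n = 0 then 1 else 0)) - of_real c * (- ((- u) ^ n) / of_nat n))
      sums (of_real a * (Ln (1 + u) / u - 1) - of_real c * Ln (1 + u))"
    by (intro sums_diff sums_mult L1 L) (rule sums_single)
  moreover have "of_real a * ((- u) ^ n / of_nat (Suc n) - (if n = 0 then 1 else 0)) - of_real c * (- ((- u) ^ n) / of_nat n)
      = of_real (log_coeff a c n) * u ^ n" for n
    by (cases "n = 0") (simp_all add: log_coeff_def power_minus[of u n] algebra_simps)
  moreover have "of_real a * (Ln (1 + u) / u - 1) - of_real c * Ln (1 + u) =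
     (of_real a * (1 / u) - of_real c) * Ln (1 + u) - of_real a"
    by (simp add: algebra_simps)
  ultimately show ?thesis by simp
qed

text \<open>
  Both \<open>eval_fps g\<close> and \<open>exp (eval_fps l)\<close> solve the linear differential equation
  \<open>G' = l' * G\<close> near 0 and agree at 0.
\<close>

lemma E_complex_expansion:
  assumes z: "norm z > 1 + (\<bar>a\<bar> + \<bar>c\<bar>)"
  shows "(\<lambda>n. of_real (exp a * fps_nth (E_fps a c) n) * (1 / z) ^ n) sums E_complex a c z"
proof -
  define M where "M = 1 + (\<bar>a\<bar> + \<bar>c\<bar>)"
  have M: "M \<ge> 1" by (simp add: M_def)
  define l where "l = Abs_fps (\<lambda>n. complex_of_real (log_coeff a c n))"
  define g where "g = fps_exp 1 oo l"
  have l0: "fps_nth l 0 = 0" by (simp add: l_def)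
  have g_nth: "fps_nth g n = of_real (fps_nth (E_fps a c) n)" for n
    unfolding g_def l_def by (rule fps_exp_compose_of_real)
  have rg: "fps_conv_radius g \<ge> ereal (1 / M)"
    using M by (intro geometric_bound_conv_radius[of M g 1]) (auto simp: g_nth M_def E_fps_bound)
  have rl: "fps_conv_radius l \<ge> ereal (1 / 1)"
    by (intro geometric_bound_conv_radius[of 1 l "\<bar>a\<bar> + \<bar>c\<bar>"]) (auto simp: l_def log_coeff_bound1)
  have in_ball: "ereal (norm u) < fps_conv_radius g" "ereal (norm u) < fps_conv_radius l" if "u \<in> ball 0 (1 / M)" for u
  proof -
    have "norm u < 1 / M" "1 / M \<le> 1" using that M by auto
    hence lt: "ereal (norm u) < ereal (1 / M)" "ereal (norm u) < ereal (1 / 1)" by simp_all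
    show "ereal (norm u) < fps_conv_radius g" by (rule order_less_le_trans[OF lt(1) rg])
    show "ereal (norm u) < fps_conv_radius l" by (rule order_less_le_trans[OF lt(2) rl])
  qed
  have dg: "(eval_fps g has_field_derivative eval_fps (fps_deriv l) u * eval_fps g u) (at u)"
    if u: "u \<in> ball 0 (1 / M)" for u
  proof -
    have "fps_deriv g = fps_deriv l * g" unfolding g_def by (rule fps_exp_compose_deriv[OF l0])
    moreover have "ereal (norm u) < fps_conv_radius (fps_deriv l)"
      by (rule order_less_le_trans[OF in_ball(2)[OF u] fps_conv_radius_deriv])
    ultimately show ?thesis
      using has_field_derivative_eval_fps[OF in_ball(1)[OF u], of UNIV] in_ball[OF u]
      by (simp add: eval_fps_mult)
  qed
  have dl: "(eval_fps l has_field_derivative eval_fps (fps_deriv l) u) (at u)"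
    if u: "u \<in> ball 0 (1 / M)" for u
    using has_field_derivative_eval_fps[OF in_ball(2)[OF u], of UNIV] by simp
  have "(\<lambda>u. eval_fps g u * exp (- eval_fps l u)) constant_on ball 0 (1 / M)"
  proof (rule has_field_derivative_0_imp_constant_on)
    fix u :: complex assume u: "u \<in> ball 0 (1 / M)"
    show "((\<lambda>u. eval_fps g u * exp (- eval_fps l u)) has_field_derivative 0) (at u)"
      by (rule derivative_eq_intros dg dl u refl)+ (simp add: algebra_simps)
  qed auto
  then obtain C where C: "\<And>u. u \<in> ball 0 (1 / M) \<Longrightarrow> eval_fps g u * exp (- eval_fps l u) = C"
    unfolding constant_on_def by blast
  have "C = 1"
    using C[of 0] M by (simp add: eval_fps_at_0 l0 g_nth)
  define u where "u = 1 / z"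
  have z0: "norm z > M" "z \<noteq> 0" using z by (auto simp: M_def)
  have u: "norm u < 1 / M" "norm u < 1" "u \<noteq> 0"
    using z0 M by (auto simp: u_def norm_divide field_simps)
  have uz: "1 / u = z" by (simp add: u_def)
  have "eval_fps g u * exp (- eval_fps l u) = 1" using C[of u] u \<open>C = 1\<close> by simp
  hence "eval_fps g u = exp (eval_fps l u)" by (simp add: exp_minus field_simps)
  also have "eval_fps l u = (of_real a * (1 / u) - of_real c) * Ln (1 + u) - of_real a"
    using log_series[OF u(2,3), of a c] by (simp add: eval_fps_def l_def sums_iff)
  finally have eg: "exp (of_real a) * eval_fps g u = E_complex a c z"
    by (simp add: E_complex_def uz) (simp add: u_def flip: exp_add)
  have "(\<lambda>n. fps_nth g n * u ^ n) sums eval_fps g u"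
    using summable_fps[OF in_ball(1)[of u]] u unfolding eval_fps_def by (intro summable_sums) auto
  from sums_mult[OF this, of "exp (of_real a)"] show ?thesis
    unfolding eg by (simp add: g_nth u_def exp_of_real mult.assoc)
qed

text \<open>
  The bracket in the integrand of \<open>D\<close>, at \<open>z = - s\<close>. It vanishes to second order at
  \<open>z = -1\<close>, which compensates the singularity of \<open>E_complex\<close>.
\<close>

definition bracket :: "real \<Rightarrow> complex \<Rightarrow> complex" where
  "bracket t z = exp ((1 + z) * of_real t) - 1 - (1 + z) * of_real t"

lemma bracket_holomorphic: "bracket t holomorphic_on S"
  unfolding bracket_def by (intro holomorphic_intros)

lemma bracket_cnj: "bracket t (cnj z) = cnj (bracket t z)"
  by (simp add: bracket_def exp_cnj)

lemma bracket_higher_deriv: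
  "(deriv ^^ m) (bracket t) z =
     of_real t ^ m * exp ((1 + z) * of_real t) - (if m = 0 then 1 + (1 + z) * of_real t else 0)
       - (if m = 1 then of_real t else 0)"
proof (induction m arbitrary: z)
  case 0
  show ?case by (simp add: bracket_def)
next
  case (Suc m)
  have "(deriv ^^ m) (bracket t) = (\<lambda>z. of_real t ^ m * exp ((1 + z) * of_real t)
       - (if m = 0 then 1 + (1 + z) * of_real t else 0) - (if m = 1 then of_real t else 0))"
    by (rule ext) (rule Suc.IH)
  hence "(deriv ^^ Suc m) (bracket t) z = deriv (\<lambda>z. of_real t ^ m * exp ((1 + z) * of_real t)
       - (if m = 0 then 1 + (1 + z) * of_real t else 0) - (if m = 1 then of_real t else 0)) z"
    by simp
  also have "\<dots> = of_real t ^ Suc m * exp ((1 + z) * of_real t) - (if m = 0 then of_real t else 0)"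
    by (rule DERIV_imp_deriv) (cases "m = 0"; auto intro!: derivative_eq_intros)
  finally show ?case by simp
qed

text \<open>
  Expanding \<open>E_complex\<close> in powers of \<open>1 / z\<close>, the term of order \<open>n + 1\<close> picks the
  \<open>n\<close>-th Taylor coefficient of \<open>bracket t\<close> at 0, and these add up to the series of the
  density at \<open>t\<close>, apart from the two corrections caused by the subtracted linear polynomial.
\<close>

lemma circle_integral_E_bracket:
  assumes R: "R > 1 + (\<bar>a\<bar> + \<bar>c\<bar>)"
  shows "contour_integral (circlepath 0 R) (\<lambda>z. E_complex a c z * bracket t z) =
    2 * of_real pi * \<i> * of_real (exp a * (- (exp t * E_density a c t)
       - (1 + t) * fps_nth (E_fps a c) 1 - t * fps_nth (E_fps a c) 2))"
proof -
  define M where "M = 1 + (\<bar>a\<bar> + \<bar>c\<bar>)"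
  have M: "M \<ge> 1" "R > M" "R > 0" using R by (auto simp: M_def)
  define g where "g = fps_nth (E_fps a c)"
  let ?I = "contour_integral (circlepath 0 R)"
  let ?p = "\<lambda>m::nat. t ^ m * exp t - (if m = 0 then 1 + t else 0) - (if m = 1 then t else 0)"
  let ?V = "exp a * (- (exp t * E_density a c t) - (1 + t) * g 1 - t * g 2)"
  define f where "f = (\<lambda>n z. of_real (exp a * g n) * (1 / z) ^ n * bracket t z)"
  obtain K where K: "\<And>z. z \<in> sphere 0 R \<Longrightarrow> norm (bracket t z) \<le> K"
  proof -
    have "compact (bracket t ` sphere 0 R)"
      by (intro compact_continuous_image holomorphic_on_imp_continuous_on bracket_holomorphic compact_sphere)
    hence "bounded (bracket t ` sphere 0 R)" by (rule compact_imp_bounded)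
    then obtain B where "\<forall>y\<in>bracket t ` sphere 0 R. norm y \<le> B" unfolding bounded_iff by blast
    thus ?thesis using that[of B] by blast
  qed
  have K0: "K \<ge> 0"
    using K[of "of_real R"] norm_ge_zero[of "bracket t (of_real R)"] M by (simp del: norm_ge_zero) 
  have ci: "f n contour_integrable_on circlepath 0 R" for n
    unfolding f_def using M
    by (intro contour_integrable_continuous_circlepath continuous_intros
         holomorphic_on_imp_continuous_on[OF bracket_holomorphic]) auto
  have ul: "uniform_limit (sphere 0 R) (\<lambda>N z. \<Sum>n<N. f n z) (\<lambda>z. \<Sum>n. f n z) sequentially"
  proof (rule Weierstrass_m_test)
    fix n :: nat and z :: complex assume z: "z \<in> sphere 0 R"
    have "norm (f n z) = exp a * \<bar>g n\<bar> * (1 / R) ^ n * norm (bracket t z)"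
      using z by (simp add: f_def norm_mult norm_power norm_divide abs_mult)
    also have "\<dots> \<le> exp a * M ^ n * (1 / R) ^ n * K"
      using M K[OF z] K0 E_fps_bound[of a c n] unfolding g_def M_def
      by (intro mult_mono mult_nonneg_nonneg) auto
    also have "\<dots> = (exp a * K) * (M / R) ^ n" by (simp add: power_divide)
    finally show "norm (f n z) \<le> (exp a * K) * (M / R) ^ n" .
  qed (use M in \<open>intro summable_mult summable_geometric, auto\<close>)
  have lim: "(\<lambda>N. ?I (\<lambda>z. \<Sum>n<N. f n z)) \<longlonglongrightarrow>
     ?I (\<lambda>z. \<Sum>n. f n z)"
    by (rule contour_integral_uniform_limit_circlepath(2)[OF _ ul])
       (use M ci in \<open>auto intro!: always_eventually contour_integrable_sum\<close>)
  have eq: "(\<Sum>n. f n z) = E_complex a c z * bracket t z" if "z \<in> path_image (circlepath 0 R)" for z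
  proof -
    have "norm z > 1 + (\<bar>a\<bar> + \<bar>c\<bar>)" using that M by (auto simp: M_def)
    from sums_mult2[OF E_complex_expansion[OF this], of "bracket t z"]
    show ?thesis by (simp add: f_def g_def sums_iff)
  qed
  define d where "d = (\<lambda>m. of_real (?p m) :: complex)"
  have d: "(deriv ^^ m) (bracket t) 0 = d m" for m
    unfolding bracket_higher_deriv by (simp add: d_def exp_of_real)
  have f0: "?I (f 0) = 0"
  proof (rule contour_integral_unique, rule Cauchy_theorem_convex_simple)
    show "f 0 holomorphic_on UNIV" unfolding f_def power_0 by (intro holomorphic_intros bracket_holomorphic)
  qed auto
  have fS: "?I (f (Suc m)) = 2 * of_real pi * \<i> * (of_real (exp a * g (Suc m)) * d m / fact m)" for m
  proof -
    have "?I (\<lambda>u. bracket t u / (u - 0) ^ Suc m) = (2 * pi * \<i>) * (deriv ^^ m) (bracket t) 0 / fact m"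
      using M by (intro Cauchy_contour_integral_circlepath holomorphic_on_imp_continuous_on bracket_holomorphic) auto
    moreover have "f (Suc m) = (\<lambda>z. of_real (exp a * g (Suc m)) * (bracket t z / (z - 0) ^ Suc m))"
      by (rule ext) (simp add: f_def power_one_over divide_simps)
    moreover have "?I (\<lambda>z. of_real (exp a * g (Suc m)) * (bracket t z / (z - 0) ^ Suc m)) =
       of_real (exp a * g (Suc m)) * ?I (\<lambda>z. bracket t z / (z - 0) ^ Suc m)"
      using M by (intro contour_integral_lmul contour_integrable_continuous_circlepath continuous_intros
         holomorphic_on_imp_continuous_on[OF bracket_holomorphic]) auto
    ultimately show ?thesis by (simp add: d)
  qed
  have "(\<lambda>n. ?I (f n)) sums ?I (\<lambda>z. \<Sum>n. f n z)"
    using lim unfolding sums_def by (subst (asm) contour_integral_sum) (auto intro: ci)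
  hence "(\<lambda>m. ?I (f (Suc m))) sums ?I (\<lambda>z. \<Sum>n. f n z)"
    using f0 by (subst sums_Suc_iff) simp
  hence S1: "(\<lambda>m. 2 * of_real pi * \<i> * (of_real (exp a * g (Suc m)) * d m / fact m)) sums
       ?I (\<lambda>z. \<Sum>n. f n z)"
    unfolding fS .
  have "(\<lambda>m. exp a * (- (exp t * (E_density_coeff a c m * t ^ m / fact m)) - (if m = 0 then (1 + t) * g 1 else 0)
       - (if m = 1 then t * g 2 else 0))) sums
      (?V)"
    unfolding E_density_def
    by (intro sums_mult sums_diff sums_minus egf_sums[OF E_density_geo_bounded] sums_single)
  moreover have "exp a * (- (exp t * (E_density_coeff a c m * t ^ m / fact m)) - (if m = 0 then (1 + t) * g 1 else 0)
       - (if m = 1 then t * g 2 else 0)) =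
     exp a * g (Suc m) * (?p m) / fact m" for m
    unfolding E_density_coeff_def g_def[symmetric]
    by (auto simp: algebra_simps numeral_2_eq_2)
  ultimately have "(\<lambda>m. exp a * g (Suc m) * (?p m) / fact m)
      sums (?V)" by simp
  hence "(\<lambda>m. complex_of_real (exp a * g (Suc m) * (?p m) / fact m))
      sums of_real (?V)"
    by (rule sums_of_real)
  hence "(\<lambda>m. 2 * of_real pi * \<i> * (of_real (exp a * g (Suc m)) * d m / fact m)) sums
       (2 * of_real pi * \<i> * of_real (?V))"
    by (intro sums_mult) (simp add: d_def)
  with S1 have "?I (\<lambda>z. \<Sum>n. f n z) =
       2 * of_real pi * \<i> * of_real (?V)"
    by (rule sums_unique2)
  moreover have "?I (\<lambda>z. \<Sum>n. f n z) =
       ?I (\<lambda>z. E_complex a c z * bracket t z)"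
    by (rule contour_integral_cong) (auto intro: eq)
  ultimately show ?thesis by (simp add: g_def)
qed

section \<open>Boundary behaviour near the cut\<close>

lemma abs_mult_ln_le:
  fixes r \<rho> :: real
  assumes "0 < r" "r \<le> \<rho>" "1 \<le> \<rho>"
  shows "\<bar>r * ln r\<bar> \<le> \<rho> ^ 2"
proof (cases "r \<ge> 1")
  case True
  have "r * ln r \<le> r * r" using ln_le_minus_one[of r] True by (intro mult_left_mono) auto
  also have "\<dots> \<le> \<rho> * \<rho>" using assms by (intro mult_mono) auto
  finally show ?thesis using True by (simp add: power2_eq_square)
next
  case False
  have "r * ln (1 / r) \<le> r * (1 / r)"
    using ln_le_minus_one[of "1 / r"] assms by (intro mult_left_mono) auto
  hence "- (r * ln r) \<le> 1" using assms by (simp add: ln_div)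
  moreover have "1 \<le> \<rho> ^ 2" using assms by simp
  moreover have "r * ln r \<le> 0" using False assms by (intro mult_nonneg_nonpos) auto
  ultimately show ?thesis by simp
qed

text \<open>
  The real part of the exponent is a combination of \<open>(x + 1) * ln \<bar>z + 1\<bar>\<close>,
  \<open>x * ln \<bar>z\<bar>\<close> (both bounded on bounded sets), of \<open>ln \<bar>z\<bar>\<close> with a
  nonnegative coefficient (bounded above), of a bounded argument term, and of
  \<open>- (a + c) * ln \<bar>z + 1\<bar>\<close>, which alone is responsible for the singularity at
  \<open>-1\<close>.
\<close>

lemma E_complex_bound:
  assumes a: "a \<ge> 0" and c: "c \<ge> 0" and z: "Im z > 0" "norm z \<le> \<rho>" "norm (z + 1) \<le> \<rho>" and \<rho>: "1 \<le> \<rho>"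
  shows "norm (E_complex a c z) \<le> exp (2 * a * \<rho> ^ 2 + c * \<rho> + a * pi * \<rho>) * norm (z + 1) powr (- (a + c))"
proof -
  define x y where "x = Re z" and "y = Im z"
  define r s where "r = norm z" and "s = norm (z + 1)"
  have nz: "z \<noteq> 0" "z + 1 \<noteq> 0" using z by (auto simp: complex_eq_iff)
  hence rs: "r > 0" "s > 0" by (simp_all add: r_def s_def)
  define L where "L = Ln (1 + 1 / z)"
  have w: "1 + 1 / z \<noteq> 0" using nz by (simp add: field_simps add.commute)
  have "norm (1 + 1 / z) = s / r"
  proof -
    have "1 + 1 / z = (z + 1) / z" using nz by (simp add: field_simps)
    thus ?thesis by (simp add: norm_divide s_def r_def)
  qed
  hence ReL: "Re L = ln s - ln r" using w rs by (simp add: L_def ln_div)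
  have ImL: "\<bar>Im L\<bar> \<le> pi"
    using Im_Ln_le_pi[OF w] mpi_less_Im_Ln[OF w] by (simp add: L_def)
  have b1: "\<bar>(x + 1) * ln s\<bar> \<le> \<rho> ^ 2"
  proof -
    have "\<bar>x + 1\<bar> \<le> s" using abs_Re_le_cmod[of "z + 1"] by (simp add: x_def s_def)
    hence "\<bar>(x + 1) * ln s\<bar> \<le> \<bar>s * ln s\<bar>" using rs by (simp add: abs_mult mult_right_mono)
    also have "\<dots> \<le> \<rho> ^ 2" using rs z \<rho> by (intro abs_mult_ln_le) (auto simp: s_def)
    finally show ?thesis .
  qed
  have b2: "\<bar>x * ln r\<bar> \<le> \<rho> ^ 2"
  proof -
    have "\<bar>x\<bar> \<le> r" using abs_Re_le_cmod[of z] by (simp add: x_def r_def)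
    hence "\<bar>x * ln r\<bar> \<le> \<bar>r * ln r\<bar>" using rs by (simp add: abs_mult mult_right_mono)
    also have "\<dots> \<le> \<rho> ^ 2" using rs z \<rho> by (intro abs_mult_ln_le) (auto simp: r_def)
    finally show ?thesis .
  qed
  have b3: "ln r \<le> \<rho>"
    using ln_le_minus_one[of r] rs z unfolding r_def by linarith
  have b4: "- (a * y * Im L) \<le> a * pi * \<rho>"
  proof -
    have "y \<le> \<rho>" using abs_Im_le_cmod[of z] z by (simp add: y_def)
    have "- (a * y * Im L) \<le> a * y * pi"
    proof -
      have "a * y * (- Im L) \<le> a * y * pi" using ImL a z by (intro mult_left_mono) (auto simp: y_def)
      thus ?thesis by simp
    qed
    also have "\<dots> \<le> a * \<rho> * pi"
      using \<open>y \<le> \<rho>\<close> a by (intro mult_right_mono mult_left_mono) auto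
    finally show ?thesis by (simp add: mult_ac)
  qed
  have "norm (E_complex a c z) = exp (Re ((of_real a * z - of_real c) * L))"
    by (simp add: E_complex_def L_def)
  also have "Re ((of_real a * z - of_real c) * L) = (a * x - c) * (ln s - ln r) - a * y * Im L"
    by (simp add: ReL x_def y_def)
  also have "\<dots> = a * ((x + 1) * ln s) - a * (x * ln r) + c * ln r - (a + c) * ln s - a * y * Im L"
    by (simp add: algebra_simps)
  also have "\<dots> \<le> a * \<rho> ^ 2 + a * \<rho> ^ 2 + c * \<rho> - (a + c) * ln s + a * pi * \<rho>"
  proof -
    have "a * ((x + 1) * ln s) \<le> a * \<rho> ^ 2" using b1 a by (intro mult_left_mono) auto
    moreover have "a * (- (x * ln r)) \<le> a * \<rho> ^ 2" using b2 a by (intro mult_left_mono) auto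
    moreover have "c * ln r \<le> c * \<rho>" using b3 c by (intro mult_left_mono) auto
    ultimately show ?thesis using b4 by simp
  qed
  also have "\<dots> = (2 * a * \<rho> ^ 2 + c * \<rho> + a * pi * \<rho>) + (- (a + c)) * ln s"
    by (simp add: algebra_simps)
  finally have "norm (E_complex a c z) \<le> exp ((2 * a * \<rho> ^ 2 + c * \<rho> + a * pi * \<rho>) + (- (a + c)) * ln s)"
    by simp
  thus ?thesis using rs by (simp only: exp_add powr_def s_def[symmetric]) simp
qed

lemma bracket_norm_bound:
  assumes "norm (z + 1) \<le> \<rho>"
  shows "norm (bracket t z) \<le> exp (\<bar>t\<bar> * \<rho>) * t ^ 2 * norm (z + 1) ^ 2"
proof -
  define v where "v = (1 + z) * of_real t"
  have nv: "norm v = norm (z + 1) * \<bar>t\<bar>" by (simp add: v_def norm_mult add.commute)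
  have "norm (bracket t z) \<le> exp (norm v) * norm v ^ 2"
    using Taylor_exp_field[of v 1] by (simp add: bracket_def v_def power2_eq_square algebra_simps)
  also have "\<dots> \<le> exp (\<bar>t\<bar> * \<rho>) * norm v ^ 2"
  proof -
    have "norm v \<le> \<bar>t\<bar> * \<rho>" unfolding nv using mult_left_mono[OF assms, of "\<bar>t\<bar>"] by (simp add: mult.commute)
    thus ?thesis by (intro mult_right_mono) auto
  qed
  finally show ?thesis by (simp add: nv power_mult_distrib mult_ac)
qed

lemma E_bracket_bound:
  assumes a: "a \<ge> 0" and c: "c \<ge> 0" and \<rho>: "1 \<le> \<rho>"
  obtains K where "K \<ge> 0" "\<And>z. Im z > 0 \<Longrightarrow> norm z \<le> \<rho> \<Longrightarrow> norm (z + 1) \<le> \<rho> \<Longrightarrow>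
     norm (E_complex a c z * bracket t z) \<le> K * norm (z + 1) powr (2 - (a + c))"
proof
  define K1 K2 where "K1 = exp (2 * a * \<rho> ^ 2 + c * \<rho> + a * pi * \<rho>)" and "K2 = exp (\<bar>t\<bar> * \<rho>) * t ^ 2"
  show "K1 * K2 \<ge> 0" by (simp add: K1_def K2_def)
  fix z :: complex assume z: "Im z > 0" "norm z \<le> \<rho>" "norm (z + 1) \<le> \<rho>"
  have "z + 1 \<noteq> 0" using z by (auto simp: complex_eq_iff)
  hence pos: "norm (z + 1) > 0" by simp
  have "norm (E_complex a c z * bracket t z) \<le> (K1 * norm (z + 1) powr (- (a + c))) * (K2 * norm (z + 1) ^ 2)"
    unfolding norm_mult using E_complex_bound[OF a c z \<rho>] bracket_norm_bound[OF z(3), of t]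
    by (intro mult_mono) (auto simp: K1_def K2_def)
  also have "norm (z + 1) ^ 2 = norm (z + 1) powr 2" using pos by (simp add: powr_numeral)
  also have "(K1 * norm (z + 1) powr (- (a + c))) * (K2 * norm (z + 1) powr 2) =
     K1 * K2 * (norm (z + 1) powr (- (a + c)) * norm (z + 1) powr 2)" by simp
  also have "norm (z + 1) powr (- (a + c)) * norm (z + 1) powr 2 = norm (z + 1) powr (2 - (a + c))"
    unfolding powr_add[symmetric] by (rule arg_cong) simp
  finally show "norm (E_complex a c z * bracket t z) \<le> K1 * K2 * norm (z + 1) powr (2 - (a + c))" .
qed

lemma abs_powr_integrable:
  fixes d L :: real
  assumes "d > -1" "L \<ge> 0"
  shows "(\<lambda>x. \<bar>x + 1\<bar> powr d) integrable_on {-1 - L..-1 + L}"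
proof -
  have 1: "(\<lambda>x. \<bar>x\<bar> powr d) integrable_on {0..L}"
    using integrable_on_powr_from_0[OF assms] by (rule integrable_eq) auto
  hence 2: "(\<lambda>x. \<bar>x\<bar> powr d) integrable_on {-L..0}"
    using Henstock_Kurzweil_Integration.integrable_reflect_real[where f = "\<lambda>x. \<bar>x\<bar> powr d" and a = 0 and b = L] by simp
  have "(\<lambda>x. \<bar>x\<bar> powr d) integrable_on {-L..L}"
    by (rule Henstock_Kurzweil_Integration.integrable_combine[OF _ _ 2 1]) (use assms in auto)
  then obtain I where "((\<lambda>x. \<bar>x\<bar> powr d) has_integral I) {-L..L}" by auto
  from has_integral_shift_real_ivl[OF this, of 1]
  have "((\<lambda>x. \<bar>x + 1\<bar> powr d) has_integral I) {-L - 1..L - 1}" .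
  moreover have "{-L - 1..L - 1} = {-1 - L..-1 + L}" by auto
  ultimately show ?thesis by (metis integrable_on_def)
qed

text \<open>
  The limit of \<open>Ln (1 + 1 / z)\<close> as \<open>z\<close> approaches the real point \<open>x\<close> from the upper
  half-plane. Over the cut \<open>1 + 1 / z\<close> tends to the negative axis from below.
\<close>

definition boundary_log :: "real \<Rightarrow> complex" where
  "boundary_log x = (if -1 < x \<and> x < 0 then of_real (ln (- (1 + 1 / x))) - \<i> * of_real pi
     else of_real (ln (1 + 1 / x)))"

definition boundary_E :: "real \<Rightarrow> real \<Rightarrow> real \<Rightarrow> complex" where
  "boundary_E a c x = exp ((of_real a * of_real x - of_real c) * boundary_log x)"

lemma Ln_boundary_limit:
  fixes e :: "nat \<Rightarrow> real"
  assumes x: "x \<noteq> -1" "x \<noteq> 0" and e: "e \<longlonglongrightarrow> 0" and pos: "\<And>n. e n > 0"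
  shows "(\<lambda>n. Ln (1 + 1 / (of_real x + \<i> * of_real (e n)))) \<longlonglongrightarrow> boundary_log x"
proof -
  define w where "w = (\<lambda>n. 1 + 1 / (of_real x + \<i> * of_real (e n)))"
  have w: "w \<longlonglongrightarrow> 1 + 1 / (of_real x + \<i> * of_real 0)"
    unfolding w_def using x by (intro tendsto_intros e) auto
  hence w': "w \<longlonglongrightarrow> of_real (1 + 1 / x)" by simp
  show ?thesis
  proof (cases "-1 < x \<and> x < 0")
    case True
    hence neg: "1 + 1 / x < 0" by (simp add: field_simps)
    have "Ln (w n) = Ln (- w n) - \<i> * of_real pi" for n
    proof -
      have "Im (w n) = - (e n / (x ^ 2 + e n ^ 2))"
        by (simp add: w_def Im_divide power2_eq_square)
      also have "\<dots> < 0" using pos[of n] by (simp add: add_nonneg_pos divide_pos_pos)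
      finally have "Im (w n) < 0" .
      moreover from this have "w n \<noteq> 0" by auto
      ultimately show ?thesis by (simp add: Ln_minus)
    qed
    moreover have "(\<lambda>n. Ln (- w n) - \<i> * of_real pi) \<longlonglongrightarrow> Ln (- of_real (1 + 1 / x)) - \<i> * of_real pi"
    proof (intro tendsto_intros w')
      have "- complex_of_real (1 + 1 / x) = of_real (- (1 + 1 / x))" by simp
      also have "\<dots> \<notin> \<real>\<^sub>\<le>\<^sub>0" using neg unfolding nonpos_Reals_of_real_iff by simp
      finally show "- complex_of_real (1 + 1 / x) \<notin> \<real>\<^sub>\<le>\<^sub>0" .
    qed
    moreover have "Ln (- of_real (1 + 1 / x)) = of_real (ln (- (1 + 1 / x)))"
      using neg Ln_of_real[of "- (1 + 1 / x)"] by simp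
    ultimately show ?thesis using True by (simp add: boundary_log_def w_def)
  next
    case False
    hence pos': "1 + 1 / x > 0" using x by (auto simp: field_simps)
    have "(\<lambda>n. Ln (w n)) \<longlonglongrightarrow> Ln (of_real (1 + 1 / x))"
      by (intro tendsto_intros w') (subst nonpos_Reals_of_real_iff, use pos' in simp)
    moreover have "Ln (of_real (1 + 1 / x)) = of_real (ln (1 + 1 / x))"
      using pos' by (rule Ln_of_real)
    ultimately show ?thesis unfolding w_def boundary_log_def if_not_P[OF False] by (simp only:)
  qed
qed

lemma boundary_E_limit:
  fixes e :: "nat \<Rightarrow> real"
  assumes x: "x \<noteq> -1" "x \<noteq> 0" and e: "e \<longlonglongrightarrow> 0" and pos: "\<And>n. e n > 0"
  shows "(\<lambda>n. E_complex a c (of_real x + \<i> * of_real (e n)) * bracket t (of_real x + \<i> * of_real (e n)))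
     \<longlonglongrightarrow> boundary_E a c x * bracket t (of_real x)"
proof -
  have z: "(\<lambda>n. of_real x + \<i> * of_real (e n)) \<longlonglongrightarrow> of_real x + \<i> * of_real 0"
    by (intro tendsto_intros e)
  have "(\<lambda>n. E_complex a c (of_real x + \<i> * of_real (e n))) \<longlonglongrightarrow>
     exp ((of_real a * (of_real x + \<i> * of_real 0) - of_real c) * boundary_log x)"
    unfolding E_complex_def by (intro tendsto_intros z Ln_boundary_limit assms)
  moreover have "isCont (bracket t) (of_real x + \<i> * of_real 0)"
    using holomorphic_on_imp_continuous_on[OF bracket_holomorphic[of t UNIV]]
    by (simp add: continuous_on_eq_continuous_at)
  from isCont_tendsto_compose[OF this z]
  have "(\<lambda>n. bracket t (of_real x + \<i> * of_real (e n))) \<longlonglongrightarrow> bracket t (of_real x + \<i> * of_real 0)" .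
  ultimately show ?thesis unfolding boundary_E_def by (intro tendsto_mult) simp_all
qed

lemma bracket_of_real: "bracket t (of_real x) = of_real (exp ((1 + x) * t) - 1 - (1 + x) * t)"
proof -
  have "bracket t (of_real x) = exp (of_real ((1 + x) * t)) - 1 - of_real ((1 + x) * t)"
    by (simp add: bracket_def)
  thus ?thesis by (simp only: exp_of_real of_real_diff of_real_1)
qed

lemma Im_boundary_E_outside:
  assumes "\<not> (-1 < x \<and> x < 0)"
  shows "Im (boundary_E a c x * bracket t (of_real x)) = 0"
  unfolding boundary_E_def boundary_log_def bracket_of_real if_not_P[OF assms]
  by (simp add: Im_exp)

text \<open>
  The weight \<open>w\<close> is the imaginary part of the boundary values of \<open>E_complex\<close> on the cut,
  divided by \<open>pi\<close>.
\<close>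

lemma Im_boundary_E_inside:
  assumes s: "0 < s" "s < 1"
  shows "Im (boundary_E a c (- s) * bracket t (of_real (- s))) =
    pi * (w a c s * (exp ((1 - s) * t) - 1 - (1 - s) * t))"
proof -
  have lnq: "ln (- (1 + 1 / (- s))) = - ln (s / (1 - s))"
  proof -
    have "- (1 + 1 / (- s)) = (1 - s) / s" using s by (simp add: field_simps)
    thus ?thesis using s by (simp add: ln_div)
  qed
  have "(of_real a * of_real (- s) - of_real c) * boundary_log (- s) =
     Complex ((a * s + c) * ln (s / (1 - s))) (pi * (a * s + c))"
    using s unfolding boundary_log_def lnq by (simp add: complex_eq_iff algebra_simps)
  hence "Im (boundary_E a c (- s)) = exp ((a * s + c) * ln (s / (1 - s))) * sin (pi * (a * s + c))"
    by (simp add: boundary_E_def Im_exp)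
  also have "exp ((a * s + c) * ln (s / (1 - s))) = (s / (1 - s)) powr (a * s + c)"
    using s by (simp add: powr_def)
  finally have "Im (boundary_E a c (- s)) = pi * w a c s"
    by (simp add: w_def)
  thus ?thesis unfolding bracket_of_real by simp
qed

section \<open>The contour integral representation of the density\<close>

lemma half_disc_integral_zero:
  assumes R: "R > 0" and hol: "f holomorphic_on {z. Im z > - \<epsilon>}" and \<epsilon>: "\<epsilon> > 0"
  shows "integral {-R..R} (\<lambda>x. f (of_real x)) + integral {0..pi} (\<lambda>\<theta>. f (of_real R * cis \<theta>) * of_real R * \<i> * cis \<theta>) = 0"
proof -
  define g1 g2 where "g1 = linepath (of_real (-R)) (complex_of_real R)" and "g2 = part_circlepath 0 R 0 pi"
  define H where "H = {z. Im z > - \<epsilon>}"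
  have H: "open H" "convex H"
    unfolding H_def by (rule open_halfspace_Im_gt convex_halfspace_Im_gt)+
  have ends: "pathstart g1 = of_real (-R)" "pathfinish g1 = of_real R" "pathstart g2 = of_real R" "pathfinish g2 = of_real (-R)"
    by (simp_all add: g1_def g2_def)
  have v: "valid_path g1" "valid_path g2" by (simp_all add: g1_def g2_def)
  have p1: "path_image g1 \<subseteq> H"
  proof -
    have "path_image g1 \<subseteq> {z. Im z \<ge> 0}"
      unfolding g1_def path_image_linepath
      by (intro closed_segment_subset convex_halfspace_Im_ge) auto
    thus ?thesis using \<epsilon> by (auto simp: H_def)
  qed
  have p2: "path_image g2 \<subseteq> H"
  proof
    fix z assume "z \<in> path_image g2"
    then obtain x where "x \<in> {0..pi}" "z = 0 + of_real R * cis x"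
      unfolding g2_def path_image_part_circlepath' by (auto simp: closed_segment_eq_real_ivl)
    thus "z \<in> H" using R \<epsilon> sin_ge_zero[of x] by (simp add: H_def) (smt (verit) mult_nonneg_nonneg)
  qed
  have "(f has_contour_integral 0) (g1 +++ g2)"
    using hol H p1 p2 v ends unfolding H_def[symmetric]
    by (intro Cauchy_theorem_convex_simple) (auto simp: path_image_join)
  hence "contour_integral (g1 +++ g2) f = 0" by (rule contour_integral_unique)
  moreover have "contour_integral (g1 +++ g2) f = contour_integral g1 f + contour_integral g2 f"
    using hol H p1 p2 v unfolding H_def[symmetric]
    by (intro contour_integral_join contour_integrable_holomorphic_simple)
  moreover have "contour_integral g1 f = integral {-R..R} (\<lambda>x. f (of_real x))"
    unfolding g1_def using R by (subst contour_integral_linepath_Reals_eq) auto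
  moreover have "contour_integral g2 f = integral {0..pi} (\<lambda>\<theta>. f (of_real R * cis \<theta>) * of_real R * \<i> * cis \<theta>)"
    unfolding g2_def by (subst contour_integral_part_circlepath_eq) auto
  ultimately show ?thesis by simp
qed

text \<open>
  On the lower half of the circle the integral is minus the complex conjugate of that over the
  upper half.
\<close>

lemma circle_integral_symmetric:
  assumes R: "R > 0" and cont: "continuous_on (sphere 0 R) f"
    and sym: "\<And>z. norm z = R \<Longrightarrow> f (cnj z) = cnj (f z)"
  shows "contour_integral (circlepath 0 R) f =
    2 * \<i> * of_real (Im (integral {0..pi} (\<lambda>\<theta>. f (of_real R * cis \<theta>) * of_real R * \<i> * cis \<theta>)))"
proof -
  define h where "h = (\<lambda>\<theta>. f (of_real R * cis \<theta>) * of_real R * \<i> * cis \<theta>)"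
  have ch: "continuous_on A h" for A
    unfolding h_def
    by (intro continuous_intros continuous_on_compose2[OF cont]) (use R in \<open>auto simp: norm_mult\<close>)
  have hi: "h integrable_on {a..b}" for a b by (intro integrable_continuous_real ch)
  have refl: "h (2 * pi - \<theta>) = - cnj (h \<theta>)" for \<theta>
  proof -
    have "cis (2 * pi - \<theta>) = cnj (cis \<theta>)" by (simp add: complex_eq_iff)
    moreover have "f (of_real R * cnj (cis \<theta>)) = cnj (f (of_real R * cis \<theta>))"
      using sym[of "of_real R * cis \<theta>"] R by (simp add: norm_mult)
    ultimately show ?thesis by (simp add: h_def)
  qed
  have "contour_integral (circlepath 0 R) f = integral {0..2 * pi} h"
    unfolding circlepath_def by (subst contour_integral_part_circlepath_eq) (auto simp: h_def)
  also have "\<dots> = integral {0..pi} h + integral {pi..2 * pi} h"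
    using Henstock_Kurzweil_Integration.integral_combine[of 0 pi "2 * pi" h] hi by simp
  also have "integral {pi..2 * pi} h = integral {0..pi} (\<lambda>\<theta>. h (2 * pi - \<theta>))"
  proof -
    have "(h has_integral integral {pi..2 * pi} h) {pi..2 * pi}" using hi by (rule integrable_integral)
    from has_integral_affinity[of h _ pi "2 * pi" "-1" "2 * pi"] this
    have "((\<lambda>x. h (2 * pi - x)) has_integral integral {pi..2 * pi} h) ((\<lambda>x. 2 * pi - x) ` {pi..2 * pi})"
      by simp
    moreover have "(\<lambda>x. 2 * pi - x) ` {pi..2 * pi} = {0..pi}" by (simp add: image_diff_atLeastAtMost)
    ultimately show ?thesis by (metis integral_unique)
  qed
  also have "\<dots> = - cnj (integral {0..pi} h)"
    unfolding refl by (simp add: integral_cnj)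
  finally have "contour_integral (circlepath 0 R) f = integral {0..pi} h - cnj (integral {0..pi} h)" by simp
  also have "\<dots> = 2 * \<i> * of_real (Im (integral {0..pi} h))" by (simp add: complex_eq_iff)
  finally show ?thesis by (simp only: h_def)
qed

lemma w_bound:
  assumes s: "0 < s" "s < 1" and a: "0 \<le> a" "a \<le> a'" and c: "0 \<le> c"
  shows "\<bar>w a c s\<bar> \<le> (1 - s) powr (- (a' + c))"
proof -
  have e: "0 \<le> a * s + c" "a * s + c \<le> a' + c"
    using s a c mult_mono[of a a' s 1] by auto
  have "\<bar>w a c s\<bar> = (1 / pi) * (s / (1 - s)) powr (a * s + c) * \<bar>sin (pi * (a * s + c))\<bar>"
    by (simp add: w_def abs_mult)
  also have "\<dots> \<le> 1 * (1 / (1 - s)) powr (a * s + c) * 1"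
    using s e pi_ge_two by (intro mult_mono powr_mono2 divide_right_mono mult_nonneg_nonneg) auto
  also have "\<dots> \<le> (1 / (1 - s)) powr (a' + c)"
    using s e by (simp add: powr_mono)
  also have "\<dots> = (1 - s) powr (- (a' + c))"
    using s by (subst powr_minus_divide, subst powr_divide) auto
  finally show ?thesis .
qed

lemma bracket_bound:
  fixes t r :: real
  assumes "0 \<le> r"
  shows "\<bar>exp (r * t) - 1 - r * t\<bar> \<le> exp (r * \<bar>t\<bar>) * t ^ 2 * r ^ 2"
  using Taylor_exp_field[of "r * t" 1] assms
  by (simp add: power2_eq_square abs_mult algebra_simps)

lemma one_minus_powr_integrable:
  fixes d :: real
  assumes "d > -1"
  shows "set_integrable lborel {0<..<1} (\<lambda>s. (1 - s) powr d)"
proof -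
  have "(\<lambda>x. (- x) powr d) integrable_on {-1..0}"
    using integrable_on_powr_from_0[OF assms, of 1]
      Henstock_Kurzweil_Integration.integrable_reflect_real[where f = "\<lambda>x. (- x) powr d" and a = "-1" and b = 0]
    by simp
  then obtain I where "((\<lambda>x. (- x) powr d) has_integral I) {-1..0}" by auto
  from has_integral_shift_real_ivl[OF this, of "-1"]
  have "((\<lambda>s. (1 - s) powr d) has_integral I) {0..1}" by simp
  hence "(\<lambda>s. (1 - s) powr d) integrable_on {0<..<1}"
    by (meson has_integral_Icc_iff_Ioo has_integral_integrable)
  hence "(\<lambda>s. (1 - s) powr d) absolutely_integrable_on {0<..<1}"
    by (rule nonnegative_absolutely_integrable_1) auto
  thus ?thesis unfolding set_integrable_def
    by (subst (asm) integrable_completion) auto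
qed

lemma w_bracket_integrable:
  assumes a: "0 \<le> a" and c: "0 \<le> c" "a + c < 3"
  shows "set_integrable lborel {0<..<1} (\<lambda>s. w a c s * (exp ((1 - s) * t) - 1 - (1 - s) * t))"
proof -
  have "set_integrable lborel {0<..<1} (\<lambda>s. exp \<bar>t\<bar> * t ^ 2 * (1 - s) powr (2 - (a + c)))"
    using c by (intro set_integrable_mult_right one_minus_powr_integrable) auto
  thus ?thesis
  proof (rule set_integrable_bound)
    show "set_borel_measurable lborel {0<..<1} (\<lambda>s. w a c s * (exp ((1 - s) * t) - 1 - (1 - s) * t))"
      unfolding set_borel_measurable_def w_def by measurable
    show "AE s in lborel. s \<in> {0<..<1} \<longrightarrow> norm (w a c s * (exp ((1 - s) * t) - 1 - (1 - s) * t)) \<le>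
        norm (exp \<bar>t\<bar> * t ^ 2 * (1 - s) powr (2 - (a + c)))"
    proof (intro AE_I2 impI)
      fix s :: real assume s: "s \<in> {0<..<1}"
      have "\<bar>exp ((1 - s) * t) - 1 - (1 - s) * t\<bar> \<le> exp ((1 - s) * \<bar>t\<bar>) * t ^ 2 * (1 - s) ^ 2"
        using s by (intro bracket_bound) auto
      also have "\<dots> \<le> exp \<bar>t\<bar> * t ^ 2 * (1 - s) ^ 2"
        using s by (intro mult_right_mono) (auto simp: mult_left_le_one_le)
      finally have "\<bar>w a c s\<bar> * \<bar>exp ((1 - s) * t) - 1 - (1 - s) * t\<bar> \<le>
         (1 - s) powr (- (a + c)) * (exp \<bar>t\<bar> * t ^ 2 * (1 - s) ^ 2)"
        using s a c by (intro mult_mono w_bound) auto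
      also have "\<dots> = exp \<bar>t\<bar> * t ^ 2 * ((1 - s) powr (- (a + c)) * (1 - s) powr 2)"
        using s by (simp add: powr_numeral)
      also have "(1 - s) powr (- (a + c)) * (1 - s) powr 2 = (1 - s) powr (2 - (a + c))"
        unfolding powr_add[symmetric] by (rule arg_cong) simp
      finally show "norm (w a c s * (exp ((1 - s) * t) - 1 - (1 - s) * t)) \<le>
          norm (exp \<bar>t\<bar> * t ^ 2 * (1 - s) powr (2 - (a + c)))"
        by (simp add: abs_mult)
    qed
  qed
qed

text \<open>
  Cauchy's theorem on a half disc in the upper half-plane, shifted by \<open>\<i> * e n\<close> to stay
  away from the cut. As \<open>e n\<close> tends to 0, dominated convergence applies on the diameter
  because the integrand is at most a multiple of \<open>\<bar>x + 1\<bar> powr d + \<rho> ^ 2\<close> and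
  \<open>d > -1\<close>. In the limit the imaginary part of the integrand on the diameter vanishes off
  the cut and is \<open>pi\<close> times the integrand of \<open>D\<close> on it. The imaginary part of the integral
  over the arc is half the integral over the whole circle divided by \<open>\<i>\<close>, a residue at
  infinity.
\<close>

lemma cut_integral:
  assumes a: "0 \<le> a" and c: "0 \<le> c" "a + c < 3"
  shows "integral {0<..<1} (\<lambda>s. w a c s * (exp ((1 - s) * t) - 1 - (1 - s) * t)) =
    exp a * (exp t * E_density a c t + (1 + t) * fps_nth (E_fps a c) 1 + t * fps_nth (E_fps a c) 2)"
proof -
  let ?V = "exp a * (- (exp t * E_density a c t) - (1 + t) * fps_nth (E_fps a c) 1 - t * fps_nth (E_fps a c) 2)"
  \<comment> \<open>beyond the radius \<open>1 + a + c\<close> from which on the expansion at infinity converges, and well away from the cut\<close>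
  define R where "R = 4 + a + c"
  define \<rho> where "\<rho> = R + 2"
  have R: "R \<ge> 4" "R > 1 + (\<bar>a\<bar> + \<bar>c\<bar>)" using a c by (auto simp: R_def)
  define d where "d = 2 - (a + c)"
  have d: "d > -1" using c by (simp add: d_def)
  define f where "f = (\<lambda>z. E_complex a c z * bracket t z)"
  have f_hol: "f holomorphic_on - cut"
    unfolding f_def by (intro holomorphic_intros E_complex_holomorphic bracket_holomorphic)
  define e where "e = (\<lambda>n. 1 / real (Suc n))"
  have e: "e \<longlonglongrightarrow> 0" unfolding e_def by (rule LIMSEQ_Suc[OF lim_const_over_n])
  have e01: "0 < e n" "e n \<le> 1" for n by (auto simp: e_def)
  obtain K where K0: "K \<ge> 0" and K: "\<And>z. Im z > 0 \<Longrightarrow> norm z \<le> \<rho> \<Longrightarrow> norm (z + 1) \<le> \<rho> \<Longrightarrow>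
     norm (f z) \<le> K * norm (z + 1) powr d"
    using E_bracket_bound[of a c \<rho> t] a c R unfolding f_def d_def by (auto simp: \<rho>_def)
  define fb where "fb = (\<lambda>x. boundary_E a c x * bracket t (of_real x))"
  define S where "S = {-R..R} - {-1, 0}"
  define I where "I = (\<lambda>n. integral {-R..R} (\<lambda>x. f (of_real x + \<i> * of_real (e n))))"
  define J where "J = (\<lambda>n. integral {0..pi} (\<lambda>\<theta>. f (of_real R * cis \<theta> + \<i> * of_real (e n)) * of_real R * \<i> * cis \<theta>))"
  have IJ: "I n + J n = 0" for n
  proof -
    have "(\<lambda>z. f (z + \<i> * of_real (e n))) holomorphic_on {z. Im z > - e n}"
    proof (rule holomorphic_on_compose_gen[OF _ f_hol, unfolded o_def])
      show "(\<lambda>z. z + \<i> * of_real (e n)) ` {z. Im z > - e n} \<subseteq> - cut"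
        using not_in_cut_Im by (force simp: )
    qed (intro holomorphic_intros)
    from half_disc_integral_zero[OF _ this e01(1), of R] show ?thesis
      using R by (simp add: I_def J_def)
  qed
  have negl: "negligible {-1, 0 :: real}" by simp
  have intS: "integral S g = integral {-R..R} g" "g integrable_on S \<longleftrightarrow> g integrable_on {-R..R}" for g :: "real \<Rightarrow> complex"
    unfolding S_def
    by (rule integral_spike_set integrable_spike_set_eq; rule negligible_subset[OF negl]; auto)+
  have lim_I: "fb integrable_on S \<and> I \<longlonglongrightarrow> integral S fb"
  proof -
    define h where "h = (\<lambda>x. K * (\<bar>x + 1\<bar> powr d + \<rho> ^ 2))"
    have hint: "h integrable_on S"
    proof -
      have "(\<lambda>x. \<bar>x + 1\<bar> powr d) integrable_on {-1 - (R + 1)..-1 + (R + 1)}"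
        by (rule abs_powr_integrable) (use d R in auto)
      hence "(\<lambda>x. \<bar>x + 1\<bar> powr d) integrable_on {-R..R}"
        by (rule integrable_on_subinterval) auto
      hence "h integrable_on {-R..R}" unfolding h_def
        by (intro integrable_on_mult_right integrable_add integrable_const_ivl)
      thus ?thesis
        by (rule integrable_spike_set) (unfold S_def; rule negligible_subset[OF negl]; auto)+
    qed
    have le: "norm (f (of_real x + \<i> * of_real (e n))) \<le> h x" if x: "x \<in> S" for n x
    proof -
      define z where "z = of_real x + \<i> * complex_of_real (e n)"
      have Im: "Im z > 0" using e01 by (simp add: z_def)
      have nx: "norm z \<le> \<bar>x\<bar> + \<bar>e n\<bar>" unfolding z_def
        by (rule order_trans[OF norm_triangle_ineq]) (simp add: norm_mult)
      have nz1: "norm z \<le> \<rho>" using nx x e01[of n] by (auto simp: \<rho>_def S_def)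
      have nz2: "norm (z + 1) \<le> \<rho>"
        using norm_triangle_ineq[of z 1] nx x e01[of n] by (auto simp: \<rho>_def S_def)
      have x1: "\<bar>x + 1\<bar> \<le> norm (z + 1)" using abs_Re_le_cmod[of "z + 1"] by (simp add: z_def)
      have x0: "\<bar>x + 1\<bar> > 0" using x by (auto simp: S_def)
      have "norm (z + 1) powr d \<le> \<bar>x + 1\<bar> powr d + \<rho> ^ 2"
      proof (cases "d \<ge> 0")
        case True
        have "norm (z + 1) powr d \<le> \<rho> powr d" using nz2 True by (intro powr_mono2) auto
        also have "\<dots> \<le> \<rho> powr 2" using True a c R by (intro powr_mono) (auto simp: d_def \<rho>_def)
        also have "\<dots> = \<rho> ^ 2" using R by (simp add: \<rho>_def powr_numeral)
        finally show ?thesis by (smt (verit) powr_ge_zero)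
      next
        case False
        have "norm (z + 1) powr d \<le> \<bar>x + 1\<bar> powr d" using x1 x0 False by (intro powr_mono2') auto
        thus ?thesis by (smt (verit) zero_le_power2)
      qed
      hence "K * norm (z + 1) powr d \<le> h x" unfolding h_def using K0 by (intro mult_left_mono)
      with K[OF Im nz1 nz2] show ?thesis by (simp add: z_def)
    qed
    have fint: "(\<lambda>x. f (of_real x + \<i> * of_real (e n))) integrable_on S" for n
    proof -
      have "continuous_on {-R..R} (\<lambda>x. f (of_real x + \<i> * of_real (e n)))"
      proof (intro continuous_on_compose2[OF holomorphic_on_imp_continuous_on[OF f_hol]] continuous_intros image_subsetI)
        fix x show "of_real x + \<i> * of_real (e n) \<in> - cut"
          using not_in_cut_Im[of "of_real x + \<i> * of_real (e n)"] e01(1)[of n] by simp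
      qed
      thus ?thesis unfolding intS(2) by (rule integrable_continuous_real)
    qed
    have conv: "(\<lambda>n. f (of_real x + \<i> * of_real (e n))) \<longlonglongrightarrow> fb x" if "x \<in> S" for x
      unfolding f_def fb_def using that e e01 by (intro boundary_E_limit) (auto simp: S_def)
    show ?thesis
      using dominated_convergence[OF fint hint le conv] by (simp add: I_def intS(1))
  qed
  define J0 where "J0 = integral {0..pi} (\<lambda>\<theta>. f (of_real R * cis \<theta>) * of_real R * \<i> * cis \<theta>)"
  have lim_J: "J \<longlonglongrightarrow> J0"
    unfolding J_def J0_def
  proof (rule dominated_convergence(2)[where h = "\<lambda>_. K * (1 + \<rho> ^ 2) * R"])
    have nz: "norm (of_real R * cis \<theta> + \<i> * of_real (e n)) > 1" for n \<theta>
      using norm_diff_triangle_ineq[of "of_real R * cis \<theta>" "\<i> * of_real (e n)" 0 0] R e01[of n]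
        norm_triangle_ineq4[of "of_real R * cis \<theta> + \<i> * of_real (e n)" "\<i> * of_real (e n)"]
      by (simp add: norm_mult)
    fix n
    show "(\<lambda>\<theta>. f (of_real R * cis \<theta> + \<i> * of_real (e n)) * of_real R * \<i> * cis \<theta>) integrable_on {0..pi}"
      by (intro integrable_continuous_real continuous_intros
            continuous_on_compose2[OF holomorphic_on_imp_continuous_on[OF f_hol]])
         (use nz not_in_cutI in blast)
    fix \<theta> assume \<theta>: "\<theta> \<in> {0..pi}"
    define z where "z = of_real R * cis \<theta> + \<i> * of_real (e n)"
    have nR: "norm (of_real R * cis \<theta>) = R" using R by (simp add: norm_mult)
    have ne: "norm (\<i> * complex_of_real (e n)) \<le> 1" using e01[of n] by (simp add: norm_mult)
    have Im: "Im z > 0" using \<theta> R e01[of n] sin_ge_zero[of \<theta>] by (simp add: z_def add_nonneg_pos)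
    have z1: "norm z \<le> R + 1" unfolding z_def using norm_triangle_ineq[of "of_real R * cis \<theta>" "\<i> * of_real (e n)"] nR ne by linarith
    have z2: "norm (z + 1) \<le> \<rho>" using norm_triangle_ineq[of z 1] z1 by (simp add: \<rho>_def)
    have z3: "norm (z + 1) \<ge> 1"
    proof -
      have "norm (of_real R * cis \<theta>) \<le> norm (z + 1) + norm (\<i> * complex_of_real (e n) + 1)"
        using norm_triangle_ineq4[of "z + 1" "\<i> * complex_of_real (e n) + 1"] by (simp add: z_def)
      moreover have "norm (\<i> * complex_of_real (e n) + 1) \<le> 2"
        using norm_triangle_ineq[of "\<i> * complex_of_real (e n)" 1] ne by simp
      ultimately show ?thesis using nR R by simp
    qed
    have "norm (z + 1) powr d \<le> 1 + \<rho> ^ 2"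
    proof -
      have "norm (z + 1) powr d \<le> norm (z + 1) powr 2" using z3 a c by (intro powr_mono) (auto simp: d_def)
      also have "\<dots> = norm (z + 1) ^ 2" using z3 by (simp add: powr_numeral)
      also have "\<dots> \<le> \<rho> ^ 2" using z2 by (intro power_mono) auto
      finally show ?thesis by simp
    qed
    hence "norm (f z) \<le> K * (1 + \<rho> ^ 2)"
      using K[OF Im _ z2] z1 K0 mult_left_mono[of "norm (z + 1) powr d" "1 + \<rho> ^ 2" K] by (simp add: \<rho>_def)
    hence "norm (f z) * R \<le> K * (1 + \<rho> ^ 2) * R" using R by (intro mult_right_mono) auto
    thus "norm (f (of_real R * cis \<theta> + \<i> * of_real (e n)) * of_real R * \<i> * cis \<theta>) \<le> K * (1 + \<rho> ^ 2) * R"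
      using R by (simp add: norm_mult z_def)
  next
    fix \<theta>
    have "of_real R * cis \<theta> + \<i> * of_real 0 \<notin> cut" using R by (intro not_in_cutI) (simp add: norm_mult)
    hence "isCont f (of_real R * cis \<theta> + \<i> * of_real 0)"
      using holomorphic_on_imp_continuous_on[OF f_hol] cut_closed
      by (metis ComplI continuous_on_eq_continuous_at open_Compl)
    moreover have "(\<lambda>n. of_real R * cis \<theta> + \<i> * of_real (e n)) \<longlonglongrightarrow> of_real R * cis \<theta> + \<i> * of_real 0"
      by (intro tendsto_intros e)
    ultimately have "(\<lambda>n. f (of_real R * cis \<theta> + \<i> * of_real (e n))) \<longlonglongrightarrow> f (of_real R * cis \<theta> + \<i> * of_real 0)"
      by (rule isCont_tendsto_compose)
    thus "(\<lambda>n. f (of_real R * cis \<theta> + \<i> * of_real (e n)) * of_real R * \<i> * cis \<theta>) \<longlonglongrightarrow>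
        f (of_real R * cis \<theta>) * of_real R * \<i> * cis \<theta>"
      by (intro tendsto_intros) simp
  qed auto
  have "(\<lambda>n. I n + J n) \<longlonglongrightarrow> integral S fb + J0"
    using lim_I lim_J by (intro tendsto_add) auto
  hence sum0: "integral S fb + J0 = 0" using IJ by (simp add: LIMSEQ_const_iff)
  define h where "h = (\<lambda>s. w a c s * (exp ((1 - s) * t) - 1 - (1 - s) * t))"
  have hI: "(h has_integral integral {0<..<1} h) {0<..<1}"
    using set_borel_integral_eq_integral(1)[OF w_bracket_integrable[OF assms, of t]]
    unfolding h_def by (rule integrable_integral)
  have "((\<lambda>x. Im (fb x)) has_integral Im (integral S fb)) S"
    using lim_I integrable_integral has_integral_linear[OF _ bounded_linear_Im, unfolded o_def] by blast
  moreover have "((\<lambda>x. Im (fb x)) has_integral pi * integral {0<..<1} h) S"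
  proof -
    have "(h has_integral integral {0<..<1} h) {0..1}" using hI by (simp add: has_integral_Icc_iff_Ioo)
    hence "((\<lambda>x. h (- x)) has_integral integral {0<..<1} h) {-1..0}"
      using has_integral_reflect_real[where f = h and a = 0 and b = 1] by simp
    hence "((\<lambda>x. h (- x)) has_integral integral {0<..<1} h) {-1<..<0}" by (simp add: has_integral_Icc_iff_Ioo)
    hence "((\<lambda>x. pi * h (- x)) has_integral pi * integral {0<..<1} h) {-1<..<0}"
      by (rule has_integral_mult_right)
    hence "((\<lambda>x. Im (fb x)) has_integral pi * integral {0<..<1} h) {-1<..<0}"
    proof (rule has_integral_eq[rotated])
      fix x :: real assume "x \<in> {-1<..<0}"
      thus "pi * h (- x) = Im (fb x)"
        using Im_boundary_E_inside[of "- x" a c t] by (simp add: h_def fb_def)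
    qed
    thus ?thesis
    proof (rule has_integral_on_superset)
      show "{-1<..<0} \<subseteq> S" using R by (auto simp: S_def)
      fix x :: real assume "x \<notin> {-1<..<0}"
      thus "Im (fb x) = 0" unfolding fb_def by (intro Im_boundary_E_outside) auto
    qed
  qed
  ultimately have eq1: "Im (integral S fb) = pi * integral {0<..<1} h"
    by (rule has_integral_unique)
  have "contour_integral (circlepath 0 R) f = 2 * \<i> * of_real (Im J0)"
    unfolding J0_def
  proof (rule circle_integral_symmetric)
    show "continuous_on (sphere 0 R) f"
    proof (rule continuous_on_subset[OF holomorphic_on_imp_continuous_on[OF f_hol]], rule subsetI)
      fix z :: complex assume "z \<in> sphere 0 R"
      thus "z \<in> - cut" using not_in_cutI[of z] R by simp
    qed
    show "f (cnj z) = cnj (f z)" if "norm z = R" for z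
      using that R E_complex_cnj[OF not_in_cutI[of z], of a c] by (simp add: f_def bracket_cnj)
  qed (use R in auto)
  also have "contour_integral (circlepath 0 R) f = 2 * of_real pi * \<i> * of_real (?V)"
    unfolding f_def by (rule circle_integral_E_bracket[OF R(2)])
  finally have "\<i> * of_real (2 * pi * (?V)) = \<i> * of_real (2 * Im J0)"
    by (simp add: mult_ac)
  hence "2 * pi * (?V) = 2 * Im J0"
    by (simp only: mult_cancel_left of_real_eq_iff) simp
  moreover have "Im J0 = - (pi * integral {0<..<1} h)"
    using arg_cong[OF sum0, of Im] eq1 by simp
  ultimately have "pi * (?V) = pi * (- integral {0<..<1} h)" by simp
  hence "?V = - integral {0<..<1} h"
    by (subst (asm) mult_left_cancel) simp_all
  thus ?thesis unfolding h_def by (simp add: algebra_simps)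
qed

lemma E_fps_1: "fps_nth (E_fps a c) 1 = - q1 a c"
  using E_fps_rec[of 0 a c] by (simp add: q1_def log_coeff_def)

lemma E_fps_2: "fps_nth (E_fps a c) 2 = q2 a c"
proof -
  have 1: "fps_nth (E_fps a c) (Suc 0) = - (a / 2 + c)" using E_fps_1[of a c] by (simp add: q1_def)
  have "2 * fps_nth (E_fps a c) (Suc (Suc 0)) = c + 2 * a / 3 - (a / 2 + c) * (- (a / 2) - c)"
    using E_fps_rec[of 1 a c] by (simp add: log_coeff_def 1)
  also have "(a / 2 + c) * (- (a / 2) - c) = - ((a / 2 + c)\<^sup>2)"
    by (simp add: power2_eq_square algebra_simps)
  finally show ?thesis by (simp add: q2_def numeral_2_eq_2)
qed

theorem D_eq_density:
  assumes "0 \<le> a" "0 \<le> c" "a + c < 3"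
  shows "D a c t = exp t * E_density a c t"
proof -
  have "(LINT s:{0<..<1}|lborel. w a c s * (exp ((1 - s) * t) - 1 - (1 - s) * t)) =
      exp a * (exp t * E_density a c t - (1 + t) * q1 a c + t * q2 a c)"
    using set_borel_integral_eq_integral(2)[OF w_bracket_integrable[OF assms, of t]] cut_integral[OF assms, of t]
    by (simp add: E_fps_1[unfolded One_nat_def] E_fps_2)
  hence "D a c t = q1 a c + (q1 a c - q2 a c) * t
     + (exp (- a) * exp a) * (exp t * E_density a c t - (1 + t) * q1 a c + t * q2 a c)"
    by (simp add: D_def)
  also have "exp (- a) * exp a = 1" by (simp flip: exp_add)
  finally show ?thesis by (simp add: algebra_simps)
qed

section \<open>Bernstein functions and the sign of the density\<close>

text \<open>
  Relates the iterated real derivatives in the definition of complete monotonicity to the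
  iterated complex derivatives of a holomorphic extension.
\<close>

lemma real_restriction_derivs:
  fixes G :: "complex \<Rightarrow> complex" and f :: "real \<Rightarrow> real"
  assumes hol: "G holomorphic_on {z. Re z > 0}" and real: "\<And>x. x > 0 \<Longrightarrow> G (of_real x) = of_real (f x)"
    and x: "x > 0"
  shows "(deriv ^^ n) G (of_real x) = of_real ((deriv ^^ n) f x) \<and> (deriv ^^ n) f differentiable (at x)"
proof -
  have op: "open {z. Re z > 0}" by (rule open_halfspace_Re_gt)
  have step: "(h has_real_derivative deriv h x) (at x) \<and> deriv H (of_real x) = of_real (deriv h x)"
    if H: "H holomorphic_on {z. Re z > 0}" and Hh: "\<And>x. x > 0 \<Longrightarrow> H (of_real x) = of_real (h x)" and x: "x > 0" for H h x
  proof -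
    have "(H has_field_derivative deriv H (of_real x)) (at (of_real x))"
      using holomorphic_derivI[OF H op, of "of_real x"] x by simp
    hence v: "((\<lambda>u. H (of_real u)) has_vector_derivative deriv H (of_real x)) (at x)"
      by (rule has_vector_derivative_real_field)
    have v': "((\<lambda>u. complex_of_real (h u)) has_vector_derivative deriv H (of_real x)) (at x)"
      by (rule has_vector_derivative_transform_within_open[OF v, of "{0<..}"]) (use x Hh in auto)
    have "(h has_real_derivative Re (deriv H (of_real x))) (at x)"
      using bounded_linear.has_vector_derivative[OF bounded_linear_Re v']
      by (simp add: has_real_derivative_iff_has_vector_derivative)
    hence d: "(h has_real_derivative deriv h x) (at x)" by (simp add: DERIV_imp_deriv)
    hence "((\<lambda>u. complex_of_real (h u)) has_vector_derivative of_real (deriv h x)) (at x)"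
      by (intro has_vector_derivative_of_real) (simp add: has_real_derivative_iff_has_vector_derivative)
    with v' have "deriv H (of_real x) = of_real (deriv h x)" by (rule vector_derivative_unique_at)
    with d show ?thesis by simp
  qed
  have all: "\<forall>x>0. (deriv ^^ n) G (of_real x) = of_real ((deriv ^^ n) f x)" for n
  proof (induction n)
    case (Suc n)
    thus ?case using step[OF holomorphic_higher_deriv[OF hol op, of n]] by simp
  qed (simp add: real)
  show ?thesis
    using all step[OF holomorphic_higher_deriv[OF hol op, of n], of "(deriv ^^ n) f" x] x
    by (auto simp: real_differentiable_def)
qed

text \<open>
  The Taylor series about \<open>y\<close> converges in the disc of radius \<open>y\<close>, as this lies in the
  right half-plane. To the left of \<open>y\<close> all terms of the series of the \<open>m\<close>-th derivative
  have the sign \<open>(-1) ^ m\<close>.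
\<close>

lemma alternating_derivs_extend:
  fixes G :: "complex \<Rightarrow> complex" and f :: "real \<Rightarrow> real"
  assumes hol: "G holomorphic_on {z. Re z > 0}" and real: "\<And>x. x > 0 \<Longrightarrow> G (of_real x) = of_real (f x)"
    and signs: "\<And>n. (-1) ^ n * (deriv ^^ n) f y \<ge> 0"
    and x: "0 < x" "x \<le> y"
  shows "(-1) ^ m * (deriv ^^ m) f x \<ge> 0"
proof -
  have op: "open {z. Re z > 0}" by (rule open_halfspace_Re_gt)
  have y: "y > 0" using x by simp
  have R: "(deriv ^^ n) G (of_real u) = of_real ((deriv ^^ n) f u)" if "u > 0" for n u
    using real_restriction_derivs[OF hol real that] by blast
  have sub: "ball (of_real y) y \<subseteq> {z. Re z > 0}"
  proof
    fix z assume "z \<in> ball (complex_of_real y) y"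
    hence "\<bar>Re (of_real y - z)\<bar> < y" using abs_Re_le_cmod[of "of_real y - z"] by (simp add: dist_norm)
    thus "z \<in> {z. Re z > 0}" by simp
  qed
  have hol_m: "(deriv ^^ m) G holomorphic_on ball (of_real y) y"
    using holomorphic_higher_deriv[OF hol op] sub by (rule holomorphic_on_subset)
  have "(\<lambda>n. (deriv ^^ n) ((deriv ^^ m) G) (of_real y) / fact n * (of_real x - of_real y) ^ n) sums
      (deriv ^^ m) G (of_real x)"
    using x by (intro holomorphic_power_series[OF hol_m]) (simp add: dist_real_def flip: of_real_diff)
  moreover have "(deriv ^^ n) ((deriv ^^ m) G) (of_real y) / fact n * (of_real x - of_real y) ^ n =
      of_real ((deriv ^^ (n + m)) f y / fact n * (x - y) ^ n)" for n
    using R[OF y, of "n + m"] by (simp add: funpow_add)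
  moreover have "(deriv ^^ m) G (of_real x) = of_real ((deriv ^^ m) f x)" using R[OF x(1)] .
  ultimately have "(\<lambda>n. complex_of_real ((deriv ^^ (n + m)) f y / fact n * (x - y) ^ n)) sums
      of_real ((deriv ^^ m) f x)" by (simp only:)
  hence "(\<lambda>n. (deriv ^^ (n + m)) f y / fact n * (x - y) ^ n) sums (deriv ^^ m) f x"
    by (simp only: sums_of_real_iff)
  hence s: "(\<lambda>n. (-1) ^ m * ((deriv ^^ (n + m)) f y / fact n * (x - y) ^ n)) sums ((-1) ^ m * (deriv ^^ m) f x)"
    by (rule sums_mult)
  have nonneg: "(-1) ^ m * ((deriv ^^ (n + m)) f y / fact n * (x - y) ^ n) \<ge> 0" for n
  proof -
    have "x - y = (-1) * (y - x)" by simp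
    hence "(x - y) ^ n = (-1) ^ n * (y - x) ^ n" by (simp only: power_mult_distrib)
    hence "(-1) ^ m * ((deriv ^^ (n + m)) f y / fact n * (x - y) ^ n) =
       ((-1) ^ (n + m) * (deriv ^^ (n + m)) f y) * ((y - x) ^ n / fact n)"
      by (simp add: power_add)
    moreover have "((-1) ^ (n + m) * (deriv ^^ (n + m)) f y) * ((y - x) ^ n / fact n) \<ge> 0"
      using x by (intro mult_nonneg_nonneg signs) auto
    ultimately show ?thesis by (simp only:)
  qed
  show ?thesis using sums_le[OF nonneg sums_zero s] .
qed

lemma F_eq_E_complex:
  assumes a: "a > 0" and x: "x > 0"
  shows "E_complex a c (of_real x / of_real a) = of_real (F a (- c) x)"
proof -
  have p: "1 + a / x > 0" using a x by (simp add: add_pos_pos)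
  have "Ln (1 + 1 / (of_real x / of_real a)) = Ln (of_real (1 + a / x))" using a x by simp
  also have "\<dots> = of_real (ln (1 + a / x))" using p by (rule Ln_of_real)
  finally have "E_complex a c (of_real x / of_real a) = exp (of_real ((x - c) * ln (1 + a / x)))"
    using a by (simp add: E_complex_def)
  also have "\<dots> = of_real (exp ((x - c) * ln (1 + a / x)))" by (rule exp_of_real)
  also have "exp ((x - c) * ln (1 + a / x)) = F a (- c) x"
    using p by (simp add: F_def powr_def)
  finally show ?thesis .
qed

lemma F_extension_holomorphic:
  assumes a: "a > 0"
  shows "(\<lambda>z. E_complex a c (z / of_real a)) holomorphic_on {z. Re z > 0}"
proof (rule holomorphic_on_compose_gen[OF _ E_complex_holomorphic, unfolded o_def])
  show "(\<lambda>z. z / of_real a) holomorphic_on {z. Re z > 0}"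
    using a by (intro holomorphic_intros) auto
  show "(\<lambda>z. z / of_real a) ` {z. Re z > 0} \<subseteq> - cut"
  proof (rule image_subsetI)
    fix z assume "z \<in> {z. Re z > 0}"
    hence "Re (z / of_real a) > 0" using a by simp
    moreover have "w \<notin> cut" if "Re w > 0" for w using that by (auto simp: cut_def)
    ultimately show "z / of_real a \<in> - cut" by blast
  qed
qed

text \<open>
  For large arguments, the derivatives of \<open>F\<close> are the series \<open>laplace_deriv\<close> for the
  density up to rescaling. Their signs determine those of the density by the Post-Widder
  formula, and are determined by them since they are Laplace integrals. Complete monotonicity
  at large arguments extends to the half-line by Taylor expansion.
\<close>

theorem bernstein_F_iff:
  assumes a: "a > 0" and c: "c \<ge> 0"
  shows "bernstein_function (F a (- c)) \<longleftrightarrow> (\<forall>t\<ge>0. E_density a c t \<ge> 0)"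
proof -
  let ?F = "F a (- c)"
  define B where "B = 1 + (\<bar>a\<bar> + \<bar>c\<bar>)"
  define y where "y = (\<lambda>j. exp a * a ^ (j + 1) * E_density_coeff a c j)"
  define M where "M = a * B"
  have B: "B \<ge> 1" by (simp add: B_def)
  have M: "M > 0" using a B by (simp add: M_def)
  have yb: "geo_bounded (exp a * a * B) M y"
    unfolding geo_bounded_def
  proof (intro conjI allI)
    fix n
    have "\<bar>y n\<bar> = exp a * a ^ (n + 1) * \<bar>E_density_coeff a c n\<bar>" using a by (simp add: y_def abs_mult)
    also have "\<dots> \<le> exp a * a ^ (n + 1) * (B * B ^ n)"
      using a E_density_geo_bounded[of a c] unfolding geo_bounded_def B_def
      by (intro mult_left_mono) auto
    finally show "\<bar>y n\<bar> \<le> exp a * a * B * M ^ n" by (simp add: M_def power_mult_distrib mult_ac)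
  qed fact
  have egf_y: "egf y t = exp a * a * E_density a c (a * t)" for t
  proof -
    have "(\<lambda>n. exp a * a * (E_density_coeff a c n * (a * t) ^ n / fact n)) sums (exp a * a * E_density a c (a * t))"
      unfolding E_density_def by (intro sums_mult egf_sums[OF E_density_geo_bounded])
    thus ?thesis by (simp add: egf_def y_def sums_iff power_mult_distrib mult_ac)
  qed
  have F_laplace: "?F x = exp a - laplace_deriv y 0 x" if x: "x > M" for x
  proof -
    have x0: "x > 0" using x M by simp
    have xa: "norm (complex_of_real x / of_real a) > 1 + (\<bar>a\<bar> + \<bar>c\<bar>)"
      using x a x0 by (simp add: norm_divide M_def B_def field_simps)
    have "(\<lambda>n. complex_of_real (exp a * fps_nth (E_fps a c) n * (a / x) ^ n)) sums of_real (?F x)"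
      using E_complex_expansion[OF xa] F_eq_E_complex[OF a x0, of c] by simp
    hence "(\<lambda>n. exp a * fps_nth (E_fps a c) n * (a / x) ^ n) sums ?F x"
      by (simp only: sums_of_real_iff)
    hence "(\<lambda>n. exp a * fps_nth (E_fps a c) (Suc n) * (a / x) ^ Suc n) sums (?F x - exp a)"
      by (subst sums_Suc_iff) simp
    hence "(\<lambda>n. - (exp a * fps_nth (E_fps a c) (Suc n) * (a / x) ^ Suc n)) sums - (?F x - exp a)"
      by (rule sums_minus)
    moreover have "- (exp a * fps_nth (E_fps a c) (Suc n) * (a / x) ^ Suc n) = y n * (fact (0 + n) / fact n) / x ^ (0 + n + 1)" for n
      by (simp add: y_def E_density_coeff_def power_divide)
    ultimately show ?thesis by (simp add: laplace_deriv_def sums_iff)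
  qed
  have derivs: "(deriv ^^ Suc n) (?F) x = (-1) ^ n * laplace_deriv y (Suc n) x" if x: "x > M" for n x
    using x
  proof (induction n arbitrary: x)
    case 0
    have "((\<lambda>x. exp a - laplace_deriv y 0 x) has_real_derivative 0 - (- laplace_deriv y (Suc 0) x)) (at x)"
      by (intro DERIV_diff DERIV_const has_real_derivative_laplace_deriv[OF yb 0])
    hence "deriv (\<lambda>x. exp a - laplace_deriv y 0 x) x = laplace_deriv y (Suc 0) x"
      by (intro DERIV_imp_deriv) simp
    moreover have "deriv (?F) x = deriv (\<lambda>x. exp a - laplace_deriv y 0 x) x"
      using eventually_nhds_in_open[of "{M<..}" x] 0
      by (intro deriv_cong_ev) (auto elim!: eventually_mono simp: F_laplace)
    ultimately show ?case by simp
  next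
    case (Suc n)
    have "((\<lambda>x. (-1) ^ n * laplace_deriv y (Suc n) x) has_real_derivative (-1) ^ n * (- laplace_deriv y (Suc (Suc n)) x)) (at x)"
      by (intro DERIV_cmult has_real_derivative_laplace_deriv[OF yb Suc.prems])
    hence "deriv (\<lambda>x. (-1) ^ n * laplace_deriv y (Suc n) x) x = (-1) ^ Suc n * laplace_deriv y (Suc (Suc n)) x"
      by (intro DERIV_imp_deriv) simp
    moreover have "deriv ((deriv ^^ Suc n) (?F)) x = deriv (\<lambda>x. (-1) ^ n * laplace_deriv y (Suc n) x) x"
      using eventually_nhds_in_open[of "{M<..}" x] Suc.prems
      by (intro deriv_cong_ev) (auto elim!: eventually_mono simp del: funpow.simps simp: Suc.IH)
    ultimately show ?case by simp
  qed
  have shift: "(deriv ^^ n) (deriv f) = (deriv ^^ Suc n) f" for n and f :: "real \<Rightarrow> real"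
    by (simp add: funpow_swap1)
  define G where "G = (\<lambda>z. E_complex a c (z / of_real a))"
  have G: "G holomorphic_on {z. Re z > 0}" unfolding G_def by (rule F_extension_holomorphic[OF a])
  have GF: "G (of_real x) = of_real (?F x)" if "x > 0" for x
    unfolding G_def by (rule F_eq_E_complex[OF a that])
  have G': "deriv G holomorphic_on {z. Re z > 0}"
    by (intro holomorphic_deriv G open_halfspace_Re_gt)
  have GF': "deriv G (of_real x) = of_real (deriv (?F) x)" if "x > 0" for x
    using real_restriction_derivs[OF G GF that, of 1] by simp
  show ?thesis
  proof
    assume bern: "bernstein_function (?F)"
    have "laplace_deriv y n x \<ge> 0" if n: "n \<ge> 1" and x: "M < x" for n x
    proof -
      obtain m where m: "n = Suc m" using n by (cases n) auto
      have "0 \<le> (-1) ^ m * (deriv ^^ m) (deriv (?F)) x"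
        using bern x M unfolding bernstein_function_def completely_monotone_def by auto
      also have "\<dots> = (-1) ^ m * ((-1) ^ m * laplace_deriv y (Suc m) x)"
        unfolding shift derivs[OF x] ..
      also have "\<dots> = laplace_deriv y n x" by (simp add: m flip: mult.assoc power_mult_distrib)
      finally show ?thesis .
    qed
    from post_widder_nonneg[OF yb this] have pos: "egf y t \<ge> 0" if "t > 0" for t using that by blast
    show "\<forall>t\<ge>0. E_density a c t \<ge> 0"
    proof (intro allI impI)
      fix t :: real assume t: "t \<ge> 0"
      show "E_density a c t \<ge> 0"
      proof (cases "t = 0")
        case True
        thus ?thesis using a c by (simp add: E_density_0)
      next
        case False
        hence "egf y (t / a) \<ge> 0" using t a by (intro pos) auto
        moreover have "exp a * a > 0" using a by simp
        ultimately show ?thesis using a zero_le_mult_iff_pos[of "exp a * a"] by (simp add: egf_y)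
      qed
    qed
  next
    assume nonneg: "\<forall>t\<ge>0. E_density a c t \<ge> 0"
    have signs: "(-1) ^ n * (deriv ^^ n) (deriv (?F)) x \<ge> 0" if x: "x > M" for n x
    proof -
      have "laplace_deriv y (Suc n) x \<ge> 0"
        using nonneg a by (intro laplace_deriv_nonneg[OF yb x]) (simp add: egf_y)
      moreover have "(-1) ^ n * (deriv ^^ n) (deriv (?F)) x = laplace_deriv y (Suc n) x"
        unfolding shift derivs[OF x] by (simp flip: mult.assoc power_mult_distrib)
      ultimately show ?thesis by simp
    qed
    have "(-1) ^ n * (deriv ^^ n) (deriv (?F)) x \<ge> 0" if x: "x > 0" for n x
    proof (rule alternating_derivs_extend[OF G' GF'])
      show "(-1) ^ k * (deriv ^^ k) (deriv (?F)) (max x M + 1) \<ge> 0" for k by (rule signs) auto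
    qed (use x in auto)
    moreover have "smooth_pos (?F)" "smooth_pos (deriv (?F))"
      unfolding smooth_pos_def
      using real_restriction_derivs[OF G GF] real_restriction_derivs[OF G' GF'] by blast+
    moreover have "?F x \<ge> 0" for x by (simp add: F_def)
    ultimately show "bernstein_function (?F)"
      unfolding bernstein_function_def completely_monotone_def by blast
  qed
qed

section \<open>Behaviour of D for large t\<close>

lemma bracket_nonneg: "exp r - 1 - r \<ge> (0::real)"
  using exp_ge_add_one_self[of r] by linarith

lemma bracket_mono:
  fixes r r' :: real
  assumes "0 \<le> r" "r \<le> r'"
  shows "exp r - 1 - r \<le> exp r' - 1 - r'"
proof -
  have "(\<lambda>x. exp x - 1 - x) r \<le> (\<lambda>x. exp x - 1 - x) r'"
  proof (rule DERIV_nonneg_imp_nondecreasing[OF assms(2)])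
    fix x assume "r \<le> x"
    moreover have "((\<lambda>x. exp x - 1 - x) has_real_derivative exp x - 1) (at x)"
      by (auto intro!: derivative_eq_intros)
    ultimately show "\<exists>y. ((\<lambda>x. exp x - 1 - x) has_real_derivative y) (at x) \<and> 0 \<le> y"
      using assms by (intro exI[of _ "exp x - 1"]) auto
  qed
  thus ?thesis by simp
qed

lemma exp_beats_quadratic:
  fixes C \<delta> P Q R :: real
  assumes "C > 0" "\<delta> > 0"
  shows "\<forall>\<^sub>F t in at_top. C * exp (\<delta> * t) - P * t ^ 2 - Q * t - R \<ge> 1"
proof -
  have "filterlim (\<lambda>t. C * exp (\<delta> * t) - P * t ^ 2 - Q * t - R) at_top at_top"
    using assms by real_asymp
  thus ?thesis by (simp add: filterlim_at_top)
qed

text \<open>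
  Near \<open>s = 0\<close> the exponent \<open>a * s + c\<close> is below 1 and hence \<open>w\<close> is positive, whereas
  for \<open>s \<ge> s0\<close> the integrand is at most of order \<open>exp ((1 - s0) * t) * t^2\<close>. The
  contribution of \<open>s0 / 4 \<le> s \<le> s0 / 2\<close> grows like \<open>exp ((1 - s0 / 2) * t)\<close> and
  dominates, uniformly in \<open>a\<close>.
\<close>

lemma D_eventually_ge_1:
  assumes c: "0 < c" "c < 1" and a': "0 < a'" "a' + c < 3"
  obtains T where "T \<ge> 0" "\<And>a t. 0 < a \<Longrightarrow> a \<le> a' \<Longrightarrow> t \<ge> T \<Longrightarrow> D a c t \<ge> 1"
proof -
  \<comment> \<open>ensures \<open>a * s + c \<le> (1 + c) / 2\<close> for all \<open>a \<le> a'\<close> and \<open>s \<le> s0\<close>\<close>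
  define s0 where "s0 = min (1 / 2) ((1 - c) / (2 * a'))"
  have s0: "0 < s0" "s0 \<le> 1 / 2" "a' * s0 \<le> (1 - c) / 2"
    using c a' by (auto simp: s0_def min_def field_simps)
  obtain m where m: "m > 0" "\<And>x. c \<le> x \<Longrightarrow> x \<le> (1 + c) / 2 \<Longrightarrow> sin (pi * x) \<ge> m"
  proof -
    have "\<exists>x\<in>{c..(1 + c) / 2}. \<forall>y\<in>{c..(1 + c) / 2}. sin (pi * x) \<le> sin (pi * y)"
      using c by (intro continuous_attains_inf continuous_intros) auto
    then obtain x where x: "x \<in> {c..(1 + c) / 2}" "\<And>y. y \<in> {c..(1 + c) / 2} \<Longrightarrow> sin (pi * x) \<le> sin (pi * y)"
      by blast
    have "sin (pi * x) > 0" using x c by (intro sin_gt_zero) auto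
    thus ?thesis using x by (intro that[of "sin (pi * x)"]) auto
  qed
  define d where "d = 2 - (a' + c)"
  have d: "d > -1" using a' by (simp add: d_def)
  define Id where "Id = (LINT s:{0<..<1}|lborel. (1 - s) powr d)"
  have Id0: "Id \<ge> 0" unfolding Id_def set_lebesgue_integral_def by (intro integral_nonneg_AE AE_I2) auto
  define w0 where "w0 = (s0 / 4) * m / pi"
  have w0: "w0 > 0" using s0 m by (simp add: w0_def)
  have exponent: "c \<le> a * s + c" "a * s + c \<le> (1 + c) / 2" if "0 < a" "a \<le> a'" "0 < s" "s \<le> s0" for a s
  proof -
    have "a * s \<le> a' * s0" using that by (intro mult_mono) auto
    thus "a * s + c \<le> (1 + c) / 2" using s0(3) by (simp add: field_simps)
  qed (use that in auto)
  have w_nonneg: "w a c s \<ge> 0" if "0 < a" "a \<le> a'" "0 < s" "s \<le> s0" for a s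
    using m(2)[OF exponent[OF that]] m(1) that s0 unfolding w_def
    by (intro mult_nonneg_nonneg) auto
  have w_lower: "w a c s \<ge> w0" if "0 < a" "a \<le> a'" "s0 / 4 \<le> s" "s \<le> s0" for a s
  proof -
    have s: "0 < s" "s \<le> s0" "s \<le> 1 / 2" using that s0 by auto
    note ex = exponent[OF that(1,2) s(1,2)]
    have "s0 / 4 = (s0 / 4) powr 1" using s0 by simp
    also have "\<dots> \<le> (s0 / 4) powr (a * s + c)" using s0 ex c by (intro powr_mono') auto
    also have "\<dots> \<le> (s / (1 - s)) powr (a * s + c)"
    proof (rule powr_mono2)
      have "s * (1 - s) \<le> s" using s by (simp add: algebra_simps)
      hence "s \<le> s / (1 - s)" using s by (simp add: pos_le_divide_eq)
      thus "s0 / 4 \<le> s / (1 - s)" using that by linarith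
    qed (use ex c s0 in auto)
    finally have "(s0 / 4) * m \<le> (s / (1 - s)) powr (a * s + c) * sin (pi * (a * s + c))"
      using m(2)[OF ex] m(1) s0 by (intro mult_mono) auto
    hence "(s0 / 4) * m / pi \<le> (s / (1 - s)) powr (a * s + c) * sin (pi * (a * s + c)) / pi"
      by (rule divide_right_mono) simp
    thus ?thesis by (simp add: w_def w0_def)
  qed
  define X where "X = (\<lambda>t. w0 * (exp ((1 - s0 / 2) * t) - 1 - (1 - s0 / 2) * t) * (s0 / 4) - Id * (exp ((1 - s0) * t) * t ^ 2))"
  have integral_lower: "(LINT s:{0<..<1}|lborel. w a c s * (exp ((1 - s) * t) - 1 - (1 - s) * t)) \<ge> X t"
    if a: "0 < a" "a \<le> a'" and t: "t \<ge> 0" for a t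
  proof -
    define g where "g = (\<lambda>s. w a c s * (exp ((1 - s) * t) - 1 - (1 - s) * t))"
    define Bt where "Bt = exp ((1 - s0 / 2) * t) - 1 - (1 - s0 / 2) * t"
    define Et where "Et = exp ((1 - s0) * t) * t ^ 2"
    have Bt: "Bt \<ge> 0" unfolding Bt_def by (rule bracket_nonneg)
    have Et: "Et \<ge> 0" unfolding Et_def by simp
    have i1: "set_integrable lborel {0<..<1} (\<lambda>s. Et * (1 - s) powr d)"
      by (intro set_integrable_mult_right one_minus_powr_integrable d)
    have sub: "indicator {0<..<1} s * (w0 * Bt * indicator {s0 / 4..s0 / 2} s) = w0 * Bt * indicator {s0 / 4..s0 / 2} s" for s :: real
      using s0 by (auto simp: indicator_def)
    have i2: "set_integrable lborel {0<..<1} (\<lambda>s. w0 * Bt * indicator {s0 / 4..s0 / 2} s)"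
      unfolding set_integrable_def real_scaleR_def sub
      using s0 by (intro integrable_mult_right integrable_real_indicator) auto
    have i3: "set_integrable lborel {0<..<1} g"
      unfolding g_def using a a' c by (intro w_bracket_integrable) auto
    have "(LINT s:{0<..<1}|lborel. w0 * Bt * indicator {s0 / 4..s0 / 2} s) = w0 * Bt * (s0 / 4)"
      unfolding set_lebesgue_integral_def real_scaleR_def sub using s0 by simp
    moreover have "(LINT s:{0<..<1}|lborel. Et * (1 - s) powr d) = Et * Id"
      unfolding Id_def by (rule set_integral_mult_right)
    moreover have "X t = w0 * Bt * (s0 / 4) - Et * Id" by (simp add: X_def Bt_def Et_def)
    ultimately have "(LINT s:{0<..<1}|lborel. w0 * Bt * indicator {s0 / 4..s0 / 2} s - Et * (1 - s) powr d) = X t"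
      by (simp only: set_integral_diff(2)[OF i2 i1])
    moreover have "(LINT s:{0<..<1}|lborel. w0 * Bt * indicator {s0 / 4..s0 / 2} s - Et * (1 - s) powr d) \<le> (LINT s:{0<..<1}|lborel. g s)"
    proof (rule set_integral_mono)
      fix s :: real assume "s \<in> {0<..<1}"
      hence s: "0 < s" "s < 1" by auto
      have br: "exp ((1 - s) * t) - 1 - (1 - s) * t \<ge> 0" by (rule bracket_nonneg)
      show "w0 * Bt * indicator {s0 / 4..s0 / 2} s - Et * (1 - s) powr d \<le> g s"
      proof (cases "s \<le> s0")
        case True
        have "w0 * Bt * indicator {s0 / 4..s0 / 2} s \<le> g s"
        proof (cases "s \<in> {s0 / 4..s0 / 2}")
          case in_core: True
          have "Bt \<le> exp ((1 - s) * t) - 1 - (1 - s) * t"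
            unfolding Bt_def using in_core t s0 by (intro bracket_mono mult_right_mono) auto
          hence "w0 * Bt \<le> g s" unfolding g_def
            using w_lower[OF a, of s] in_core s0 w0 Bt by (intro mult_mono) auto
          thus ?thesis using in_core by simp
        next
          case False
          have "g s \<ge> 0" unfolding g_def using br w_nonneg[OF a s(1) True] by (intro mult_nonneg_nonneg)
          thus ?thesis using False by simp
        qed
        moreover have "Et * (1 - s) powr d \<ge> 0" using Et by simp
        ultimately show ?thesis by linarith
      next
        case False
        have "\<bar>exp ((1 - s) * t) - 1 - (1 - s) * t\<bar> \<le> exp ((1 - s) * \<bar>t\<bar>) * t ^ 2 * (1 - s) ^ 2"
          using s by (intro bracket_bound) auto
        also have "\<dots> \<le> Et * (1 - s) ^ 2"
          unfolding Et_def using False t by (intro mult_right_mono) (auto simp: mult_right_mono)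
        finally have "\<bar>g s\<bar> \<le> (1 - s) powr (- (a' + c)) * (Et * (1 - s) ^ 2)"
          unfolding g_def abs_mult using s a c by (intro mult_mono w_bound) auto
        also have "\<dots> = Et * ((1 - s) powr (- (a' + c)) * (1 - s) powr 2)"
          using s by (simp add: powr_numeral)
        also have "(1 - s) powr (- (a' + c)) * (1 - s) powr 2 = (1 - s) powr d"
          unfolding powr_add[symmetric] d_def by (rule arg_cong) simp
        finally have "- (Et * (1 - s) powr d) \<le> g s" by linarith
        moreover have "indicator {s0 / 4..s0 / 2} s = (0 :: real)" using False s0 by (auto simp: indicator_def)
        ultimately show ?thesis by simp
      qed
    qed (use i1 i2 i3 in auto)
    ultimately show ?thesis by (simp add: g_def)
  qed
  define Q where "Q = q2 a' c"
  define k where "k = exp (- a')"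
  have k: "k > 0" by (simp add: k_def)
  have D_lower: "D a c t \<ge> k * X t - Q * t" if a: "0 < a" "a \<le> a'" and t: "t \<ge> 0" and X: "X t \<ge> 0" for a t
  proof -
    have "q1 a c \<ge> 0" using a c by (simp add: q1_def)
    moreover have "q2 a c \<le> Q"
      unfolding q2_def Q_def using a c by (intro add_mono mult_left_mono power_mono divide_right_mono) auto
    hence "(q1 a c - q2 a c) * t \<ge> (- Q) * t"
      using \<open>q1 a c \<ge> 0\<close> t by (intro mult_right_mono) auto
    moreover have "exp (- a) * (LINT s:{0<..<1}|lborel. w a c s * (exp ((1 - s) * t) - 1 - (1 - s) * t)) \<ge> k * X t"
      using integral_lower[OF a t] X a by (intro mult_mono) (auto simp: k_def)
    ultimately show ?thesis by (simp add: D_def)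
  qed
  define C where "C = k * w0 * (s0 / 4)"
  have C: "C > 0" using k w0 s0 by (simp add: C_def)
  have "\<forall>\<^sub>F t in at_top. C * exp ((s0 / 2) * t) - k * Id * t ^ 2 - (C + Q) * t - C \<ge> 1"
    using C s0 by (intro exp_beats_quadratic) auto
  then obtain T0 where T0: "\<And>t. t \<ge> T0 \<Longrightarrow> C * exp ((s0 / 2) * t) - k * Id * t ^ 2 - (C + Q) * t - C \<ge> 1"
    by (auto simp: eventually_at_top_linorder)
  have Q0: "Q \<ge> 0" unfolding Q_def q2_def using a' c by simp
  have main: "k * X t \<ge> 1 + Q * t" if t: "t \<ge> max 0 T0" for t
  proof -
    define e where "e = exp ((1 - s0) * t)"
    have e1: "e \<ge> 1" unfolding e_def using t s0 by simp
    have split: "exp ((1 - s0 / 2) * t) = e * exp ((s0 / 2) * t)"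
      by (simp add: e_def algebra_simps flip: exp_add)
    have "(1 - s0 / 2) * t \<le> t" using t s0 by (simp add: algebra_simps)
    moreover have "1 + t \<le> e * (1 + t)" using e1 t by simp
    ultimately have le: "1 + (1 - s0 / 2) * t \<le> e * (1 + t)" by linarith
    have "1 + Q * t \<le> e * (1 + Q * t)"
      using mult_right_mono[OF e1, of "1 + Q * t"] Q0 t by simp
    also have "\<dots> \<le> e * (C * exp ((s0 / 2) * t) - k * Id * t ^ 2 - C * t - C)"
      using T0[of t] t e1 by (intro mult_left_mono) (auto simp: algebra_simps)
    also have "\<dots> = C * (e * exp ((s0 / 2) * t)) - k * Id * (e * t ^ 2) - C * (e * (1 + t))"
      by (simp add: algebra_simps)
    also have "\<dots> \<le> C * (e * exp ((s0 / 2) * t)) - k * Id * (e * t ^ 2) - C * (1 + (1 - s0 / 2) * t)"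
      using le C by simp
    also have "\<dots> = k * X t"
      unfolding X_def split C_def e_def[symmetric] by (simp add: algebra_simps)
    finally show ?thesis .
  qed
  show ?thesis
  proof (rule that[of "max 0 T0"])
    fix a t assume a: "0 < a" "a \<le> a'" and t: "t \<ge> max 0 T0"
    have "k * X t \<ge> 0" using main[OF t] Q0 t by (smt (verit) max.bounded_iff mult_nonneg_nonneg)
    hence "X t \<ge> 0" using k by (simp add: zero_le_mult_iff)
    from D_lower[OF a _ this] main[OF t] t show "D a c t \<ge> 1" by simp
  qed simp
qed

text \<open>
  For \<open>a = 1 - c\<close> the argument of the sine in \<open>w\<close> stays in \<open>{0..pi}\<close>, so the integral is
  nonnegative, and so is the linear part.
\<close>

lemma D_pos_initial:
  assumes c: "0 < c" "c < 1" and t: "t \<ge> 0"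
  shows "D (1 - c) c t > 0"
proof -
  have q1: "q1 (1 - c) c > 0" using c by (simp add: q1_def add_nonneg_pos)
  have "q2 (1 - c) c \<le> q1 (1 - c) c"
  proof -
    have "q1 (1 - c) c - q2 (1 - c) c = (1 - c) * (1 + 3 * c) / 24"
      by (simp add: q1_def q2_def power2_eq_square field_simps)
    also have "\<dots> \<ge> 0" using c by simp
    finally show ?thesis by simp
  qed
  hence "(q1 (1 - c) c - q2 (1 - c) c) * t \<ge> 0" using t by simp
  moreover have "(LINT s:{0<..<1}|lborel. w (1 - c) c s * (exp ((1 - s) * t) - 1 - (1 - s) * t)) \<ge> 0"
    unfolding set_lebesgue_integral_def
  proof (intro integral_nonneg_AE AE_I2)
    fix s :: real
    have "w (1 - c) c s \<ge> 0" if "0 < s" "s < 1"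
    proof -
      have "(1 - c) * s \<le> (1 - c) * 1" using that c by (intro mult_left_mono) auto
      hence "(1 - c) * s + c \<le> 1" by simp
      hence "0 \<le> pi * ((1 - c) * s + c)" "pi * ((1 - c) * s + c) \<le> pi * 1"
        using that c by (simp, intro mult_left_mono) auto
      hence "0 \<le> sin (pi * ((1 - c) * s + c))" by (intro sin_ge_zero) (simp_all only: mult_1_right)
      thus ?thesis unfolding w_def by (intro mult_nonneg_nonneg) auto
    qed
    thus "0 \<le> indicat_real {0<..<1} s *\<^sub>R (w (1 - c) c s * (exp ((1 - s) * t) - 1 - (1 - s) * t))"
      using bracket_nonneg[of "(1 - s) * t"] by (auto simp: indicator_def)
  qed
  ultimately show ?thesis using q1 by (simp add: D_def add_pos_nonneg)
qed

section \<open>The threshold\<close>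

theorem proposition20:
  fixes b :: real
  assumes "-1 < b" and "b < 0"
  shows "A b = Sup {a \<in> {0<..<3 + b}. Psi b a \<ge> 0}
    \<and> A b = Sup {a \<in> {0<..<3 + b}. (INF t\<in>{0..}. ereal (D a (- b) t)) \<ge> 0}
    \<and> A b \<in> {0<..<3 + b}
    \<and> (\<forall>a. 0 < a \<and> a < A b \<longrightarrow> Psi b a > 0)
    \<and> Psi b (A b) = 0
    \<and> (\<forall>a. A b < a \<and> a < 3 + b \<longrightarrow> Psi b a < 0)
    \<and> (\<exists>t>0. ereal (D (A b) (- b) t) = (INF u\<in>{0..}. ereal (D (A b) (- b) u)))"
proof -
  define c where "c = - b"
  have c: "0 < c" "c < 1" and bc: "b = - c" using assms by (auto simp: c_def)
  define S where "S = {a. a > 0 \<and> (\<forall>t\<ge>0. E_density a c t \<ge> 0)}"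
  have A_eq: "A b = Sup S"
    unfolding A_def S_def bc using bernstein_F_iff c by (metis (no_types, lifting) less_imp_le)
  have D_eq: "D a c t = exp t * E_density a c t" if "0 < a" "a < 3 - c" for a t
    using that c by (intro D_eq_density) auto
  have cont_a: "isCont (\<lambda>a. E_density a c t) x" for x t
    using DERIV_isCont[OF E_density_line_deriv[of 0 1 c 0 t x]] by simp
  have first: "1 - c \<in> S"
  proof -
    have "E_density (1 - c) c t \<ge> 0" if "t \<ge> 0" for t
      using D_pos_initial[OF c that] D_eq[of "1 - c" t] c by (simp add: zero_less_mult_iff)
    thus ?thesis using c by (simp add: S_def)
  qed
  have down: "E_density a c t > 0" if "x \<in> S" "0 < a" "a < x" "t \<ge> 0" for a x t
    using that c by (intro E_density_pos_down[of c a x t]) (auto simp: S_def)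
  obtain a1 where a1: "a1 < 3 - c" "\<And>a. a \<in> S \<Longrightarrow> a \<le> a1"
  proof -
    \<comment> \<open>the density is continuous in \<open>a\<close>, so the negative value persists slightly below \<open>3 - c\<close>\<close>
    obtain t where t: "t \<ge> 0" "E_density (3 - c) c t < 0"
      using E_density_neg_on_diagonal[of c] c by auto
    have "((\<lambda>a. E_density a c t) \<longlongrightarrow> E_density (3 - c) c t) (at_left (3 - c))"
      using cont_a[of "3 - c" t] by (simp add: isCont_def filterlim_at_split)
    hence "\<forall>\<^sub>F a in at_left (3 - c). E_density a c t < 0" using t(2) by (rule order_tendstoD)
    moreover have "\<forall>\<^sub>F a in at_left (3 - c). a \<in> {0<..<3 - c}"
      using c by (intro eventually_at_leftI[of 0]) auto
    ultimately have "\<forall>\<^sub>F a in at_left (3 - c). E_density a c t < 0 \<and> a \<in> {0<..<3 - c}" by (rule eventually_conj)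
    then obtain a1 where a1: "E_density a1 c t < 0" "0 < a1" "a1 < 3 - c"
      using eventually_happens[of _ "at_left (3 - c)"] by auto
    show ?thesis
    proof (rule that[OF a1(3)])
      fix a assume "a \<in> S"
      thus "a \<le> a1" using down[of a a1 t] a1 t by force
    qed
  qed
  have bdd: "bdd_above S" using a1(2) by (rule bdd_aboveI)
  define \<alpha> where "\<alpha> = Sup S"
  have "1 - c \<le> \<alpha>" unfolding \<alpha>_def by (rule cSup_upper[OF first bdd])
  hence \<alpha>0: "\<alpha> > 0" using c by simp
  have "\<alpha> \<le> a1" unfolding \<alpha>_def using first a1(2) by (intro cSup_least) auto
  hence \<alpha>3: "\<alpha> < 3 - c" using a1(1) by simp
  have pos_below: "E_density a c t > 0" if a: "0 < a" "a < \<alpha>" and t: "t \<ge> 0" for a t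
  proof -
    have "S \<noteq> {}" using first by blast
    then obtain x where "x \<in> S" "a < x" using a(2) less_cSup_iff[OF _ bdd, of a] unfolding \<alpha>_def by blast
    thus ?thesis using down a t by blast
  qed
  have nonneg: "E_density \<alpha> c t \<ge> 0" if "t \<ge> 0" for t
  proof (rule tendsto_lowerbound[of _ _ "at_left \<alpha>"])
    show "((\<lambda>a. E_density a c t) \<longlongrightarrow> E_density \<alpha> c t) (at_left \<alpha>)"
      using cont_a[of \<alpha> t] by (simp add: isCont_def filterlim_at_split)
    have "\<forall>\<^sub>F a in at_left \<alpha>. a \<in> {0<..<\<alpha>}" using \<alpha>0 by (intro eventually_at_leftI[of 0]) auto
    thus "\<forall>\<^sub>F a in at_left \<alpha>. 0 \<le> E_density a c t"
      by (rule eventually_mono) (use pos_below that in \<open>auto intro: less_imp_le\<close>)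
  qed simp
  have neg_above: "\<exists>t\<ge>0. E_density a c t < 0" if "a > \<alpha>" for a
  proof (rule ccontr)
    assume "\<not> ?thesis"
    hence "a \<in> S" using that \<alpha>0 by (auto simp: S_def not_less)
    thus False using cSup_upper[OF _ bdd, of a] that by (simp add: \<alpha>_def)
  qed
  have Psi_eq: "Psi b a = (INF t\<in>{0..}. ereal (D a c t))" for a by (simp add: Psi_def c_def)
  have Psi_pos: "Psi b a > 0" if a: "0 < a" "a < \<alpha>" for a
  proof -
    have a3: "a < 3 - c" using a \<alpha>3 by simp
    obtain T where T: "T \<ge> 0" "\<And>x t. 0 < x \<Longrightarrow> x \<le> a \<Longrightarrow> t \<ge> T \<Longrightarrow> D x c t \<ge> 1"
      by (rule D_eventually_ge_1[OF c a(1)]) (use a3 in auto)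
    have "continuous_on {0..T} (D a c)"
    proof -
      have "D a c = (\<lambda>t. exp t * E_density a c t)" using D_eq a a3 by auto
      thus ?thesis by (simp add: continuous_intros E_density_continuous_on)
    qed
    then obtain t0 where t0: "t0 \<in> {0..T}" "\<And>t. t \<in> {0..T} \<Longrightarrow> D a c t0 \<le> D a c t"
      using continuous_attains_inf[of "{0..T}" "D a c"] T(1) by auto
    have "D a c t0 > 0" using D_eq[OF a(1) a3, of t0] pos_below[OF a, of t0] t0(1) by simp
    have "ereal (min 1 (D a c t0)) \<le> Psi b a"
      unfolding Psi_eq
    proof (rule INF_greatest)
      fix t :: real assume "t \<in> {0..}"
      hence "min 1 (D a c t0) \<le> D a c t"
        using t0(2)[of t] T(2)[of a t] a by (cases "t \<le> T") auto
      thus "ereal (min 1 (D a c t0)) \<le> ereal (D a c t)" by (simp only: ereal_less_eq)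
    qed
    moreover have "ereal (min 1 (D a c t0)) > 0" using \<open>D a c t0 > 0\<close> by simp
    ultimately show ?thesis by (rule order_less_le_trans[rotated])
  qed
  have Psi_neg: "Psi b a < 0" if a: "\<alpha> < a" "a < 3 - c" for a
  proof -
    obtain t where t: "t \<ge> 0" "E_density a c t < 0" using neg_above[OF a(1)] by blast
    have "Psi b a \<le> ereal (D a c t)" unfolding Psi_eq using t by (intro INF_lower) auto
    also have "\<dots> < 0" using D_eq[of a t] a \<alpha>0 t by (simp add: mult_pos_neg)
    finally show ?thesis .
  qed
  have D_nonneg: "D \<alpha> c t \<ge> 0" if "t \<ge> 0" for t using D_eq[OF \<alpha>0 \<alpha>3] nonneg[OF that] by simp
  obtain t0 where t0: "t0 > 0" "D \<alpha> c t0 = 0"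
  proof -
    \<comment> \<open>Parameters decreasing to \<open>\<alpha>\<close> have negative values at arguments that stay bounded; a limit point of these is a zero for \<open>\<alpha>\<close>.\<close>
    define a2 where "a2 = (\<alpha> + (3 - c)) / 2"
    have a2: "\<alpha> < a2" "a2 < 3 - c" using \<alpha>3 by (auto simp: a2_def field_simps)
    obtain T where T: "T \<ge> 0" "\<And>a t. 0 < a \<Longrightarrow> a \<le> a2 \<Longrightarrow> t \<ge> T \<Longrightarrow> D a c t \<ge> 1"
      by (rule D_eventually_ge_1[OF c, of a2]) (use a2 \<alpha>0 in auto)
    define a where "a = (\<lambda>n. \<alpha> + (a2 - \<alpha>) / real (Suc n))"
    have a_range: "\<alpha> < a n" "a n \<le> a2" for n
    proof -
      have "(a2 - \<alpha>) / real (Suc n) > 0" using a2 by simp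
      moreover have "(a2 - \<alpha>) / real (Suc n) \<le> (a2 - \<alpha>) / 1"
        using a2 by (intro divide_left_mono) auto
      ultimately show "\<alpha> < a n" "a n \<le> a2" by (simp_all add: a_def)
    qed
    have a_lim: "a \<longlonglongrightarrow> \<alpha>"
    proof -
      have "(\<lambda>n. \<alpha> + (a2 - \<alpha>) / real (Suc n)) \<longlonglongrightarrow> \<alpha> + 0"
        by (intro tendsto_add tendsto_const LIMSEQ_Suc[OF lim_const_over_n])
      thus ?thesis by (simp add: a_def)
    qed
    have "\<exists>t\<in>{0..T}. E_density (a n) c t < 0" for n
    proof -
      obtain t where t: "t \<ge> 0" "E_density (a n) c t < 0" using neg_above a_range by blast
      have "D (a n) c t < 0" using D_eq[of "a n" t] a_range[of n] \<alpha>0 a2 t by (simp add: mult_pos_neg)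
      hence "t \<le> T" using T(2)[of "a n" t] a_range[of n] \<alpha>0 by (cases "t \<ge> T") auto
      thus ?thesis using t by auto
    qed
    then obtain \<tau> where \<tau>: "\<And>n. \<tau> n \<in> {0..T}" "\<And>n. E_density (a n) c (\<tau> n) < 0" by metis
    obtain t0 r where t0: "t0 \<in> {0..T}" "strict_mono r" "(\<tau> \<circ> r) \<longlonglongrightarrow> t0"
      using compact_imp_seq_compact[OF compact_Icc, of 0 T] \<tau>(1) unfolding seq_compact_def by blast
    have lim: "(\<lambda>n. (a (r n), \<tau> (r n))) \<longlonglongrightarrow> (\<alpha>, t0)"
      using LIMSEQ_subseq_LIMSEQ[OF a_lim t0(2)] t0(3) by (intro tendsto_Pair) (auto simp: o_def)
    have "continuous_on ({0..a2} \<times> {0..T}) (\<lambda>(u, t). E_density (0 + u * 1) (c + u * 0) t)"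
      by (rule E_density_line_continuous_on)
    hence cont: "continuous_on ({0..a2} \<times> {0..T}) (\<lambda>(u, t). E_density u c t)" by simp
    have "\<forall>n. (a (r n), \<tau> (r n)) \<in> {0..a2} \<times> {0..T}"
    proof
      fix n show "(a (r n), \<tau> (r n)) \<in> {0..a2} \<times> {0..T}"
        using a_range[of "r n"] \<tau>(1)[of "r n"] \<alpha>0 by simp
    qed
    moreover have "(\<alpha>, t0) \<in> {0..a2} \<times> {0..T}" using \<alpha>0 a2 t0(1) by simp
    ultimately have "(\<lambda>n. (\<lambda>(u, t). E_density u c t) (a (r n), \<tau> (r n))) \<longlonglongrightarrow> (\<lambda>(u, t). E_density u c t) (\<alpha>, t0)"
      using continuous_on_tendsto_compose[OF cont lim _ always_eventually] by blast
    hence "(\<lambda>n. E_density (a (r n)) c (\<tau> (r n))) \<longlonglongrightarrow> E_density \<alpha> c t0" by simp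
    hence "E_density \<alpha> c t0 \<le> 0"
      by (rule tendsto_upperbound) (auto intro!: always_eventually less_imp_le \<tau>(2))
    hence z: "E_density \<alpha> c t0 = 0" using nonneg[of t0] t0(1) by simp
    have "t0 \<noteq> 0" using z \<alpha>0 c by (auto simp: E_density_0)
    thus ?thesis using that[of t0] t0(1) z D_eq[OF \<alpha>0 \<alpha>3, of t0] by simp
  qed
  have Psi_\<alpha>: "Psi b \<alpha> = 0"
  proof (rule antisym)
    show "Psi b \<alpha> \<le> 0" unfolding Psi_eq using t0 INF_lower[of t0 "{0..}" "\<lambda>t. ereal (D \<alpha> c t)"]
      by (simp add: zero_ereal_def[symmetric])
    show "Psi b \<alpha> \<ge> 0" unfolding Psi_eq using D_nonneg by (intro INF_greatest) auto
  qed
  have set_eq: "{a \<in> {0<..<3 + b}. Psi b a \<ge> 0} = {0<..\<alpha>}"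
  proof (intro equalityI subsetI)
    fix a assume "a \<in> {a \<in> {0<..<3 + b}. Psi b a \<ge> 0}"
    thus "a \<in> {0<..\<alpha>}" using Psi_neg[of a] by (cases "a \<le> \<alpha>") (auto simp: c_def)
  next
    fix a assume "a \<in> {0<..\<alpha>}"
    hence a: "0 < a" "a \<le> \<alpha>" by auto
    have "Psi b a \<ge> 0"
    proof (cases "a = \<alpha>")
      case False
      thus ?thesis using Psi_pos[of a] a by (intro less_imp_le) simp
    qed (simp add: Psi_\<alpha>)
    thus "a \<in> {a \<in> {0<..<3 + b}. Psi b a \<ge> 0}" using a \<alpha>3 by (simp add: c_def)
  qed
  have A: "A b = \<alpha>" by (simp add: A_eq \<alpha>_def)
  have "Sup {a \<in> {0<..<3 + b}. Psi b a \<ge> 0} = \<alpha>"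
    unfolding set_eq using \<alpha>0 by (rule cSup_greaterThanAtMost)
  moreover have "{a \<in> {0<..<3 + b}. (INF t\<in>{0..}. ereal (D a (- b) t)) \<ge> 0} = {a \<in> {0<..<3 + b}. Psi b a \<ge> 0}"
    by (simp add: Psi_def)
  moreover have "\<alpha> \<in> {0<..<3 + b}" using \<alpha>0 \<alpha>3 by (simp add: c_def)
  moreover have "\<forall>a. \<alpha> < a \<and> a < 3 + b \<longrightarrow> Psi b a < 0" using Psi_neg by (auto simp: c_def)
  moreover have "ereal (D \<alpha> (- b) t0) = (INF u\<in>{0..}. ereal (D \<alpha> (- b) u))"
    using t0 Psi_\<alpha> by (simp add: Psi_def c_def zero_ereal_def[symmetric])
  ultimately show ?thesis unfolding A using Psi_pos Psi_\<alpha> t0(1) by auto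
qed

end
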